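(* The functors $\mathrm{Pred}(-)$, $\mathrm{Rel}(-;\mathbf 1)$, $\mathrm{Proj}(\ell^\infty(-))$, and $\mathrm{Fun}(-;`\mathbb B)$ are naturally isomorphic as contravariant functors from the category $\mathbf{qSet}$ of quantum sets and functions to the category of ortholattices and ortholattice morphisms.
   Context: A quantum set $\mathcal X$ is determined by a set $\mathrm{At}(\mathcal X)$ of nonzero finite-dimensional complex Hilbert spaces, called its atoms; $X\propto\mathcal X$ means $X\in\mathrm{At}(\mathcal X)$. A binary relation $R$ from $\mathcal X$ to $\mathcal Y$ assigns to each $X\propto\mathcal X$, $Y\propto\mathcal Y$ a linear subspace $R(X,Y)\le L(X,Y)$ of the space of linear operators $X\to Y$; $\mathrm{Rel}(\mathcal X;\mathcal Y)$ is the set of these. Composition: $(S\circ R)(X,Z)=\mathrm{span}\{sr : Y\propto\mathcal Y,\ s\in S(Y,Z),\ r\in R(X,Y)\}$. Identity: $I_{\mathcal X}(X,X)=\mathbb C\cdot 1_X$, $I_{\mathcal X}(X,X')=0$ for $X\ne X'$. Adjoint: $R^\dagger(Y,X)=\{r^\dagger: r\in R(X,Y)\}$. Order: $R\le S$ iff $R(X,Y)\le S(X,Y)$ for all $X,Y$. A function $F\colon\mathcal X\to\mathcal Y$ is a binary relation with $F^\dagger\circ F\ge I_{\mathcal X}$ and $F\circ F^\dagger\le I_{\mathcal Y}$; $\mathrm{Fun}(\mathcal X;\mathcal Y)$ is the set of functions. $\mathbf{qSet}$ is the category of quantum sets and functions; $*$ denotes its category-theoretic product, with projections $Q_1,Q_2$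 and pairing $\langle\cdot,\cdot\rangle$. $\mathbf 1$ is the quantum set whose only atom is $\mathbb C$. An ortholattice is a bounded lattice (not necessarily distributive) with an orthocomplementation; an ortholattice morphism preserves meets, joins, orthocomplements, top and bottom. $\mathrm{Pred}(\mathcal X)$: a predicate $P$ on $\mathcal X$ assigns to each $X\propto\mathcal X$ a subspace $P(X)\le X$; order and orthocomplement are atomwise. A function $F\colon\mathcal X\to\mathcal Y$ acts by inverse image: for $P\in\mathrm{Pred}(\mathcal Y)$, $F^\star(P)(X)=\mathrm{span}\{r^\dagger y: Y\propto\mathcal Y,\ y\in P(Y),\ r\in F(X,Y)\}$. $\mathrm{Rel}(\mathcal X;\mathbf 1)$: order and orthocomplement are atomwise, $(\neg R)(X,\mathbb C)=R(X,\mathbb C)^\perp$ in the dual Hilbert space $L(X,\mathbb C)$; functions act by precomposition. $\mathrm{Proj}(\ell^\infty(\mathcal X))$: $\ell(\mathcal X)=\prod_{X\propto\mathcal X}L(X)$ and $\ell^\infty(\mathcal X)=\{a\in\ell(\mathcal X):\sup_X\|a(X)\|<\infty\}$, a von Neumann algebra; $\mathrm{Proj}$ is its ortholattice of projections. A function $F\colon\mathcal X\to\mathcal Y$ acts by restricting the unital normal $*$-homomorphism $F^\star\colon\ell^\infty(\mathcal Y)\to\ell^\infty(\mathcal X)$, $F^\star(b)(X)=\sum_{Y\propto\mathcal Y}\sum_{v\in B_X^Y}v^\dagger b(Y)v$, where $B_X^Y$ is any orthonormal basis of $F(X,Y)$ for the inner product defined by $(v|v')1_Y=v'v^\dagger$.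 $\mathrm{Fun}(\mathcal X;`\mathbb B)$: $\mathbb B=\{0,1\}$ and $`\mathbb B$ is the quantum set with exactly two atoms $\mathbb C_0=\ell^2(\{0\})$ and $\mathbb C_1=\ell^2(\{1\})$. Let $t\in\ell(`\mathbb B)$ be given by $t(\mathbb C_\alpha)=\alpha$. For each quantum set $\mathcal X$ and each projection $p\in\ell^\infty(\mathcal X)$ there is a unique function $F\colon\mathcal X\to`\mathbb B$ with $F^\star(t)=p$; hence one defines $\vee,\wedge\colon`\mathbb B*`\mathbb B\to`\mathbb B$ by $\vee^\star(t)=Q_1^\star(t)\vee Q_2^\star(t)$, $\wedge^\star(t)=Q_1^\star(t)\wedge Q_2^\star(t)$, and $\sim\colon`\mathbb B\to`\mathbb B$ by $\sim^\star(t)=1-t$. For $F_1,F_2\in\mathrm{Fun}(\mathcal X;`\mathbb B)$ put $F_1\vee F_2=\vee\circ\langle F_1,F_2\rangle$, $F_1\wedge F_2=\wedge\circ\langle F_1,F_2\rangle$, orthocomplement $\sim F_1=\sim\circ F_1$, and $F_1\le F_2$ iff $F_1\vee F_2=F_2$. Functions act by precomposition. *)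

theory Defs
  imports "Jordan_Normal_Form.VS_Connect" "HOL-Algebra.Lattice"
begin

section \<open>Finite-dimensional complex Hilbert spaces\<close>

text \<open>Scalars are \<^term>\<open>class_ring :: complex ring\<close>. The fields \<^term>\<open>mult\<close> and
  \<^term>\<open>one\<close> inherited from the record of modules carry no meaning. Records that differ only
  there, or outside the carrier, count as distinct copies of the same Hilbert space.\<close>

record 'v hilb = "(complex, 'v) module" +
  inner :: "'v \<Rightarrow> 'v \<Rightarrow> complex"

locale fd_hilbert = vectorspace "class_ring :: complex ring" H
  for H :: "'v hilb" (structure) +
  assumes finite_dimensional: "fin_dim"
    and inner_commute: "\<lbrakk>x \<in> carrier H; y \<in> carrier H\<rbrakk> \<Longrightarrow> inner H y x = cnj (inner H x y)"
    and inner_add_right: "\<lbrakk>x \<in> carrier H; y \<in> carrier H; z \<in> carrier H\<rbrakk>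
          \<Longrightarrow> inner H x (y \<oplus> z) = inner H x y + inner H x z"
    and inner_smult_right: "\<lbrakk>x \<in> carrier H; y \<in> carrier H\<rbrakk>
          \<Longrightarrow> inner H x (c \<odot> y) = c * inner H x y"
    and inner_pos: "\<lbrakk>x \<in> carrier H; x \<noteq> \<zero>\<rbrakk> \<Longrightarrow> Re (inner H x x) > 0"

definition hnorm :: "'v hilb \<Rightarrow> 'v \<Rightarrow> real" where
  "hnorm A x = sqrt (Re (inner A x x))"

abbreviation cspan :: "(complex, 'v, 'm) module_scheme \<Rightarrow> 'v set \<Rightarrow> 'v set" where
  "cspan V S \<equiv> LinearCombinations.module.span (class_ring :: complex ring) V S"

abbreviation csubspace :: "(complex, 'v, 'm) module_scheme \<Rightarrow> 'v set \<Rightarrow> bool" where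
  "csubspace V W \<equiv> VectorSpace.subspace (class_ring :: complex ring) W V"

definition orthcomp :: "'v hilb \<Rightarrow> 'v set \<Rightarrow> 'v set" where
  "orthcomp A S = {x \<in> carrier A. \<forall>y\<in>S. inner A y x = 0}"

text \<open>The space \<open>L(A,B)\<close> of linear operators. Operators are extensional (\<^term>\<open>undefined\<close> outside
  the domain), so that operators, relations and elements of \<open>\<ell>(X)\<close> are determined by their values.\<close>

definition lin_ops :: "'v hilb \<Rightarrow> 'w hilb \<Rightarrow> (complex, 'v \<Rightarrow> 'w) module" where
  "lin_ops A B = \<lparr>carrier = LinearCombinations.module_hom (class_ring :: complex ring) A B \<inter> extensional (carrier A),
     mult = (\<lambda>f g. \<lambda>x\<in>carrier A. \<zero>\<^bsub>B\<^esub>), one = (\<lambda>x\<in>carrier A. \<zero>\<^bsub>B\<^esub>),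
     zero = (\<lambda>x\<in>carrier A. \<zero>\<^bsub>B\<^esub>),
     add = (\<lambda>f g. \<lambda>x\<in>carrier A. f x \<oplus>\<^bsub>B\<^esub> g x),
     smult = (\<lambda>c f. \<lambda>x\<in>carrier A. c \<odot>\<^bsub>B\<^esub> f x)\<rparr>"

definition op_id :: "'v hilb \<Rightarrow> 'v \<Rightarrow> 'v" where
  "op_id A = (\<lambda>x\<in>carrier A. x)"

definition op_comp :: "'v hilb \<Rightarrow> ('w \<Rightarrow> 'u) \<Rightarrow> ('v \<Rightarrow> 'w) \<Rightarrow> 'v \<Rightarrow> 'u" where
  "op_comp A s r = FuncSet.compose (carrier A) s r"

definition op_adj :: "'v hilb \<Rightarrow> 'w hilb \<Rightarrow> ('v \<Rightarrow> 'w) \<Rightarrow> 'w \<Rightarrow> 'v" where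
  "op_adj A B r = (THE s. s \<in> carrier (lin_ops B A) \<and>
     (\<forall>x\<in>carrier A. \<forall>y\<in>carrier B. inner B (r x) y = inner A x (s y)))"

definition op_norm :: "'v hilb \<Rightarrow> ('v \<Rightarrow> 'v) \<Rightarrow> real" where
  "op_norm A a = (SUP x\<in>{x \<in> carrier A. hnorm A x \<le> 1}. hnorm A (a x))"

definition cplx :: "complex hilb" where
  "cplx = \<lparr>carrier = UNIV, mult = (*), one = 1, zero = 0, add = (+), smult = (*),
     inner = (\<lambda>x y. cnj x * y)\<rparr>"

definition ell2 :: "'i set \<Rightarrow> ('i \<Rightarrow> complex) hilb" where
  "ell2 S = \<lparr>carrier = extensional S,
     mult = (\<lambda>f g. \<lambda>i\<in>S. f i * g i), one = (\<lambda>i\<in>S. 1), zero = (\<lambda>i\<in>S. 0),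
     add = (\<lambda>f g. \<lambda>i\<in>S. f i + g i), smult = (\<lambda>c f. \<lambda>i\<in>S. c * f i),
     inner = (\<lambda>f g. \<Sum>i\<in>S. cnj (f i) * g i)\<rparr>" \<comment> \<open>used for finite \<open>S\<close>\<close>

text \<open>The dual Hilbert space \<open>L(A,\<complex>)\<close>: a functional \<open>r\<close> is \<open>inner A (r\<^sup>\<dagger> 1)\<close>, and the map
  sending \<open>r\<close> to \<open>r\<^sup>\<dagger> 1\<close> is antiunitary.\<close>

definition dual :: "'v hilb \<Rightarrow> ('v \<Rightarrow> complex) hilb" where
  "dual A = \<lparr>carrier = carrier (lin_ops A cplx),
     mult = mult (lin_ops A cplx), one = one (lin_ops A cplx), zero = zero (lin_ops A cplx),
     add = add (lin_ops A cplx), smult = smult (lin_ops A cplx),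
     inner = (\<lambda>r s. inner A (op_adj A cplx s 1) (op_adj A cplx r 1))\<rparr>"


section \<open>Quantum sets, binary relations and functions\<close>

text \<open>A quantum set is identified with its set of atoms. The carriers of the atoms of one quantum set
  are subsets of one type; this type is arbitrary, and it plays the role of the universe: the
  category of quantum sets over a type \<open>'v\<close> has the sets \<open>X :: 'v hilb set\<close> with
  \<open>qset X\<close> as objects. Relations may go between quantum sets over different types.\<close>

definition qset :: "'v hilb set \<Rightarrow> bool" where
  "qset X \<longleftrightarrow> (\<forall>A\<in>X. fd_hilbert A \<and> carrier A \<noteq> {\<zero>\<^bsub>A\<^esub>})"

type_synonym ('v, 'w) qrel = "'v hilb \<times> 'w hilb \<Rightarrow> ('v \<Rightarrow> 'w) set"

definition qRel :: "'v hilb set \<Rightarrow> 'w hilb set \<Rightarrow> ('v, 'w) qrel set" where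
  "qRel X Y = (\<Pi>\<^sub>E (A, B)\<in>X \<times> Y. {W. csubspace (lin_ops A B) W})"

definition rel_comp :: "'v hilb set \<Rightarrow> 'w hilb set \<Rightarrow> 'u hilb set
    \<Rightarrow> ('w, 'u) qrel \<Rightarrow> ('v, 'w) qrel \<Rightarrow> ('v, 'u) qrel" where
  "rel_comp X Y Z S R = (\<lambda>(A, C)\<in>X \<times> Z. cspan (lin_ops A C)
     {op_comp A s r | B s r. B \<in> Y \<and> s \<in> S (B, C) \<and> r \<in> R (A, B)})"

definition rel_id :: "'v hilb set \<Rightarrow> ('v, 'v) qrel" where
  "rel_id X = (\<lambda>(A, A')\<in>X \<times> X.
     if A = A' then {c \<odot>\<^bsub>lin_ops A A\<^esub> op_id A | c. True} else {\<zero>\<^bsub>lin_ops A A'\<^esub>})"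

definition rel_adj :: "'v hilb set \<Rightarrow> 'w hilb set \<Rightarrow> ('v, 'w) qrel \<Rightarrow> ('w, 'v) qrel" where
  "rel_adj X Y R = (\<lambda>(B, A)\<in>Y \<times> X. op_adj A B ` R (A, B))"

definition rel_le :: "'v hilb set \<Rightarrow> 'w hilb set \<Rightarrow> ('v, 'w) qrel \<Rightarrow> ('v, 'w) qrel \<Rightarrow> bool" where
  "rel_le X Y R S \<longleftrightarrow> (\<forall>A\<in>X. \<forall>B\<in>Y. R (A, B) \<subseteq> S (A, B))"

definition qFun :: "'v hilb set \<Rightarrow> 'w hilb set \<Rightarrow> ('v, 'w) qrel set" where
  "qFun X Y = {F \<in> qRel X Y.
     rel_le X X (rel_id X) (rel_comp X Y X (rel_adj X Y F) F) \<and>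
     rel_le Y Y (rel_comp Y X Y F (rel_adj X Y F)) (rel_id Y)}"


section \<open>Ortholattices\<close>

record 'a ortho = "'a gorder" +
  ojoin :: "'a \<Rightarrow> 'a \<Rightarrow> 'a"
  omeet :: "'a \<Rightarrow> 'a \<Rightarrow> 'a"
  ocompl :: "'a \<Rightarrow> 'a"

locale ortholattice = Lattice.bounded_lattice L for L :: "'a ortho" (structure) +
  assumes ojoin_eq: "\<lbrakk>x \<in> carrier L; y \<in> carrier L\<rbrakk> \<Longrightarrow> ojoin L x y = x \<squnion> y"
    and omeet_eq: "\<lbrakk>x \<in> carrier L; y \<in> carrier L\<rbrakk> \<Longrightarrow> omeet L x y = x \<sqinter> y"
    and ocompl_closed: "x \<in> carrier L \<Longrightarrow> ocompl L x \<in> carrier L"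
    and ocompl_involutive: "x \<in> carrier L \<Longrightarrow> ocompl L (ocompl L x) = x"
    and ocompl_antitone: "\<lbrakk>x \<in> carrier L; y \<in> carrier L; x \<sqsubseteq> y\<rbrakk> \<Longrightarrow> ocompl L y \<sqsubseteq> ocompl L x"
    and ocompl_join: "x \<in> carrier L \<Longrightarrow> x \<squnion> ocompl L x = \<top>"
    and ocompl_meet: "x \<in> carrier L \<Longrightarrow> x \<sqinter> ocompl L x = \<bottom>"

definition ortho_hom :: "'a ortho \<Rightarrow> 'b ortho \<Rightarrow> ('a \<Rightarrow> 'b) set" where
  "ortho_hom L M = {h \<in> carrier L \<rightarrow> carrier M.
     (\<forall>x\<in>carrier L. \<forall>y\<in>carrier L. h (ojoin L x y) = ojoin M (h x) (h y)) \<and>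
     (\<forall>x\<in>carrier L. \<forall>y\<in>carrier L. h (omeet L x y) = omeet M (h x) (h y)) \<and>
     (\<forall>x\<in>carrier L. h (ocompl L x) = ocompl M (h x)) \<and>
     h \<top>\<^bsub>L\<^esub> = \<top>\<^bsub>M\<^esub> \<and> h \<bottom>\<^bsub>L\<^esub> = \<bottom>\<^bsub>M\<^esub>}"

definition ortho_iso :: "'a ortho \<Rightarrow> 'b ortho \<Rightarrow> ('a \<Rightarrow> 'b) set" where
  "ortho_iso L M = {h \<in> ortho_hom L M. bij_betw h (carrier L) (carrier M) \<and>
     inv_into (carrier L) h \<in> ortho_hom M L}"

definition ortho_of_order :: "'a set \<Rightarrow> ('a \<Rightarrow> 'a \<Rightarrow> bool) \<Rightarrow> ('a \<Rightarrow> 'a) \<Rightarrow> 'a ortho" where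
  "ortho_of_order C le_op compl_op =
     (let L = \<lparr>carrier = C, eq = (=), le = le_op\<rparr>
      in \<lparr>carrier = C, eq = (=), le = le_op, ojoin = Lattice.join L, omeet = Lattice.meet L,
          ocompl = compl_op\<rparr>)"


section \<open>Contravariant functors from quantum sets to ortholattices\<close>

record ('v, 'a) qfunctor =
  obj :: "'v hilb set \<Rightarrow> 'a ortho"
  arr :: "'v hilb set \<Rightarrow> 'v hilb set \<Rightarrow> ('v, 'v) qrel \<Rightarrow> 'a \<Rightarrow> 'a"

definition contravariant_functor :: "('v, 'a) qfunctor \<Rightarrow> bool" where
  "contravariant_functor \<Phi> \<longleftrightarrow>
     (\<forall>X. qset X \<longrightarrow> ortholattice (obj \<Phi> X)) \<and>
     (\<forall>X Y. qset X \<and> qset Y \<longrightarrow>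
        (\<forall>F \<in> qFun X Y. arr \<Phi> X Y F \<in> ortho_hom (obj \<Phi> Y) (obj \<Phi> X))) \<and>
     (\<forall>X. qset X \<longrightarrow> (\<forall>a \<in> carrier (obj \<Phi> X). arr \<Phi> X X (rel_id X) a = a)) \<and>
     (\<forall>X Y Z. qset X \<and> qset Y \<and> qset Z \<longrightarrow>
        (\<forall>F \<in> qFun X Y. \<forall>G \<in> qFun Y Z. \<forall>a \<in> carrier (obj \<Phi> Z).
           arr \<Phi> X Z (rel_comp X Y Z G F) a = arr \<Phi> X Y F (arr \<Phi> Y Z G a)))"

definition naturally_isomorphic :: "('v, 'a) qfunctor \<Rightarrow> ('v, 'b) qfunctor \<Rightarrow> bool" where
  "naturally_isomorphic \<Phi> \<Psi> \<longleftrightarrow> (\<exists>\<eta>.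
     (\<forall>X. qset X \<longrightarrow> \<eta> X \<in> ortho_iso (obj \<Phi> X) (obj \<Psi> X)) \<and>
     (\<forall>X Y. qset X \<and> qset Y \<longrightarrow>
        (\<forall>F \<in> qFun X Y. \<forall>a \<in> carrier (obj \<Phi> Y).
           \<eta> X (arr \<Phi> X Y F a) = arr \<Psi> X Y F (\<eta> Y a))))"


section \<open>Predicates\<close>

definition Pred :: "'v hilb set \<Rightarrow> ('v hilb \<Rightarrow> 'v set) ortho" where
  "Pred X = ortho_of_order (\<Pi>\<^sub>E A\<in>X. {W. csubspace A W})
     (\<lambda>P Q. \<forall>A\<in>X. P A \<subseteq> Q A) (\<lambda>P. \<lambda>A\<in>X. orthcomp A (P A))"

definition pred_pullback :: "'v hilb set \<Rightarrow> 'w hilb set \<Rightarrow> ('v, 'w) qrel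
    \<Rightarrow> ('w hilb \<Rightarrow> 'w set) \<Rightarrow> 'v hilb \<Rightarrow> 'v set" where
  "pred_pullback X Y F P = (\<lambda>A\<in>X. cspan A
     {op_adj A B r y | B y r. B \<in> Y \<and> y \<in> P B \<and> r \<in> F (A, B)})"

definition PredF :: "('v, 'v hilb \<Rightarrow> 'v set) qfunctor" where
  "PredF = \<lparr>obj = Pred, arr = pred_pullback\<rparr>"


section \<open>Relations to the one-atom quantum set\<close>

definition q_one :: "complex hilb set" where
  "q_one = {cplx}"

definition Rel_one :: "'v hilb set \<Rightarrow> ('v, complex) qrel ortho" where
  "Rel_one X = ortho_of_order (qRel X q_one) (rel_le X q_one)
     (\<lambda>R. \<lambda>(A, B)\<in>X \<times> q_one. orthcomp (dual A) (R (A, B)))"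

definition RelF :: "('v, ('v, complex) qrel) qfunctor" where
  "RelF = \<lparr>obj = Rel_one, arr = (\<lambda>X Y F R. rel_comp X Y q_one R F)\<rparr>"


section \<open>Projections\<close>

definition ell :: "'v hilb set \<Rightarrow> ('v hilb \<Rightarrow> 'v \<Rightarrow> 'v) set" where
  "ell X = (\<Pi>\<^sub>E A\<in>X. carrier (lin_ops A A))"

definition ell_inf :: "'v hilb set \<Rightarrow> ('v hilb \<Rightarrow> 'v \<Rightarrow> 'v) set" where
  "ell_inf X = {a \<in> ell X. bdd_above ((\<lambda>A. op_norm A (a A)) ` X)}"

definition ell_mult :: "'v hilb set \<Rightarrow> ('v hilb \<Rightarrow> 'v \<Rightarrow> 'v) \<Rightarrow> ('v hilb \<Rightarrow> 'v \<Rightarrow> 'v)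
    \<Rightarrow> 'v hilb \<Rightarrow> 'v \<Rightarrow> 'v" where
  "ell_mult X a b = (\<lambda>A\<in>X. op_comp A (a A) (b A))"

definition ell_star :: "'v hilb set \<Rightarrow> ('v hilb \<Rightarrow> 'v \<Rightarrow> 'v) \<Rightarrow> 'v hilb \<Rightarrow> 'v \<Rightarrow> 'v" where
  "ell_star X a = (\<lambda>A\<in>X. op_adj A A (a A))"

definition ell_compl :: "'v hilb set \<Rightarrow> ('v hilb \<Rightarrow> 'v \<Rightarrow> 'v) \<Rightarrow> 'v hilb \<Rightarrow> 'v \<Rightarrow> 'v" where
  "ell_compl X a = (\<lambda>A\<in>X. op_id A \<ominus>\<^bsub>lin_ops A A\<^esub> a A)"

definition Proj :: "'v hilb set \<Rightarrow> ('v hilb \<Rightarrow> 'v \<Rightarrow> 'v) ortho" where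
  "Proj X = ortho_of_order {p \<in> ell_inf X. ell_mult X p p = p \<and> ell_star X p = p}
     (\<lambda>p q. ell_mult X p q = p) (ell_compl X)"

text \<open>The inner product on \<open>F(A,B)\<close> given by \<open>(v|v') 1\<^sub>B = v' v\<^sup>\<dagger>\<close>; the scalar exists whenever
  \<open>F\<close> is a function and \<open>v, v' \<in> F(A,B)\<close>.\<close>

definition fun_inner :: "'v hilb \<Rightarrow> 'w hilb \<Rightarrow> ('v \<Rightarrow> 'w) \<Rightarrow> ('v \<Rightarrow> 'w) \<Rightarrow> complex" where
  "fun_inner A B v v' =
     (THE c. op_comp B v' (op_adj A B v) = c \<odot>\<^bsub>lin_ops B B\<^esub> op_id B)"

definition is_onb :: "'v hilb \<Rightarrow> 'w hilb \<Rightarrow> ('v \<Rightarrow> 'w) set \<Rightarrow> ('v \<Rightarrow> 'w) set \<Rightarrow> bool" where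
  "is_onb A B W E \<longleftrightarrow> finite E \<and> E \<subseteq> W \<and> cspan (lin_ops A B) E = W \<and>
     (\<forall>v\<in>E. \<forall>v'\<in>E. fun_inner A B v v' = (if v = v' then 1 else 0))"

definition some_onb :: "'v hilb \<Rightarrow> 'w hilb \<Rightarrow> ('v \<Rightarrow> 'w) set \<Rightarrow> ('v \<Rightarrow> 'w) set" where
  "some_onb A B W = (SOME E. is_onb A B W E)"

text \<open>The sum below does not depend on the choice of the orthonormal bases.
  For fixed \<open>A\<close> only finitely many \<open>F(A,B)\<close> are nonzero; the others contribute empty
  inner sums and are left out because \<^const>\<open>finsum\<close> is zero on infinite index sets.\<close>

definition fun_star :: "'v hilb set \<Rightarrow> 'w hilb set \<Rightarrow> ('v, 'w) qrel
    \<Rightarrow> ('w hilb \<Rightarrow> 'w \<Rightarrow> 'w) \<Rightarrow> 'v hilb \<Rightarrow> 'v \<Rightarrow> 'v" where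
  "fun_star X Y F b = (\<lambda>A\<in>X.
     \<Oplus>\<^bsub>lin_ops A A\<^esub> B \<in> {B \<in> Y. F (A, B) \<noteq> {\<zero>\<^bsub>lin_ops A B\<^esub>}}.
       \<Oplus>\<^bsub>lin_ops A A\<^esub> v \<in> some_onb A B (F (A, B)).
         op_comp A (op_adj A B v) (op_comp A (b B) v))"

definition ProjF :: "('v, 'v hilb \<Rightarrow> 'v \<Rightarrow> 'v) qfunctor" where
  "ProjF = \<lparr>obj = Proj, arr = fun_star\<rparr>"


section \<open>Functions to the two-element classical quantum set\<close>

definition q_bool :: "(nat \<Rightarrow> complex) hilb set" where
  "q_bool = {ell2 {\<alpha>} | \<alpha>. \<alpha> \<in> {0, 1}}"

definition q_true :: "(nat \<Rightarrow> complex) hilb \<Rightarrow> (nat \<Rightarrow> complex) \<Rightarrow> nat \<Rightarrow> complex" where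
  "q_true = (\<lambda>A\<in>q_bool. if A = ell2 {1} then op_id A else \<zero>\<^bsub>lin_ops A A\<^esub>)"

text \<open>The product in the category of quantum sets. The product object \<open>P\<close> and the test objects
  \<open>Z\<close> range over the quantum sets over the same type \<open>'v\<close>. A type \<open>'v\<close> over which a nonempty
  quantum set exists has at least the cardinality of the continuum and then carries a product of
  \<^const>\<open>q_bool\<close> with itself; otherwise the empty quantum set is the product.\<close>

definition is_qprod :: "'a hilb set \<Rightarrow> 'b hilb set
    \<Rightarrow> 'v hilb set \<times> ('v, 'a) qrel \<times> ('v, 'b) qrel \<Rightarrow> bool" where
  "is_qprod X Y = (\<lambda>(P, Q1, Q2). qset P \<and> Q1 \<in> qFun P X \<and> Q2 \<in> qFun P Y \<and>
     (\<forall>Z :: 'v hilb set. qset Z \<longrightarrow> (\<forall>F1 \<in> qFun Z X. \<forall>F2 \<in> qFun Z Y.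
        \<exists>!G. G \<in> qFun Z P \<and> rel_comp Z P X Q1 G = F1 \<and> rel_comp Z P Y Q2 G = F2)))"

definition bb_prod :: "'v hilb set \<times> ('v, nat \<Rightarrow> complex) qrel \<times> ('v, nat \<Rightarrow> complex) qrel" where
  "bb_prod = (SOME T. is_qprod q_bool q_bool T)"

definition BB :: "'v hilb set" where
  "BB = fst bb_prod"

definition BQ1 :: "('v, nat \<Rightarrow> complex) qrel" where
  "BQ1 = fst (snd bb_prod)"

definition BQ2 :: "('v, nat \<Rightarrow> complex) qrel" where
  "BQ2 = snd (snd bb_prod)"

definition bb_pair :: "'v hilb set \<Rightarrow> ('v, nat \<Rightarrow> complex) qrel \<Rightarrow> ('v, nat \<Rightarrow> complex) qrel
    \<Rightarrow> ('v, 'v) qrel" where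
  "bb_pair X F1 F2 = (THE G. G \<in> qFun X BB \<and>
     rel_comp X BB q_bool BQ1 G = F1 \<and> rel_comp X BB q_bool BQ2 G = F2)"

definition q_or :: "('v, nat \<Rightarrow> complex) qrel" where
  "q_or = (THE V. V \<in> qFun BB q_bool \<and> fun_star BB q_bool V q_true =
     ojoin (Proj BB) (fun_star BB q_bool BQ1 q_true) (fun_star BB q_bool BQ2 q_true))"

definition q_and :: "('v, nat \<Rightarrow> complex) qrel" where
  "q_and = (THE V. V \<in> qFun BB q_bool \<and> fun_star BB q_bool V q_true =
     omeet (Proj BB) (fun_star BB q_bool BQ1 q_true) (fun_star BB q_bool BQ2 q_true))"

definition q_not :: "(nat \<Rightarrow> complex, nat \<Rightarrow> complex) qrel" where
  "q_not = (THE V. V \<in> qFun q_bool q_bool \<and>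
     fun_star q_bool q_bool V q_true = ell_compl q_bool q_true)"

definition fun_or :: "'v hilb set \<Rightarrow> ('v, nat \<Rightarrow> complex) qrel \<Rightarrow> ('v, nat \<Rightarrow> complex) qrel
    \<Rightarrow> ('v, nat \<Rightarrow> complex) qrel" where
  "fun_or X F1 F2 = rel_comp X BB q_bool q_or (bb_pair X F1 F2)"

definition fun_and :: "'v hilb set \<Rightarrow> ('v, nat \<Rightarrow> complex) qrel \<Rightarrow> ('v, nat \<Rightarrow> complex) qrel
    \<Rightarrow> ('v, nat \<Rightarrow> complex) qrel" where
  "fun_and X F1 F2 = rel_comp X BB q_bool q_and (bb_pair X F1 F2)"

definition fun_not :: "'v hilb set \<Rightarrow> ('v, nat \<Rightarrow> complex) qrel \<Rightarrow> ('v, nat \<Rightarrow> complex) qrel" where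
  "fun_not X F = rel_comp X q_bool q_bool q_not F"

definition Fun_bool :: "'v hilb set \<Rightarrow> ('v, nat \<Rightarrow> complex) qrel ortho" where
  "Fun_bool X = \<lparr>carrier = qFun X q_bool, eq = (=), le = (\<lambda>F1 F2. fun_or X F1 F2 = F2),
     ojoin = fun_or X, omeet = fun_and X, ocompl = fun_not X\<rparr>"

definition FunF :: "('v, ('v, nat \<Rightarrow> complex) qrel) qfunctor" where
  "FunF = \<lparr>obj = Fun_bool, arr = (\<lambda>X Y F G. rel_comp X Y q_bool G F)\<rparr>"

end

theory Submission
  imports Defs "Jordan_Normal_Form.Spectral_Radius"
begin

text \<open>A relation \<open>F\<close> from \<open>X\<close> to \<open>Y\<close> is a function iff, for all \<open>r \<in> F(A,B)\<close> and \<open>s \<in> F(A,B')\<close>, the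
  operator \<open>s r\<^sup>\<dagger>\<close> is a scalar (zero if \<open>B \<noteq> B'\<close>), and the operators in \<open>F(A,-)\<close> have no common
  kernel. Therefore \<open>F\<^sup>\<star>(P)(A)\<close> consists of the vectors \<open>x\<close> with \<open>r x \<in> P(B)\<close> for all \<open>r \<in> F(A,B)\<close>,
  and \<open>F\<^sup>\<star>(b)\<close> is the only family \<open>a\<close> with \<open>r a(A) = b(B) r\<close> for all \<open>r \<in> F(A,B)\<close>. In this form the
  identification of predicates with functionals and with projections is visibly natural, and the
  ortholattice and functor laws are transported from the predicates.

  A projection \<open>p\<close> on \<open>X\<close> gives the function to the two-element quantum set whose elements are
  the operators that intertwine \<open>p\<close> with \<open>t\<close>. In the same way two projections \<open>p\<close>, \<open>q\<close> on \<open>X\<close> give a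
  function to the quantum set \<open>B\<close> of representatives of the irreducible pairs of projections on the
  spaces over the universe: its elements are the operators intertwining the pairs, Schur's lemma
  makes them functional, and complete reducibility makes their common kernel trivial. So \<open>B\<close> is the
  product of the two-element quantum set with itself, and the connectives defined through it
  correspond to the lattice operations on projections.\<close>

section \<open>Finite-dimensional Hilbert spaces\<close>

text \<open>Everything lives over one type, and this shapes the product. The type need not contain
  any prescribed model such as the plane, so pairs of projections are not classified: an irreducible
  pair is taken where it occurs, on a minimal invariant subspace of an atom, which is again a
  Hilbert space over the type. Over a type without nonzero Hilbert spaces the construction yields
  the empty quantum set. The connectives are defined from a chosen product of which only the
  universal property is known. They are evaluated by pulling projections back along the pairing, and
  this is an ortholattice morphism by functoriality, since the product lies over the same type as
  the given quantum set.

  Self-adjointness of projections is what makes intertwiners functional: if r and s intertwine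
  projections on A with projections on B and B', then s r^dagger intertwines those on B with those
  on B', a condition on the target alone.\<close>

abbreviation cvs :: "(complex, 'v, 'm) module_scheme \<Rightarrow> bool" where
  "cvs V \<equiv> vectorspace (class_ring :: complex ring) V"

abbreviation ops :: "'v hilb \<Rightarrow> 'w hilb \<Rightarrow> ('v \<Rightarrow> 'w) set" where
  "ops A B \<equiv> carrier (lin_ops A B)"

lemma cvs_module: "cvs V \<Longrightarrow> Module.module (class_ring :: complex ring) V"
  by (simp add: vectorspace_def)

lemma cvs_abelian_group: "cvs V \<Longrightarrow> abelian_group V"
  by (drule cvs_module) (simp add: Module.module_def)

lemma fd_hilbert_cvs [simp]: "fd_hilbert H \<Longrightarrow> cvs H"
  by (simp add: fd_hilbert_def)

context
  fixes V :: "(complex, 'v, 'm) module_scheme" (structure)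
  assumes V [simp]: "cvs V"
begin

interpretation vectorspace "class_ring :: complex ring" V by (rule V)

lemma cvs_closed [simp]:
  "x \<in> carrier V \<Longrightarrow> y \<in> carrier V \<Longrightarrow> x \<oplus> y \<in> carrier V"
  "\<zero> \<in> carrier V"
  "x \<in> carrier V \<Longrightarrow> c \<odot> x \<in> carrier V"
  "x \<in> carrier V \<Longrightarrow> \<ominus> x \<in> carrier V"
  "x \<in> carrier V \<Longrightarrow> y \<in> carrier V \<Longrightarrow> x \<ominus> y \<in> carrier V"
  by (simp_all add: smult_closed)

lemma cvs_smult [simp]:
  "x \<in> carrier V \<Longrightarrow> 0 \<odot> x = \<zero>"
  "x \<in> carrier V \<Longrightarrow> 1 \<odot> x = x"
  "c \<odot> \<zero> = \<zero>"
  "x \<in> carrier V \<Longrightarrow> c \<odot> (d \<odot> x) = (c * d) \<odot> x"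
  using smult_assoc1[of c d x] smult_one[of x] lmult_0[of x] rmult_0[of c] by auto

lemma cvs_add [simp]:
  "x \<in> carrier V \<Longrightarrow> \<zero> \<oplus> x = x"
  "x \<in> carrier V \<Longrightarrow> x \<oplus> \<zero> = x"
  by auto

lemma cvs_distrib:
  "x \<in> carrier V \<Longrightarrow> (c + d) \<odot> x = c \<odot> x \<oplus> d \<odot> x"
  "x \<in> carrier V \<Longrightarrow> y \<in> carrier V \<Longrightarrow> c \<odot> (x \<oplus> y) = c \<odot> x \<oplus> c \<odot> y"
  using smult_l_distr[of c d x] smult_r_distr[of c x y] by auto

lemma cvs_uminus:
  assumes "x \<in> carrier V" shows "\<ominus> x = (-1) \<odot> x"
proof (rule M.minus_equality)
  show "(-1) \<odot> x \<oplus> x = \<zero>" using cvs_distrib(1)[of x "-1" 1] assms by simp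
qed (use assms in simp_all)

lemma cvs_minus: "x \<in> carrier V \<Longrightarrow> y \<in> carrier V \<Longrightarrow> x \<ominus> y = x \<oplus> (-1) \<odot> y"
  by (simp add: a_minus_def cvs_uminus)

lemma csubspace_iff:
  "csubspace V W \<longleftrightarrow> W \<subseteq> carrier V \<and> \<zero> \<in> W \<and> (\<forall>x\<in>W. \<forall>y\<in>W. x \<oplus> y \<in> W) \<and> (\<forall>c. \<forall>x\<in>W. c \<odot> x \<in> W)"
  using V unfolding VectorSpace.subspace_def LinearCombinations.submodule_def by (auto simp: cvs_module)

lemma cspan_superset: "S \<subseteq> carrier V \<Longrightarrow> S \<subseteq> cspan V S"
  by (rule in_own_span)

lemma csubspace_cspan: "S \<subseteq> carrier V \<Longrightarrow> csubspace V (cspan V S)"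
  by (rule span_is_subspace)

lemma cspan_least: "csubspace V W \<Longrightarrow> S \<subseteq> W \<Longrightarrow> cspan V S \<subseteq> W"
  by (rule span_is_subset) (simp_all add: VectorSpace.subspace_def)

lemma csubspace_carrier: "csubspace V (carrier V)"
  by (simp add: csubspace_iff)

lemma csubspace_zero: "csubspace V {\<zero>}"
  by (simp add: csubspace_iff)

lemma csubspace_finsum:
  assumes W: "csubspace V W" and "finite E" and "\<And>e. e \<in> E \<Longrightarrow> f e \<in> W"
  shows "finsum V f E \<in> W"
  using assms(2,3)
proof (induction E)
  case empty
  then show ?case using W by (simp add: csubspace_iff)
next
  case (insert e E)
  have "f \<in> insert e E \<rightarrow> carrier V" using insert W by (auto simp: csubspace_iff)
  then show ?case using insert W by (auto simp: csubspace_iff Pi_iff)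
qed

end

text \<open>The vectors of \<open>carrier V\<close> with property P form a subspace that contains S,
  hence also its span.\<close>

lemma cspan_induct [consumes 3, case_names base zero add smult]:
  fixes V :: "(complex, 'v, 'm) module_scheme" (structure)
  assumes V: "cvs V" and x: "x \<in> cspan V S" and "S \<subseteq> carrier V"
    and "\<And>x. x \<in> S \<Longrightarrow> P x" and "P \<zero>"
    and "\<And>x y. x \<in> carrier V \<Longrightarrow> y \<in> carrier V \<Longrightarrow> P x \<Longrightarrow> P y \<Longrightarrow> P (x \<oplus> y)"
    and "\<And>c x. x \<in> carrier V \<Longrightarrow> P x \<Longrightarrow> P (c \<odot> x)"
  shows "P x"
proof -
  have "cspan V S \<subseteq> {x \<in> carrier V. P x}"
    using assms(3-) V by (intro cspan_least) (auto simp: csubspace_iff)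
  then show ?thesis using x by blast
qed

lemma csubspaceD:
  assumes "csubspace V W" "cvs V"
  shows "x \<in> W \<Longrightarrow> x \<in> carrier V" "\<zero>\<^bsub>V\<^esub> \<in> W" "x \<in> W \<Longrightarrow> y \<in> W \<Longrightarrow> x \<oplus>\<^bsub>V\<^esub> y \<in> W"
    "x \<in> W \<Longrightarrow> c \<odot>\<^bsub>V\<^esub> x \<in> W" "x \<in> W \<Longrightarrow> y \<in> W \<Longrightarrow> x \<ominus>\<^bsub>V\<^esub> y \<in> W"
  using assms by (auto simp: csubspace_iff cvs_minus subset_iff)

section \<open>Orthonormal bases, orthocomplements and the Riesz representation\<close>

definition orthonormal :: "'v hilb \<Rightarrow> 'v set \<Rightarrow> bool" where
  "orthonormal H E \<longleftrightarrow> E \<subseteq> carrier H \<and> (\<forall>e\<in>E. \<forall>f\<in>E. inner H e f = (if e = f then 1 else 0))"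

text \<open>Completeness is expressed by the Fourier expansion instead of a span, so that
  coordinates are available at once.\<close>

definition onb :: "'v hilb \<Rightarrow> 'v set \<Rightarrow> 'v set \<Rightarrow> bool" where
  "onb H W E \<longleftrightarrow> finite E \<and> orthonormal H E \<and> E \<subseteq> W
     \<and> (\<forall>x\<in>W. x = (\<Oplus>\<^bsub>H\<^esub>e\<in>E. inner H e x \<odot>\<^bsub>H\<^esub> e))"

context
  fixes H :: "'v hilb" (structure)
  assumes H [simp]: "fd_hilbert H"
begin

interpretation fd_hilbert H by (rule H)

lemma hinner [simp]:
  "x \<in> carrier H \<Longrightarrow> y \<in> carrier H \<Longrightarrow> z \<in> carrier H \<Longrightarrow> inner H x (y \<oplus> z) = inner H x y + inner H x z"
  "x \<in> carrier H \<Longrightarrow> y \<in> carrier H \<Longrightarrow> z \<in> carrier H \<Longrightarrow> inner H (y \<oplus> z) x = inner H y x + inner H z x"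
  "x \<in> carrier H \<Longrightarrow> y \<in> carrier H \<Longrightarrow> inner H x (c \<odot> y) = c * inner H x y"
  "x \<in> carrier H \<Longrightarrow> y \<in> carrier H \<Longrightarrow> inner H (c \<odot> y) x = cnj c * inner H y x"
  "x \<in> carrier H \<Longrightarrow> inner H x \<zero> = 0"
  "x \<in> carrier H \<Longrightarrow> inner H \<zero> x = 0"
  "x \<in> carrier H \<Longrightarrow> y \<in> carrier H \<Longrightarrow> z \<in> carrier H \<Longrightarrow> inner H x (y \<ominus> z) = inner H x y - inner H x z"
  "x \<in> carrier H \<Longrightarrow> y \<in> carrier H \<Longrightarrow> z \<in> carrier H \<Longrightarrow> inner H (y \<ominus> z) x = inner H y x - inner H z x"
proof -
  note add = inner_add_right and smult = inner_smult_right and comm = inner_commute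
  show 1: "inner H x (y \<oplus> z) = inner H x y + inner H x z"
    if "x \<in> carrier H" "y \<in> carrier H" "z \<in> carrier H" for x y z using that by (rule add)
  show 2: "inner H (y \<oplus> z) x = inner H y x + inner H z x"
    if "x \<in> carrier H" "y \<in> carrier H" "z \<in> carrier H" for x y z
    using that comm[of x "y \<oplus> z"] comm[of x y] comm[of x z] add[of x y z] by simp
  show 3: "inner H x (c \<odot> y) = c * inner H x y" if "x \<in> carrier H" "y \<in> carrier H" for x y c
    using that by (rule smult)
  show 4: "inner H (c \<odot> y) x = cnj c * inner H y x" if "x \<in> carrier H" "y \<in> carrier H" for x y c
    using that comm[of x "c \<odot> y"] comm[of x y] smult[of x y c] by simp
  show "inner H x \<zero> = 0" if "x \<in> carrier H" using that 3[of x \<zero> 0] by simp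
  show "inner H \<zero> x = 0" if "x \<in> carrier H" using that 4[of x \<zero> 0] by simp
  show "inner H x (y \<ominus> z) = inner H x y - inner H x z"
    if "x \<in> carrier H" "y \<in> carrier H" "z \<in> carrier H" using that by (simp add: cvs_minus 1 3)
  show "inner H (y \<ominus> z) x = inner H y x - inner H z x"
    if "x \<in> carrier H" "y \<in> carrier H" "z \<in> carrier H" using that by (simp add: cvs_minus 2 4)
qed

lemma hinner_commute: "x \<in> carrier H \<Longrightarrow> y \<in> carrier H \<Longrightarrow> inner H y x = cnj (inner H x y)"
  by (rule inner_commute)

lemma cnj_hinner: "x \<in> carrier H \<Longrightarrow> y \<in> carrier H \<Longrightarrow> cnj (inner H x y) = inner H y x"
  by (rule hinner_commute[symmetric])

lemma hinner_self_eq_0: "x \<in> carrier H \<Longrightarrow> inner H x x = 0 \<longleftrightarrow> x = \<zero>"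
  using inner_pos[of x] by (cases "x = \<zero>") auto

lemma hinner_self_real:
  assumes "x \<in> carrier H" shows "inner H x x = of_real (Re (inner H x x))"
  using cnj_hinner[OF assms assms] by (metis Reals_cnj_iff of_real_Re)

lemma hinner_self_nonneg: "x \<in> carrier H \<Longrightarrow> 0 \<le> Re (inner H x x)"
  using inner_pos[of x] by (cases "x = \<zero>") auto

lemma hminus_eq_0 [simp]: "x \<in> carrier H \<Longrightarrow> y \<in> carrier H \<Longrightarrow> x \<ominus> y = \<zero> \<longleftrightarrow> x = y"
  by simp

lemma hinner_ext:
  assumes "x \<in> carrier H" "y \<in> carrier H" "\<And>z. z \<in> carrier H \<Longrightarrow> inner H z x = inner H z y"
  shows "x = y"
proof -
  have "inner H (x \<ominus> y) (x \<ominus> y) = 0" using assms by simp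
  then have "x \<ominus> y = \<zero>" using assms by (simp add: hinner_self_eq_0 del: hinner minus_other_side)
  then show ?thesis using assms by simp
qed

lemma hinner_finsum:
  assumes "finite E" "\<And>e. e \<in> E \<Longrightarrow> f e \<in> carrier H" "x \<in> carrier H"
  shows "inner H x (finsum H f E) = (\<Sum>e\<in>E. inner H x (f e))"
  using assms
proof (induction E)
  case (insert e E)
  have "f \<in> E \<rightarrow> carrier H" "f e \<in> carrier H" using insert by auto
  then show ?case using insert by simp
qed simp

lemma orthonormal_lin_indpt:
  assumes E: "orthonormal H E" and fin: "finite E"
  shows "lin_indpt E"
proof (rule finite_lin_indpt2[OF fin])
  show sub: "E \<subseteq> carrier H" using E by (simp add: orthonormal_def)
  fix a assume "lincomb a E = \<zero>"
  then have 0: "(\<Oplus>v\<in>E. a v \<odot> v) = \<zero>" by (simp add: lincomb_def)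
  have "a v = 0" if v: "v \<in> E" for v
  proof -
    have "0 = inner H v (\<Oplus>w\<in>E. a w \<odot> w)" using v sub 0 by auto
    also have "\<dots> = (\<Sum>w\<in>E. a w * inner H v w)"
      using sub v by (subst hinner_finsum[OF fin]) (auto intro!: sum.cong simp: subset_iff)
    also have "\<dots> = (\<Sum>w\<in>E. if w = v then a w else 0)"
      using E v by (intro sum.cong) (auto simp: orthonormal_def)
    also have "\<dots> = a v" using v fin by simp
    finally show ?thesis by simp
  qed
  then show "\<forall>v\<in>E. a v = \<zero>\<^bsub>class_ring\<^esub>" by simp
qed

text \<open>Orthonormal sets are linearly independent; an infinite one would contain an orthonormal
  set with one element more than the dimension.\<close>

lemma orthonormal_card:
  assumes "orthonormal H E" shows "finite E" "card E \<le> dim"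
proof -
  show fin: "finite E"
  proof (rule ccontr)
    assume "infinite E"
    then obtain F where F: "F \<subseteq> E" "finite F" "card F = Suc dim"
      using infinite_arbitrarily_large by blast
    then have "orthonormal H F" using assms unfolding orthonormal_def by (meson subset_iff)
    then show False
      using li_le_dim(2)[OF finite_dimensional, of F] orthonormal_lin_indpt[of F] F
      by (simp add: orthonormal_def)
  qed
  show "card E \<le> dim"
    using li_le_dim(2)[OF finite_dimensional, of E] orthonormal_lin_indpt[OF assms fin] assms
    by (simp add: orthonormal_def)
qed

lemma normalise:
  assumes "x \<in> carrier H" "x \<noteq> \<zero>"
  shows "\<exists>c. c \<noteq> 0 \<and> inner H (c \<odot> x) (c \<odot> x) = 1"
proof -
  have pos: "0 < Re (inner H x x)" using assms by (rule inner_pos)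
  let ?c = "complex_of_real (1 / sqrt (Re (inner H x x)))"
  have "?c * ?c * of_real (Re (inner H x x)) = 1"
    using pos unfolding of_real_mult[symmetric] by simp
  moreover have "inner H (?c \<odot> x) (?c \<odot> x) = ?c * ?c * inner H x x"
    using assms(1) by (simp add: mult.assoc)
  ultimately have "inner H (?c \<odot> x) (?c \<odot> x) = 1"
    using hinner_self_real[OF assms(1)] by metis
  then show ?thesis using pos by (intro exI[of _ ?c]) simp
qed

text \<open>An orthonormal subset of W of largest cardinality is a basis: if some x in W differed
  from its expansion, the normalised difference could be added to the set.\<close>

lemma onb_exists:
  assumes W: "csubspace H W"
  shows "\<exists>E. onb H W E"
proof -
  let ?P = "\<lambda>E. orthonormal H E \<and> E \<subseteq> W"
  have "?P {}" by (simp add: orthonormal_def)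
  then obtain E where E: "?P E" and max: "\<And>F. ?P F \<Longrightarrow> card F \<le> card E"
    using ex_has_greatest_nat[of ?P "{}" card "Suc dim"] orthonormal_card(2) by (metis le_imp_less_Suc)
  have fin: "finite E" using E orthonormal_card by blast
  have sub: "E \<subseteq> carrier H" using E by (auto simp: orthonormal_def)
  have "x = (\<Oplus>e\<in>E. inner H e x \<odot> e)" if x: "x \<in> W" for x
  proof (rule ccontr)
    let ?s = "\<Oplus>e\<in>E. inner H e x \<odot> e"
    assume ne: "x \<noteq> ?s"
    have xH: "x \<in> carrier H" using x W by (auto simp: csubspace_iff)
    have sW: "?s \<in> W" using W E fin by (intro csubspace_finsum) (auto simp: csubspace_iff)
    then have sH: "?s \<in> carrier H" using W by (auto simp: csubspace_iff)
    let ?y = "x \<ominus> ?s"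
    have y: "?y \<in> carrier H" "?y \<noteq> \<zero>" "?y \<in> W"
      using xH sH ne x sW W by (auto intro: csubspaceD)
    have orth: "inner H e ?y = 0" if e: "e \<in> E" for e
    proof -
      have "inner H e ?s = (\<Sum>f\<in>E. inner H f x * inner H e f)"
        using e sub xH by (subst hinner_finsum[OF fin]) (auto intro!: sum.cong simp: subset_iff)
      also have "\<dots> = (\<Sum>f\<in>E. if f = e then inner H f x else 0)"
        using E e by (intro sum.cong) (auto simp: orthonormal_def)
      also have "\<dots> = inner H e x" using e fin by simp
      finally show ?thesis using e sub xH sH by (simp add: subset_iff)
    qed
    obtain c where c: "c \<noteq> 0" "inner H (c \<odot> ?y) (c \<odot> ?y) = 1" using normalise y by blast
    obtain z where z: "z \<in> carrier H" "z \<in> W" "inner H z z = 1" and ez: "\<And>e. e \<in> E \<Longrightarrow> inner H e z = 0"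
    proof
      show "c \<odot> ?y \<in> carrier H" "c \<odot> ?y \<in> W" "inner H (c \<odot> ?y) (c \<odot> ?y) = 1"
        using y W c(2) by (auto intro: csubspaceD simp del: hinner)
      fix e assume e: "e \<in> E"
      then have "inner H e (c \<odot> ?y) = c * inner H e ?y" using sub y by (intro hinner(3)) auto
      then show "inner H e (c \<odot> ?y) = 0" using orth[OF e] by simp
    qed
    have ze: "inner H z e = 0" if "e \<in> E" for e
      using ez[OF that] cnj_hinner[of e z] z sub that by auto
    have "z \<notin> E" using z ez by force
    moreover have "orthonormal H (insert z E)"
      using E z ez ze \<open>z \<notin> E\<close> unfolding orthonormal_def by simp blast
    ultimately show False using max[of "insert z E"] E z fin by simp
  qed
  then show ?thesis using E fin by (auto simp: onb_def)
qed

text \<open>The vector w is the Fourier sum of x in an orthonormal basis of W; expanding u as well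
  shows that x and w have the same inner product with u.\<close>

lemma orthogonal_decomposition:
  assumes W: "csubspace H W" and x: "x \<in> carrier H"
  shows "\<exists>w\<in>W. \<forall>u\<in>W. inner H u x = inner H u w"
proof -
  obtain E where E: "onb H W E" using onb_exists[OF W] by blast
  have fin: "finite E" and EW: "E \<subseteq> W" and sub: "E \<subseteq> carrier H" and EE: "orthonormal H E"
    using E by (auto simp: onb_def orthonormal_def)
  let ?w = "\<Oplus>e\<in>E. inner H e x \<odot> e"
  have w: "?w \<in> W" using W EW fin by (intro csubspace_finsum) (auto intro: csubspaceD)
  have "inner H u x = inner H u ?w" if u: "u \<in> W" for u
  proof -
    have uH: "u \<in> carrier H" using u W by (auto simp: csubspace_iff)
    have ue: "u = (\<Oplus>e\<in>E. inner H e u \<odot> e)" using E u by (simp add: onb_def)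
    have "inner H x u = inner H x (\<Oplus>e\<in>E. inner H e u \<odot> e)" using ue by simp
    also have "\<dots> = (\<Sum>e\<in>E. inner H e u * inner H x e)"
      using sub x uH by (subst hinner_finsum[OF fin]) (auto intro!: sum.cong simp: subset_iff)
    finally have "inner H u x = (\<Sum>e\<in>E. cnj (inner H e u * inner H x e))"
      using hinner_commute[OF x uH] by simp
    also have "\<dots> = (\<Sum>e\<in>E. inner H e x * inner H u e)"
      using sub x uH by (intro sum.cong) (auto simp: subset_iff cnj_hinner)
    also have "\<dots> = inner H u ?w"
      using sub x uH by (subst hinner_finsum[OF fin]) (auto intro!: sum.cong simp: subset_iff)
    finally show ?thesis .
  qed
  then show ?thesis using w by blast
qed

lemma orthcomp_csubspace: "S \<subseteq> carrier H \<Longrightarrow> csubspace H (orthcomp H S)"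
  by (auto simp: csubspace_iff orthcomp_def subset_iff)

text \<open>If x is orthogonal to the orthocomplement and w is its component in W, then x - w lies
  in the orthocomplement, so it is orthogonal to x and to w, hence to itself.\<close>

lemma orthcomp_orthcomp:
  assumes W: "csubspace H W"
  shows "orthcomp H (orthcomp H W) = W"
proof
  have sub: "W \<subseteq> carrier H" using W by (simp add: csubspace_iff)
  show "W \<subseteq> orthcomp H (orthcomp H W)"
    using sub hinner_commute by (fastforce simp: orthcomp_def)
  show "orthcomp H (orthcomp H W) \<subseteq> W"
  proof
    fix x assume x: "x \<in> orthcomp H (orthcomp H W)"
    then have xH: "x \<in> carrier H" by (simp add: orthcomp_def)
    obtain w where w: "w \<in> W" "\<forall>u\<in>W. inner H u x = inner H u w"
      using orthogonal_decomposition[OF W xH] by blast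
    have wH: "w \<in> carrier H" using w sub by blast
    have "x \<ominus> w \<in> orthcomp H W" using w xH wH sub by (auto simp: orthcomp_def subset_iff)
    then have "inner H (x \<ominus> w) x = 0" using x by (simp add: orthcomp_def)
    moreover have "inner H w (x \<ominus> w) = 0" using w xH wH by simp
    then have "inner H (x \<ominus> w) w = 0" using hinner_commute[of w "x \<ominus> w"] xH wH by simp
    ultimately have "inner H (x \<ominus> w) (x \<ominus> w) = 0" using xH wH by simp
    then have "x = w" using hinner_self_eq_0[of "x \<ominus> w"] xH wH by simp
    then show "x \<in> W" using w by simp
  qed
qed

text \<open>The vector is the sum of \<open>cnj (f e)\<close> times e over an orthonormal basis. The
  functional is a bare function with two laws, so the lemma applies directly to x -> <y, r x>, from
  which adjoints are made.\<close>

lemma riesz: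
  assumes "\<And>x y. x \<in> carrier H \<Longrightarrow> y \<in> carrier H \<Longrightarrow> f (x \<oplus> y) = f x + f y"
    and "\<And>c x. x \<in> carrier H \<Longrightarrow> f (c \<odot> x) = c * f x"
  shows "\<exists>z\<in>carrier H. \<forall>x\<in>carrier H. f x = inner H z x"
proof -
  obtain E where E: "onb H (carrier H) E" using onb_exists[OF csubspace_carrier] by auto
  have fin: "finite E" and sub: "E \<subseteq> carrier H" using E by (auto simp: onb_def)
  let ?z = "\<Oplus>e\<in>E. cnj (f e) \<odot> e"
  have z: "?z \<in> carrier H" using sub fin by (intro csubspace_finsum[OF _ csubspace_carrier]) auto
  have f_sum: "f (\<Oplus>e\<in>F. g e) = (\<Sum>e\<in>F. f (g e))" if "finite F" "g \<in> F \<rightarrow> carrier H" for g and F :: "'v set"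
    using that
  proof (induction F)
    case empty
    have "f \<zero> = f (0 \<odot> \<zero>)" by simp
    also have "\<dots> = 0 * f \<zero>" by (rule assms(2)) simp
    finally show ?case by simp
  next
    case (insert e F)
    then show ?case by (simp add: Pi_iff assms(1) finsum_closed)
  qed
  have "f x = inner H ?z x" if x: "x \<in> carrier H" for x
  proof -
    have "f x = f (\<Oplus>e\<in>E. inner H e x \<odot> e)" using E x by (simp add: onb_def)
    also have "\<dots> = (\<Sum>e\<in>E. inner H e x * f e)"
      using sub x by (subst f_sum[OF fin]) (auto simp: assms(2) intro!: sum.cong)
    also have "\<dots> = (\<Sum>e\<in>E. cnj (inner H x (cnj (f e) \<odot> e)))"
      using sub x by (intro sum.cong) (auto simp: subset_iff cnj_hinner)
    also have "\<dots> = cnj (inner H x ?z)"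
      using sub x by (subst hinner_finsum[OF fin]) auto
    also have "\<dots> = inner H ?z x" using x z hinner_commute[of x ?z] by simp
    finally show ?thesis .
  qed
  then show ?thesis using z by blast
qed

end

section \<open>Operators, adjoints and projections\<close>

lemma ops_iff:
  "r \<in> ops A B \<longleftrightarrow> (\<forall>x\<in>carrier A. r x \<in> carrier B)
     \<and> (\<forall>x\<in>carrier A. \<forall>y\<in>carrier A. r (x \<oplus>\<^bsub>A\<^esub> y) = r x \<oplus>\<^bsub>B\<^esub> r y)
     \<and> (\<forall>c. \<forall>x\<in>carrier A. r (c \<odot>\<^bsub>A\<^esub> x) = c \<odot>\<^bsub>B\<^esub> r x) \<and> r \<in> extensional (carrier A)"
  by (auto simp: lin_ops_def LinearCombinations.module_hom_def)

lemma opsI: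
  assumes "\<And>x. x \<in> carrier A \<Longrightarrow> r x \<in> carrier B"
    and "\<And>x y. x \<in> carrier A \<Longrightarrow> y \<in> carrier A \<Longrightarrow> r (x \<oplus>\<^bsub>A\<^esub> y) = r x \<oplus>\<^bsub>B\<^esub> r y"
    and "\<And>c x. x \<in> carrier A \<Longrightarrow> r (c \<odot>\<^bsub>A\<^esub> x) = c \<odot>\<^bsub>B\<^esub> r x"
    and "r \<in> extensional (carrier A)"
  shows "r \<in> ops A B"
  using assms by (simp add: ops_iff)

lemma ops_restrictI:
  assumes "\<And>x. x \<in> carrier A \<Longrightarrow> f x \<in> carrier B"
    and "\<And>x y. x \<in> carrier A \<Longrightarrow> y \<in> carrier A \<Longrightarrow> f (x \<oplus>\<^bsub>A\<^esub> y) = f x \<oplus>\<^bsub>B\<^esub> f y"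
    and "\<And>c x. x \<in> carrier A \<Longrightarrow> f (c \<odot>\<^bsub>A\<^esub> x) = c \<odot>\<^bsub>B\<^esub> f x"
    and "fd_hilbert A"
  shows "(\<lambda>x\<in>carrier A. f x) \<in> ops A B"
  using assms by (intro opsI) simp_all

lemma ops_closed [simp]: "r \<in> ops A B \<Longrightarrow> x \<in> carrier A \<Longrightarrow> r x \<in> carrier B"
  and ops_add [simp]: "r \<in> ops A B \<Longrightarrow> x \<in> carrier A \<Longrightarrow> y \<in> carrier A \<Longrightarrow> r (x \<oplus>\<^bsub>A\<^esub> y) = r x \<oplus>\<^bsub>B\<^esub> r y"
  and ops_smult [simp]: "r \<in> ops A B \<Longrightarrow> x \<in> carrier A \<Longrightarrow> r (c \<odot>\<^bsub>A\<^esub> x) = c \<odot>\<^bsub>B\<^esub> r x"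
  and ops_ext: "r \<in> ops A B \<Longrightarrow> r \<in> extensional (carrier A)"
  by (auto simp: ops_iff)

lemma ops_zero [simp]:
  assumes "r \<in> ops A B" "fd_hilbert A" "fd_hilbert B" shows "r \<zero>\<^bsub>A\<^esub> = \<zero>\<^bsub>B\<^esub>"
  using assms ops_smult[of r A B "\<zero>\<^bsub>A\<^esub>" 0] by simp

lemma ops_minus [simp]:
  assumes "r \<in> ops A B" "fd_hilbert A" "fd_hilbert B" "x \<in> carrier A" "y \<in> carrier A"
  shows "r (x \<ominus>\<^bsub>A\<^esub> y) = r x \<ominus>\<^bsub>B\<^esub> r y"
  using assms by (simp add: cvs_minus)

lemma ops_eqI:
  assumes "r \<in> ops A B" "s \<in> ops A B" "\<And>x. x \<in> carrier A \<Longrightarrow> r x = s x"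
  shows "r = s"
  using assms ops_ext extensionalityI by metis

lemma lin_ops_apply [simp]:
  "x \<in> carrier A \<Longrightarrow> (f \<oplus>\<^bsub>lin_ops A B\<^esub> g) x = f x \<oplus>\<^bsub>B\<^esub> g x"
  "x \<in> carrier A \<Longrightarrow> (c \<odot>\<^bsub>lin_ops A B\<^esub> f) x = c \<odot>\<^bsub>B\<^esub> f x"
  "x \<in> carrier A \<Longrightarrow> \<zero>\<^bsub>lin_ops A B\<^esub> x = \<zero>\<^bsub>B\<^esub>"
  by (simp_all add: lin_ops_def)

lemma lin_ops_extensional:
  "f \<oplus>\<^bsub>lin_ops A B\<^esub> g \<in> extensional (carrier A)" "c \<odot>\<^bsub>lin_ops A B\<^esub> f \<in> extensional (carrier A)"
  "\<zero>\<^bsub>lin_ops A B\<^esub> \<in> extensional (carrier A)"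
  by (simp_all add: lin_ops_def)

lemma cvs_add_swap:
  assumes "cvs V" "a \<in> carrier V" "b \<in> carrier V" "c \<in> carrier V" "d \<in> carrier V"
  shows "(a \<oplus>\<^bsub>V\<^esub> b) \<oplus>\<^bsub>V\<^esub> (c \<oplus>\<^bsub>V\<^esub> d) = (a \<oplus>\<^bsub>V\<^esub> c) \<oplus>\<^bsub>V\<^esub> (b \<oplus>\<^bsub>V\<^esub> d)"
proof -
  interpret abelian_group V using assms(1) by (rule cvs_abelian_group)
  show ?thesis using assms by (simp add: a_ac)
qed

lemma cvs_lin_ops [simp]:
  assumes A [simp]: "fd_hilbert A" and B [simp]: "fd_hilbert B"
  shows "cvs (lin_ops A B)"
proof (rule vs_criteria)
  interpret B: abelian_group B by (rule cvs_abelian_group) simp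
  let ?L = "lin_ops A B"
  show fld: "field (class_ring :: complex ring)" by (rule class_field)
  show zero: "\<zero>\<^bsub>?L\<^esub> \<in> ops A B" by (intro opsI) (simp_all add: lin_ops_extensional)
  have add: "f \<oplus>\<^bsub>?L\<^esub> g \<in> ops A B" if f: "f \<in> ops A B" and g: "g \<in> ops A B" for f g
  proof (rule opsI)
    fix x y assume "x \<in> carrier A" "y \<in> carrier A"
    then show "(f \<oplus>\<^bsub>?L\<^esub> g) (x \<oplus>\<^bsub>A\<^esub> y) = (f \<oplus>\<^bsub>?L\<^esub> g) x \<oplus>\<^bsub>B\<^esub> (f \<oplus>\<^bsub>?L\<^esub> g) y"
      using cvs_add_swap[of B "f x" "f y" "g x" "g y"] f g by simp
  qed (use f g in \<open>simp_all add: lin_ops_extensional cvs_distrib\<close>)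
  then show "\<forall>v w. v \<in> ops A B \<and> w \<in> ops A B \<longrightarrow> v \<oplus>\<^bsub>?L\<^esub> w \<in> ops A B" by blast
  have smult: "c \<odot>\<^bsub>?L\<^esub> f \<in> ops A B" if f: "f \<in> ops A B" for c f
    using f by (intro opsI) (simp_all add: lin_ops_extensional cvs_distrib mult.commute)
  then show "\<forall>c v. c \<in> carrier class_ring \<and> v \<in> ops A B \<longrightarrow> c \<odot>\<^bsub>?L\<^esub> v \<in> ops A B" by blast
  have eqI: "f = g" if "f \<in> ops A B" "g \<in> ops A B" "\<And>x. x \<in> carrier A \<Longrightarrow> f x = g x" for f g
    using that by (rule ops_eqI)
  show "\<forall>v\<in>ops A B. \<exists>neg_v\<in>ops A B. v \<oplus>\<^bsub>?L\<^esub> neg_v = \<zero>\<^bsub>?L\<^esub>"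
  proof
    fix v assume v: "v \<in> ops A B"
    have "v \<oplus>\<^bsub>?L\<^esub> (-1) \<odot>\<^bsub>?L\<^esub> v = \<zero>\<^bsub>?L\<^esub>"
      using v by (intro eqI add smult zero) (simp_all add: cvs_uminus[symmetric] B.r_neg)
    then show "\<exists>neg_v\<in>ops A B. v \<oplus>\<^bsub>?L\<^esub> neg_v = \<zero>\<^bsub>?L\<^esub>" using smult[OF v] by blast
  qed
  show "\<forall>v w. v \<in> ops A B \<and> w \<in> ops A B \<longrightarrow> v \<oplus>\<^bsub>?L\<^esub> w = w \<oplus>\<^bsub>?L\<^esub> v"
    by (auto intro!: eqI add simp: B.a_comm)
  show "\<forall>v w x. v \<in> ops A B \<and> w \<in> ops A B \<and> x \<in> ops A B \<longrightarrow>
      v \<oplus>\<^bsub>?L\<^esub> w \<oplus>\<^bsub>?L\<^esub> x = v \<oplus>\<^bsub>?L\<^esub> (w \<oplus>\<^bsub>?L\<^esub> x)"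
    by (auto intro!: eqI add simp: B.a_assoc)
  show "\<forall>v\<in>ops A B. v \<oplus>\<^bsub>?L\<^esub> \<zero>\<^bsub>?L\<^esub> = v"
    by (auto intro!: eqI add zero)
  show "\<forall>a b v. a \<in> carrier class_ring \<and> b \<in> carrier class_ring \<and> v \<in> ops A B \<longrightarrow>
      (a \<otimes>\<^bsub>class_ring\<^esub> b) \<odot>\<^bsub>?L\<^esub> v = a \<odot>\<^bsub>?L\<^esub> (b \<odot>\<^bsub>?L\<^esub> v)"
    by (auto intro!: eqI smult)
  show "\<forall>v\<in>ops A B. \<one>\<^bsub>class_ring\<^esub> \<odot>\<^bsub>?L\<^esub> v = v"
    by (auto intro!: eqI smult)
  show "\<forall>a b v. a \<in> carrier class_ring \<and> b \<in> carrier class_ring \<and> v \<in> ops A B \<longrightarrow>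
      (a \<oplus>\<^bsub>class_ring\<^esub> b) \<odot>\<^bsub>?L\<^esub> v = a \<odot>\<^bsub>?L\<^esub> v \<oplus>\<^bsub>?L\<^esub> b \<odot>\<^bsub>?L\<^esub> v"
    by (auto intro!: eqI smult add simp: cvs_distrib)
  show "\<forall>a v w. a \<in> carrier class_ring \<and> v \<in> ops A B \<and> w \<in> ops A B \<longrightarrow>
      a \<odot>\<^bsub>?L\<^esub> (v \<oplus>\<^bsub>?L\<^esub> w) = a \<odot>\<^bsub>?L\<^esub> v \<oplus>\<^bsub>?L\<^esub> a \<odot>\<^bsub>?L\<^esub> w"
    by (auto intro!: eqI smult add simp: cvs_distrib)
qed

lemma lin_ops_minus_apply [simp]:
  assumes "fd_hilbert A" "fd_hilbert B" "f \<in> ops A B" "g \<in> ops A B" "x \<in> carrier A"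
  shows "(f \<ominus>\<^bsub>lin_ops A B\<^esub> g) x = f x \<ominus>\<^bsub>B\<^esub> g x"
  using assms by (simp add: cvs_minus)

lemma op_comp_apply [simp]: "x \<in> carrier A \<Longrightarrow> op_comp A s r x = s (r x)"
  by (simp add: op_comp_def compose_def)

lemma op_id_apply [simp]: "x \<in> carrier A \<Longrightarrow> op_id A x = x"
  by (simp add: op_id_def)

lemma op_comp_closed [simp]: "r \<in> ops A B \<Longrightarrow> s \<in> ops B C \<Longrightarrow> fd_hilbert A \<Longrightarrow> op_comp A s r \<in> ops A C"
  unfolding op_comp_def compose_def by (rule ops_restrictI) auto

lemma op_id_closed [simp]: "fd_hilbert A \<Longrightarrow> op_id A \<in> ops A A"
  unfolding op_id_def by (rule ops_restrictI) auto

lemma ops_finsum: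
  assumes "r \<in> ops A B" "fd_hilbert A" "fd_hilbert B" "finite E" "\<And>e. e \<in> E \<Longrightarrow> f e \<in> carrier A"
  shows "r (finsum A f E) = finsum B (\<lambda>e. r (f e)) E"
  using assms(4,5)
proof (induction E)
  case empty
  then show ?case using assms(1-3) by (simp add: abelian_monoid.finsum_empty abelian_group.axioms(1) cvs_abelian_group)
next
  case (insert e E)
  interpret A: abelian_group A using assms(2) by (intro cvs_abelian_group) simp
  interpret B: abelian_group B using assms(3) by (intro cvs_abelian_group) simp
  have "f \<in> E \<rightarrow> carrier A" "f e \<in> carrier A" "(\<lambda>e. r (f e)) \<in> E \<rightarrow> carrier B" "r (f e) \<in> carrier B"
    using insert assms(1) by auto
  then show ?case using insert assms(1-3) by simp
qed

lemma lin_ops_finsum_apply: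
  assumes "fd_hilbert A" "fd_hilbert B" "finite E" "\<And>e. e \<in> E \<Longrightarrow> f e \<in> ops A B" "x \<in> carrier A"
  shows "finsum (lin_ops A B) f E x = finsum B (\<lambda>e. f e x) E"
  using assms(3,4)
proof (induction E)
  case empty
  interpret L: abelian_group "lin_ops A B" using assms(1,2) by (intro cvs_abelian_group) simp
  interpret B: abelian_group B using assms(2) by (intro cvs_abelian_group) simp
  show ?case using assms by simp
next
  case (insert e E)
  interpret L: abelian_group "lin_ops A B" using assms(1,2) by (intro cvs_abelian_group) simp
  interpret B: abelian_group B using assms(2) by (intro cvs_abelian_group) simp
  have "f \<in> E \<rightarrow> ops A B" "f e \<in> ops A B" "(\<lambda>e. f e x) \<in> E \<rightarrow> carrier B" "f e x \<in> carrier B"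
    using insert assms(5) by (auto intro: ops_closed)
  then show ?case using insert assms by simp
qed

section \<open>Adjoints\<close>

lemma op_adj_unique:
  assumes [simp]: "fd_hilbert A" "fd_hilbert B" and r: "r \<in> ops A B"
    and s: "s \<in> ops B A" "\<And>x y. x \<in> carrier A \<Longrightarrow> y \<in> carrier B \<Longrightarrow> inner B (r x) y = inner A x (s y)"
  shows "op_adj A B r = s"
  unfolding op_adj_def
proof (rule the_equality)
  show "s \<in> ops B A \<and> (\<forall>x\<in>carrier A. \<forall>y\<in>carrier B. inner B (r x) y = inner A x (s y))" using s by blast
  fix s' assume s': "s' \<in> ops B A \<and> (\<forall>x\<in>carrier A. \<forall>y\<in>carrier B. inner B (r x) y = inner A x (s' y))"
  then show "s' = s" using s by (intro ops_eqI[of s' B A s] hinner_ext[of A]) auto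
qed

text \<open>The Riesz representation, applied for each y to x -> <y, r x>, gives the values s y;
  linearity of s follows because inner products separate vectors.\<close>

lemma op_adj_exists:
  assumes [simp]: "fd_hilbert A" "fd_hilbert B" and r: "r \<in> ops A B"
  shows "\<exists>s\<in>ops B A. \<forall>x\<in>carrier A. \<forall>y\<in>carrier B. inner B (r x) y = inner A x (s y)"
proof -
  have "\<exists>z\<in>carrier A. \<forall>x\<in>carrier A. inner B y (r x) = inner A z x" if "y \<in> carrier B" for y
    using that r by (intro riesz) simp_all
  then obtain s where s: "\<And>y. y \<in> carrier B \<Longrightarrow> s y \<in> carrier A"
    and eq: "\<And>x y. y \<in> carrier B \<Longrightarrow> x \<in> carrier A \<Longrightarrow> inner B y (r x) = inner A (s y) x"
    by metis
  have eq': "inner A x (s y) = inner B (r x) y" if "x \<in> carrier A" "y \<in> carrier B" for x y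
    using eq[OF that(2,1)] that s r cnj_hinner[of A "s y" x] cnj_hinner[of B y "r x"] by simp
  have "(\<lambda>y\<in>carrier B. s y) \<in> ops B A"
    using r by (intro ops_restrictI hinner_ext[of A]) (auto simp: s eq')
  then show ?thesis by (intro bexI[of _ "\<lambda>y\<in>carrier B. s y"]) (auto simp: s eq')
qed

lemma op_adj:
  assumes "fd_hilbert A" "fd_hilbert B" "r \<in> ops A B"
  shows op_adj_closed [simp]: "op_adj A B r \<in> ops B A"
    and op_adj_inner_right [simp]:
      "x \<in> carrier A \<Longrightarrow> y \<in> carrier B \<Longrightarrow> inner A x (op_adj A B r y) = inner B (r x) y"
proof -
  obtain s where s: "s \<in> ops B A" "\<And>x y. x \<in> carrier A \<Longrightarrow> y \<in> carrier B \<Longrightarrow> inner B (r x) y = inner A x (s y)"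
    using op_adj_exists[OF assms] by blast
  have eq: "op_adj A B r = s" using op_adj_unique[OF assms s] .
  show "op_adj A B r \<in> ops B A" using s eq by simp
  show "inner A x (op_adj A B r y) = inner B (r x) y" if "x \<in> carrier A" "y \<in> carrier B"
    using that s eq by simp
qed

lemma op_adj_apply_closed [simp]:
  "fd_hilbert A \<Longrightarrow> fd_hilbert B \<Longrightarrow> r \<in> ops A B \<Longrightarrow> y \<in> carrier B \<Longrightarrow> op_adj A B r y \<in> carrier A"
  by (rule ops_closed[OF op_adj_closed])

lemma op_adj_inner_left [simp]:
  assumes "fd_hilbert A" "fd_hilbert B" "r \<in> ops A B" "x \<in> carrier A" "y \<in> carrier B"
  shows "inner A (op_adj A B r y) x = inner B y (r x)"
  using cnj_hinner[of A x "op_adj A B r y"] cnj_hinner[of B "r x" y] op_adj_inner_right[OF assms]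
    ops_closed[OF assms(3,4)] op_adj_apply_closed[OF assms(1-3,5)] assms by metis

lemma op_adj_adj [simp]:
  assumes "fd_hilbert A" "fd_hilbert B" "r \<in> ops A B"
  shows "op_adj B A (op_adj A B r) = r"
  using assms by (intro op_adj_unique) auto

lemma op_adj_comp:
  assumes "fd_hilbert A" "fd_hilbert B" "fd_hilbert C" "r \<in> ops A B" "s \<in> ops B C"
  shows "op_adj A C (op_comp A s r) = op_comp C (op_adj A B r) (op_adj B C s)"
  using assms op_comp_closed[OF op_adj_closed[of B C s] op_adj_closed[of A B r]]
  by (intro op_adj_unique) auto

lemma op_adj_add_apply:
  assumes "fd_hilbert A" "fd_hilbert B" "r \<in> ops A B" "s \<in> ops A B" "y \<in> carrier B"
  shows "op_adj A B (r \<oplus>\<^bsub>lin_ops A B\<^esub> s) y = op_adj A B r y \<oplus>\<^bsub>A\<^esub> op_adj A B s y"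
  using assms by (intro hinner_ext[of A]) simp_all

lemma op_adj_smult_apply:
  assumes "fd_hilbert A" "fd_hilbert B" "r \<in> ops A B" "y \<in> carrier B"
  shows "op_adj A B (c \<odot>\<^bsub>lin_ops A B\<^esub> r) y = cnj c \<odot>\<^bsub>A\<^esub> op_adj A B r y"
  using assms by (intro hinner_ext[of A]) simp_all

lemma op_adj_zero_apply:
  assumes "fd_hilbert A" "fd_hilbert B" "y \<in> carrier B"
  shows "op_adj A B \<zero>\<^bsub>lin_ops A B\<^esub> y = \<zero>\<^bsub>A\<^esub>"
  using assms by (intro hinner_ext[of A]) simp_all

lemma hminus_self [simp]: "fd_hilbert H \<Longrightarrow> x \<in> carrier H \<Longrightarrow> x \<ominus>\<^bsub>H\<^esub> x = \<zero>\<^bsub>H\<^esub>"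
  by (simp only: hminus_eq_0)

section \<open>Orthogonal projections and their ranges\<close>

definition proj :: "'v hilb \<Rightarrow> 'v set \<Rightarrow> 'v \<Rightarrow> 'v" where
  "proj H W = (\<lambda>x\<in>carrier H. SOME w. w \<in> W \<and> (\<forall>u\<in>W. inner H u x = inner H u w))"

definition is_proj :: "'v hilb \<Rightarrow> ('v \<Rightarrow> 'v) \<Rightarrow> bool" where
  "is_proj H p \<longleftrightarrow> p \<in> ops H H \<and> (\<forall>x\<in>carrier H. p (p x) = p x)
     \<and> (\<forall>x\<in>carrier H. \<forall>y\<in>carrier H. inner H (p x) y = inner H x (p y))"

definition fixed :: "'v hilb \<Rightarrow> ('v \<Rightarrow> 'v) \<Rightarrow> 'v set" where
  "fixed H p = {x \<in> carrier H. p x = x}"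

lemma is_projD:
  assumes "is_proj H p"
  shows "p \<in> ops H H" "x \<in> carrier H \<Longrightarrow> p (p x) = p x"
    "x \<in> carrier H \<Longrightarrow> y \<in> carrier H \<Longrightarrow> inner H (p x) y = inner H x (p y)"
  using assms by (auto simp: is_proj_def)

context
  fixes H :: "'v hilb" (structure) and W
  assumes H [simp]: "fd_hilbert H" and W: "csubspace H W"
begin

lemma proj_spec:
  assumes "x \<in> carrier H"
  shows "proj H W x \<in> W" "u \<in> W \<Longrightarrow> inner H u (proj H W x) = inner H u x"
proof -
  have ex: "\<exists>w. w \<in> W \<and> (\<forall>u\<in>W. inner H u x = inner H u w)"
    using orthogonal_decomposition[OF H W assms] by blast
  have eq: "proj H W x = (SOME w. w \<in> W \<and> (\<forall>u\<in>W. inner H u x = inner H u w))"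
    unfolding proj_def by (rule restrict_apply'[OF assms])
  have "proj H W x \<in> W \<and> (\<forall>u\<in>W. inner H u x = inner H u (proj H W x))"
    unfolding eq by (rule someI_ex[OF ex])
  then show "proj H W x \<in> W" "u \<in> W \<Longrightarrow> inner H u (proj H W x) = inner H u x"
    by simp_all
qed

text \<open>Two vectors of W with the same inner products against W differ by a vector of W
  orthogonal to W, which is zero. So the choice in \<open>proj\<close> is forced, and linearity and
  special values follow by exhibiting candidates.\<close>

lemma proj_eqI:
  assumes "x \<in> carrier H" "w \<in> W" "\<And>u. u \<in> W \<Longrightarrow> inner H u w = inner H u x"
  shows "proj H W x = w"
proof -
  have sub: "W \<subseteq> carrier H" using W by (simp add: csubspace_iff)
  have w: "w \<in> carrier H" "proj H W x \<in> carrier H" using sub assms proj_spec by auto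
  let ?d = "proj H W x \<ominus> w"
  have "?d \<in> W" using proj_spec(1)[OF assms(1)] assms(2) W by (intro csubspaceD) auto
  then have "inner H ?d (proj H W x) = inner H ?d w"
    using assms proj_spec(2)[OF assms(1)] by simp
  then have "inner H ?d ?d = 0" using w by simp
  then show ?thesis using w hinner_self_eq_0[of H ?d] hminus_eq_0[OF H w(2,1)] by simp
qed

lemma proj_carrier [simp]: "x \<in> carrier H \<Longrightarrow> proj H W x \<in> carrier H"
  using proj_spec(1) W by (auto simp: csubspace_iff)

lemma proj_ident: "x \<in> W \<Longrightarrow> proj H W x = x"
  using W by (intro proj_eqI) (auto intro: csubspaceD)

lemma proj_orth: "x \<in> orthcomp H W \<Longrightarrow> proj H W x = \<zero>"
  using W by (intro proj_eqI) (auto simp: orthcomp_def csubspace_iff)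

lemma minus_proj_orth: "x \<in> carrier H \<Longrightarrow> x \<ominus> proj H W x \<in> orthcomp H W"
  using W by (auto simp: orthcomp_def csubspace_iff proj_spec subset_iff)

lemma proj_ops: "proj H W \<in> ops H H"
proof (rule opsI)
  note WD = csubspaceD[OF W fd_hilbert_cvs[OF H]]
  show "proj H W (x \<oplus> y) = proj H W x \<oplus> proj H W y" if "x \<in> carrier H" "y \<in> carrier H" for x y
    using that WD by (intro proj_eqI) (simp_all add: proj_spec)
  show "proj H W (c \<odot> x) = c \<odot> proj H W x" if "x \<in> carrier H" for c x
    using that WD by (intro proj_eqI) (simp_all add: proj_spec)
  show "proj H W \<in> extensional (carrier H)" by (simp add: proj_def)
qed simp

lemma is_proj_proj: "is_proj H (proj H W)"
proof -
  have "inner H (proj H W x) y = inner H x (proj H W y)" if "x \<in> carrier H" "y \<in> carrier H" for x y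
  proof -
    have "inner H (proj H W x) y = inner H (proj H W x) (proj H W y)"
      using proj_spec that by simp
    also have "\<dots> = cnj (inner H (proj H W y) (proj H W x))" using that cnj_hinner[of H] by simp
    also have "\<dots> = cnj (inner H (proj H W y) x)" using proj_spec that by simp
    also have "\<dots> = inner H x (proj H W y)" using that cnj_hinner[of H] by simp
    finally show ?thesis .
  qed
  then show ?thesis using proj_ops proj_ident proj_spec(1) by (auto simp: is_proj_def)
qed

lemma fixed_proj: "fixed H (proj H W) = W"
  using W proj_ident proj_spec(1) by (force simp: fixed_def csubspace_iff)

end

lemma csubspace_fixed:
  assumes "fd_hilbert H" "p \<in> ops H H" shows "csubspace H (fixed H p)"
  using assms by (auto simp: csubspace_iff fixed_def)

text \<open>The vector p x lies in the fixed space, and <u, p x> = <p u, x> = <u, x> when p fixes u.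
  With \<open>fixed_proj\<close> this gives the bijection between projections and subspaces.\<close>

lemma proj_fixed:
  assumes H [simp]: "fd_hilbert H" and p: "is_proj H p" shows "proj H (fixed H p) = p"
proof (rule ops_eqI)
  note [simp] = is_projD(2)[OF p] ops_closed[OF is_projD(1)[OF p]]
  have W: "csubspace H (fixed H p)" by (rule csubspace_fixed[OF H is_projD(1)[OF p]])
  show "proj H (fixed H p) \<in> ops H H" using W by (rule proj_ops[OF H])
  show "proj H (fixed H p) x = p x" if "x \<in> carrier H" for x
    using that by (intro proj_eqI[OF H W]) (auto simp: fixed_def is_projD(3)[OF p, symmetric])
qed (rule is_projD(1)[OF p])

text \<open>If p x = 0 and p y = y, then <y, x> = <p y, x> = <y, p x> = 0; conversely p is the
  orthogonal projection onto its fixed space.\<close>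

lemma proj_kernel_orthcomp:
  assumes H [simp]: "fd_hilbert H" and p: "is_proj H p" and x: "x \<in> carrier H"
  shows "p x = \<zero>\<^bsub>H\<^esub> \<longleftrightarrow> x \<in> orthcomp H (fixed H p)"
proof
  note [simp] = is_projD(2)[OF p] ops_closed[OF is_projD(1)[OF p]]
  assume 0: "p x = \<zero>\<^bsub>H\<^esub>"
  have "inner H y x = 0" if "y \<in> fixed H p" for y
  proof -
    have y: "y \<in> carrier H" "p y = y" using that by (auto simp: fixed_def)
    then have "inner H y x = inner H y (p x)" using is_projD(3)[OF p y(1) x] by simp
    then show ?thesis using 0 y by simp
  qed
  then show "x \<in> orthcomp H (fixed H p)" using x by (simp add: orthcomp_def)
next
  assume "x \<in> orthcomp H (fixed H p)"
  then show "p x = \<zero>\<^bsub>H\<^esub>"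
    using proj_orth[OF H csubspace_fixed[OF H is_projD(1)[OF p]]] proj_fixed[OF H p] by metis
qed

lemma is_proj_compl:
  assumes H [simp]: "fd_hilbert H" and p: "is_proj H p"
  shows "is_proj H (op_id H \<ominus>\<^bsub>lin_ops H H\<^esub> p)"
    and "fixed H (op_id H \<ominus>\<^bsub>lin_ops H H\<^esub> p) = orthcomp H (fixed H p)"
proof -
  note p1 = is_projD(1)[OF p]
  note [simp] = p1 is_projD(2)[OF p] ops_closed[OF p1] ops_minus[OF p1]
  have c [simp]: "op_id H \<ominus>\<^bsub>lin_ops H H\<^esub> p \<in> ops H H" by simp
  have xx: "x \<ominus>\<^bsub>H\<^esub> \<zero>\<^bsub>H\<^esub> = x" if "x \<in> carrier H" for x using that by (simp add: cvs_minus)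
  show "is_proj H (op_id H \<ominus>\<^bsub>lin_ops H H\<^esub> p)"
    unfolding is_proj_def using is_projD[OF p] by (simp add: xx)
  have "x \<ominus>\<^bsub>H\<^esub> p x = x \<longleftrightarrow> p x = \<zero>\<^bsub>H\<^esub>" if x: "x \<in> carrier H" for x
  proof
    assume eq: "x \<ominus>\<^bsub>H\<^esub> p x = x"
    show "p x = \<zero>\<^bsub>H\<^esub>"
    proof (rule hinner_ext[of H])
      fix z assume z: "z \<in> carrier H"
      have "inner H z x - inner H z (p x) = inner H z x"
        using hinner(7)[OF H z x, of "p x"] x eq by simp
      then show "inner H z (p x) = inner H z \<zero>\<^bsub>H\<^esub>" using z by simp
    qed (use x in auto)
  qed (simp add: xx x)
  then show "fixed H (op_id H \<ominus>\<^bsub>lin_ops H H\<^esub> p) = orthcomp H (fixed H p)"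
    using proj_kernel_orthcomp[OF H p] unfolding fixed_def by (auto simp: orthcomp_def)
qed

section \<open>One-dimensional spaces\<close>

lemma Re_cnj_mult_self_pos:
  assumes "x \<noteq> 0" shows "0 < Re (cnj x * x)"
proof -
  have "cnj x * x = of_real ((cmod x)\<^sup>2)"
    by (metis complex_norm_square mult.commute)
  then have "Re (cnj x * x) = (cmod x)\<^sup>2" by (metis Re_complex_of_real)
  then show ?thesis using assms by (metis zero_less_norm_iff zero_less_power)
qed

lemma fd_hilbert_cplx [simp]: "fd_hilbert cplx"
proof -
  have vs: "cvs cplx"
    by (rule vs_criteria[OF class_field])
      (auto simp: cplx_def algebra_simps intro: exI[of _ "- _"])
  interpret vectorspace "class_ring :: complex ring" cplx by (rule vs)
  have one: "1 \<in> cspan cplx {1}" using cspan_superset[OF vs, of "{1}"] by (simp add: cplx_def)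
  have "z \<in> cspan cplx {1}" for z
    using csubspaceD(4)[OF csubspace_cspan[OF vs] vs one, of z] by (simp add: cplx_def)
  then have "fin_dim" unfolding fin_dim_def by (intro exI[of _ "{1}"]) (auto simp: cplx_def)
  then show ?thesis
    using vs Re_cnj_mult_self_pos unfolding fd_hilbert_def fd_hilbert_axioms_def
    by (intro conjI allI impI) (simp_all add: cplx_def algebra_simps del: times_complex.sel complex_cnj)
qed

lemma fd_hilbert_ell2 [simp]: "fd_hilbert (ell2 {a})"
proof -
  let ?E = "ell2 {a}"
  have ext: "f = g" if "f \<in> extensional {a}" "g \<in> extensional {a}" "f a = g a" for f g :: "'a \<Rightarrow> complex"
    using that by (intro extensionalityI[of _ "{a}"]) auto
  have vs: "cvs ?E"
  proof (rule vs_criteria[OF class_field])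
    show "\<forall>v\<in>carrier ?E. \<exists>neg_v\<in>carrier ?E. v \<oplus>\<^bsub>?E\<^esub> neg_v = \<zero>\<^bsub>?E\<^esub>"
    proof
      fix v assume "v \<in> carrier ?E"
      then show "\<exists>neg_v\<in>carrier ?E. v \<oplus>\<^bsub>?E\<^esub> neg_v = \<zero>\<^bsub>?E\<^esub>"
        by (intro bexI[of _ "\<lambda>i\<in>{a}. - v i"]) (auto simp: ell2_def intro!: ext)
    qed
  qed (auto simp: ell2_def algebra_simps intro!: ext)
  interpret vectorspace "class_ring :: complex ring" ?E by (rule vs)
  let ?u = "\<lambda>i\<in>{a}. 1 :: complex"
  have u: "?u \<in> carrier ?E" by (simp add: ell2_def)
  have one: "?u \<in> cspan ?E {?u}" using cspan_superset[OF vs, of "{?u}"] u by simp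
  have sub: "cspan ?E {?u} \<subseteq> carrier ?E" using csubspace_cspan[OF vs, of "{?u}"] u by (simp add: csubspace_iff[OF vs])
  have "f \<in> cspan ?E {?u}" if f: "f \<in> carrier ?E" for f
  proof -
    have "f = f a \<odot>\<^bsub>?E\<^esub> ?u" using f by (intro ext) (auto simp: ell2_def)
    then show ?thesis using csubspaceD(4)[OF csubspace_cspan[OF vs] vs one, of "f a"] u by simp
  qed
  then have "fin_dim" unfolding fin_dim_def using sub u by (intro exI[of _ "{?u}"]) auto
  moreover have "f a \<noteq> 0" if "f \<in> carrier ?E" "f \<noteq> \<zero>\<^bsub>?E\<^esub>" for f
    using that ext[of f "\<zero>\<^bsub>?E\<^esub>"] by (auto simp: ell2_def)
  ultimately show ?thesis
    using vs Re_cnj_mult_self_pos unfolding fd_hilbert_def fd_hilbert_axioms_def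
    by (intro conjI allI impI) (simp_all add: ell2_def algebra_simps del: times_complex.sel complex_cnj)
qed

section \<open>Quantum functions\<close>

lemma qsetD: "qset X \<Longrightarrow> A \<in> X \<Longrightarrow> fd_hilbert A" "qset X \<Longrightarrow> A \<in> X \<Longrightarrow> carrier A \<noteq> {\<zero>\<^bsub>A\<^esub>}"
  by (simp_all add: qset_def)

text \<open>Atoms are nonzero, so the scalar of a multiple of the identity can be read off at a unit
  vector.\<close>

lemma unit_vector_exists:
  assumes [simp]: "fd_hilbert A" and "carrier A \<noteq> {\<zero>\<^bsub>A\<^esub>}"
  shows "\<exists>y\<in>carrier A. inner A y y = 1"
proof -
  have "\<zero>\<^bsub>A\<^esub> \<in> carrier A" by simp
  then obtain x where x: "x \<in> carrier A" "x \<noteq> \<zero>\<^bsub>A\<^esub>" using assms(2) by blast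
  then obtain c where "inner A (c \<odot>\<^bsub>A\<^esub> x) (c \<odot>\<^bsub>A\<^esub> x) = 1" using normalise[of A x] by auto
  then show ?thesis using x(1) by (intro bexI[of _ "c \<odot>\<^bsub>A\<^esub> x"]) (simp_all del: hinner)
qed

lemma qRel_iff:
  "R \<in> qRel X Y \<longleftrightarrow> R \<in> extensional (X \<times> Y) \<and> (\<forall>A\<in>X. \<forall>B\<in>Y. csubspace (lin_ops A B) (R (A, B)))"
  by (auto simp: qRel_def PiE_iff)

lemma qRel_csubspace: "R \<in> qRel X Y \<Longrightarrow> A \<in> X \<Longrightarrow> B \<in> Y \<Longrightarrow> csubspace (lin_ops A B) (R (A, B))"
  by (simp add: qRel_iff)

lemma qRel_ops:
  assumes "R \<in> qRel X Y" "A \<in> X" "B \<in> Y" "r \<in> R (A, B)" shows "r \<in> ops A B"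
  using qRel_csubspace[OF assms(1-3)] assms(4)
  unfolding VectorSpace.subspace_def LinearCombinations.submodule_def by blast

lemma qRel_eqI:
  assumes "R \<in> qRel X Y" "S \<in> qRel X Y" "\<And>A B. A \<in> X \<Longrightarrow> B \<in> Y \<Longrightarrow> R (A, B) = S (A, B)"
  shows "R = S"
  using assms by (intro extensionalityI[of R "X \<times> Y" S]) (auto simp: qRel_iff)

lemma qFun_qRel: "F \<in> qFun X Y \<Longrightarrow> F \<in> qRel X Y"
  by (simp add: qFun_def)

lemma rel_comp_apply:
  "A \<in> X \<Longrightarrow> C \<in> Z \<Longrightarrow> rel_comp X Y Z S R (A, C)
     = cspan (lin_ops A C) {op_comp A s r | B s r. B \<in> Y \<and> s \<in> S (B, C) \<and> r \<in> R (A, B)}"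
  by (simp add: rel_comp_def)

context
  fixes X :: "'v hilb set" and Y :: "'w hilb set" and Z :: "'u hilb set" and R S
  assumes X: "qset X" and Y: "qset Y" and Z: "qset Z" and R: "R \<in> qRel X Y" and S: "S \<in> qRel Y Z"
begin

lemma rel_comp_generators:
  assumes "A \<in> X" "C \<in> Z"
  shows "{op_comp A s r | B s r. B \<in> Y \<and> s \<in> S (B, C) \<and> r \<in> R (A, B)} \<subseteq> ops A C"
  using assms qRel_ops[OF R] qRel_ops[OF S] op_comp_closed qsetD(1)[OF X] by blast

lemma rel_comp_base:
  assumes "A \<in> X" "C \<in> Z" "B \<in> Y" "s \<in> S (B, C)" "r \<in> R (A, B)"
  shows "op_comp A s r \<in> rel_comp X Y Z S R (A, C)"
  unfolding rel_comp_apply[OF assms(1,2)]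
  using cspan_superset[OF cvs_lin_ops rel_comp_generators[OF assms(1,2)]] assms qsetD(1)[OF X] qsetD(1)[OF Z]
  by blast

lemma rel_comp_least:
  assumes "A \<in> X" "C \<in> Z" "csubspace (lin_ops A C) W"
    and "\<And>B s r. B \<in> Y \<Longrightarrow> s \<in> S (B, C) \<Longrightarrow> r \<in> R (A, B) \<Longrightarrow> op_comp A s r \<in> W"
  shows "rel_comp X Y Z S R (A, C) \<subseteq> W"
  unfolding rel_comp_apply[OF assms(1,2)]
  using assms qsetD(1)[OF X] qsetD(1)[OF Z] by (intro cspan_least cvs_lin_ops) auto

lemma rel_comp_qRel: "rel_comp X Y Z S R \<in> qRel X Z"
proof -
  have "csubspace (lin_ops A C) (rel_comp X Y Z S R (A, C))" if "A \<in> X" "C \<in> Z" for A C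
    unfolding rel_comp_apply[OF that]
    using that qsetD(1)[OF X] qsetD(1)[OF Z] by (intro csubspace_cspan rel_comp_generators) auto
  then show ?thesis by (auto simp: qRel_iff rel_comp_def extensional_def)
qed

end

lemma rel_comp_induct [consumes 8, case_names base zero add smult]:
  assumes X: "qset X" and Y: "qset Y" and Z: "qset Z" and R: "R \<in> qRel X Y" and S: "S \<in> qRel Y Z"
    and A: "A \<in> X" and C: "C \<in> Z" and t: "t \<in> rel_comp X Y Z S R (A, C)"
    and "\<And>B s r. B \<in> Y \<Longrightarrow> s \<in> S (B, C) \<Longrightarrow> r \<in> R (A, B) \<Longrightarrow> P (op_comp A s r)"
    and "P \<zero>\<^bsub>lin_ops A C\<^esub>"
    and "\<And>t u. t \<in> ops A C \<Longrightarrow> u \<in> ops A C \<Longrightarrow> P t \<Longrightarrow> P u \<Longrightarrow> P (t \<oplus>\<^bsub>lin_ops A C\<^esub> u)"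
    and "\<And>c t. t \<in> ops A C \<Longrightarrow> P t \<Longrightarrow> P (c \<odot>\<^bsub>lin_ops A C\<^esub> t)"
  shows "P t"
proof -
  have cvs: "cvs (lin_ops A C)" using qsetD(1)[OF X A] qsetD(1)[OF Z C] by simp
  show ?thesis
    by (rule cspan_induct[OF cvs t[unfolded rel_comp_apply[OF A C]] rel_comp_generators[OF X Y Z R S A C]])
      (use assms(9-) in auto)
qed

text \<open>The adjoint is antilinear, yet it maps subspaces to subspaces: c r^dagger is the adjoint
  of the multiple of r by \<open>cnj c\<close>.\<close>

lemma rel_adj_qRel:
  assumes X: "qset X" and Y: "qset Y" and R: "R \<in> qRel X Y"
  shows "rel_adj X Y R \<in> qRel Y X"
proof -
  have "csubspace (lin_ops B A) (op_adj A B ` R (A, B))" if A: "A \<in> X" and B: "B \<in> Y" for A B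
  proof -
    note [simp] = qsetD(1)[OF X A] qsetD(1)[OF Y B]
    note RD = csubspaceD[OF qRel_csubspace[OF R A B] cvs_lin_ops]
    have ops: "r \<in> ops A B" if "r \<in> R (A, B)" for r using that RD(1) by simp
    have z: "\<zero>\<^bsub>lin_ops B A\<^esub> = op_adj A B \<zero>\<^bsub>lin_ops A B\<^esub>"
      using ops RD(2) by (intro ops_eqI[of _ B A]) (simp_all add: op_adj_zero_apply)
    have a: "op_adj A B r \<oplus>\<^bsub>lin_ops B A\<^esub> op_adj A B s = op_adj A B (r \<oplus>\<^bsub>lin_ops A B\<^esub> s)"
      if "r \<in> R (A, B)" "s \<in> R (A, B)" for r s
      using that ops RD(3)[OF _ _ that] by (intro ops_eqI[of _ B A]) (simp_all add: op_adj_add_apply)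
    have c: "c \<odot>\<^bsub>lin_ops B A\<^esub> op_adj A B r = op_adj A B (cnj c \<odot>\<^bsub>lin_ops A B\<^esub> r)"
      if "r \<in> R (A, B)" for r c
      using that ops by (intro ops_eqI[of _ B A]) (simp_all add: op_adj_smult_apply)
    show ?thesis
      using RD ops by (auto simp: csubspace_iff z a c)
  qed
  then show ?thesis by (auto simp: qRel_iff rel_adj_def extensional_def)
qed

lemma rel_id_qRel: "qset X \<Longrightarrow> rel_id X \<in> qRel X X"
proof -
  assume X: "qset X"
  have "csubspace (lin_ops A A') (rel_id X (A, A'))" if A: "A \<in> X" and A': "A' \<in> X" for A A'
  proof (cases "A = A'")
    case True
    note [simp] = qsetD(1)[OF X A]
    have zero: "\<exists>c. \<zero>\<^bsub>lin_ops A A\<^esub> = c \<odot>\<^bsub>lin_ops A A\<^esub> op_id A" by (intro exI[of _ 0]) simp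
    have add: "\<exists>c. a \<odot>\<^bsub>lin_ops A A\<^esub> op_id A \<oplus>\<^bsub>lin_ops A A\<^esub> b \<odot>\<^bsub>lin_ops A A\<^esub> op_id A = c \<odot>\<^bsub>lin_ops A A\<^esub> op_id A" for a b
      using cvs_distrib(1)[of "lin_ops A A" "op_id A" a b, symmetric] by auto
    have "csubspace (lin_ops A A) {c \<odot>\<^bsub>lin_ops A A\<^esub> op_id A | c. True}"
      using zero add by (auto simp: csubspace_iff)
    then show ?thesis using True A by (simp add: rel_id_def)
  next
    case False
    then show ?thesis using that qsetD(1)[OF X] by (auto simp: rel_id_def intro: csubspace_zero)
  qed
  then show ?thesis by (auto simp: qRel_iff rel_id_def extensional_def)
qed

section \<open>Functional and total relations\<close>

definition qfunctional :: "'v hilb set \<Rightarrow> 'w hilb set \<Rightarrow> ('v, 'w) qrel \<Rightarrow> bool" where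
  "qfunctional X Y F \<longleftrightarrow> (\<forall>A\<in>X. \<forall>B\<in>Y. \<forall>r\<in>F (A, B).
     (\<forall>s\<in>F (A, B). \<exists>c. \<forall>y\<in>carrier B. s (op_adj A B r y) = c \<odot>\<^bsub>B\<^esub> y) \<and>
     (\<forall>B'\<in>Y. B' \<noteq> B \<longrightarrow> (\<forall>s\<in>F (A, B'). \<forall>y\<in>carrier B. s (op_adj A B r y) = \<zero>\<^bsub>B'\<^esub>)))"

text \<open>In general weaker than the identity lying below F^dagger F; for functional relations the
  two conditions agree, by \<open>qFun_iff\<close>.\<close>

definition qtotal :: "'v hilb set \<Rightarrow> 'w hilb set \<Rightarrow> ('v, 'w) qrel \<Rightarrow> bool" where
  "qtotal X Y F \<longleftrightarrow>
     (\<forall>A\<in>X. \<forall>x\<in>carrier A. (\<forall>B\<in>Y. \<forall>r\<in>F (A, B). r x = \<zero>\<^bsub>B\<^esub>) \<longrightarrow> x = \<zero>\<^bsub>A\<^esub>)"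

lemma qfunctionalD:
  assumes "qfunctional X Y F" "A \<in> X" "B \<in> Y" "r \<in> F (A, B)"
  shows "s \<in> F (A, B) \<Longrightarrow> \<exists>c. \<forall>y\<in>carrier B. s (op_adj A B r y) = c \<odot>\<^bsub>B\<^esub> y"
    "B' \<in> Y \<Longrightarrow> B' \<noteq> B \<Longrightarrow> s \<in> F (A, B') \<Longrightarrow> y \<in> carrier B \<Longrightarrow> s (op_adj A B r y) = \<zero>\<^bsub>B'\<^esub>"
  using assms by (auto simp: qfunctional_def)

text \<open>Each value of \<open>rel_id Y\<close> is a subspace, so it contains the composite as
  soon as it contains the generators s r^dagger.\<close>

lemma rel_comp_adj_le_id_iff:
  assumes X: "qset X" and Y: "qset Y" and F: "F \<in> qRel X Y"
  shows "rel_le Y Y (rel_comp Y X Y F (rel_adj X Y F)) (rel_id Y) \<longleftrightarrow> qfunctional X Y F"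
proof
  note base = rel_comp_base[OF Y X Y rel_adj_qRel[OF X Y F] F]
  assume le: "rel_le Y Y (rel_comp Y X Y F (rel_adj X Y F)) (rel_id Y)"
  have mem: "op_comp B s (op_adj A B r) \<in> rel_id Y (B, B')"
    if "A \<in> X" "B \<in> Y" "B' \<in> Y" "r \<in> F (A, B)" "s \<in> F (A, B')" for A B B' r s
    using base[of B B' A s "op_adj A B r"] that le by (auto simp: rel_le_def rel_adj_def)
  show "qfunctional X Y F"
    unfolding qfunctional_def
  proof (intro ballI conjI impI)
    fix A B r s assume h: "A \<in> X" "B \<in> Y" "r \<in> F (A, B)" "s \<in> F (A, B)"
    then obtain c where c: "op_comp B s (op_adj A B r) = c \<odot>\<^bsub>lin_ops B B\<^esub> op_id B"
      using mem[of A B B r s] by (auto simp: rel_id_def)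
    have "s (op_adj A B r y) = c \<odot>\<^bsub>B\<^esub> y" if "y \<in> carrier B" for y
      using fun_cong[OF c, of y] that by simp
    then show "\<exists>c. \<forall>y\<in>carrier B. s (op_adj A B r y) = c \<odot>\<^bsub>B\<^esub> y" by blast
  next
    fix A B B' r s y
    assume h: "A \<in> X" "B \<in> Y" "r \<in> F (A, B)" "B' \<in> Y" "B' \<noteq> B" "s \<in> F (A, B')" "y \<in> carrier B"
    then have "op_comp B s (op_adj A B r) = \<zero>\<^bsub>lin_ops B B'\<^esub>"
      using mem[of A B B' r s] by (auto simp: rel_id_def)
    from fun_cong[OF this, of y] h show "s (op_adj A B r y) = \<zero>\<^bsub>B'\<^esub>" by simp
  qed
next
  assume fn: "qfunctional X Y F"
  show "rel_le Y Y (rel_comp Y X Y F (rel_adj X Y F)) (rel_id Y)"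
    unfolding rel_le_def
  proof (intro ballI rel_comp_least[OF Y X Y rel_adj_qRel[OF X Y F] F])
    fix B B' A s r' assume h: "B \<in> Y" "B' \<in> Y" "A \<in> X" "s \<in> F (A, B')" "r' \<in> rel_adj X Y F (B, A)"
    then obtain r where r: "r \<in> F (A, B)" "r' = op_adj A B r" by (auto simp: rel_adj_def)
    note [simp] = qsetD(1)[OF X h(3)] qsetD(1)[OF Y h(1)] qsetD(1)[OF Y h(2)]
    have ro: "r \<in> ops A B" and so: "s \<in> ops A B'" using qRel_ops[OF F] h r by auto
    have co: "op_comp B s r' \<in> ops B B'" using ro so r by (intro op_comp_closed[of r' B A]) auto
    show "op_comp B s r' \<in> rel_id Y (B, B')"
    proof (cases "B' = B")
      case True
      then obtain c where c: "\<forall>y\<in>carrier B. s (r' y) = c \<odot>\<^bsub>B\<^esub> y"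
        using qfunctionalD(1)[OF fn h(3) h(1) r(1), of s] h(4) r by auto
      have "op_comp B s r' = c \<odot>\<^bsub>lin_ops B B\<^esub> op_id B"
        using co True c by (intro ops_eqI[of _ B B]) auto
      then show ?thesis using h True by (auto simp: rel_id_def)
    next
      case False
      have "op_comp B s r' = \<zero>\<^bsub>lin_ops B B'\<^esub>"
        using co qfunctionalD(2)[OF fn h(3) h(1) r(1) h(2) False h(4)] r(2)
        by (intro ops_eqI[of _ B B']) auto
      then show ?thesis using h False by (auto simp: rel_id_def)
    qed
  qed (use Y rel_id_qRel[OF Y] in \<open>auto intro: qRel_csubspace\<close>)
qed

text \<open>The identity on A is a linear combination of products s r with r in F(A,B), so it kills
  every vector that all these r kill.\<close>

lemma id_le_adj_comp_imp_qtotal: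
  assumes X: "qset X" and Y: "qset Y" and F: "F \<in> qRel X Y"
    and le: "rel_le X X (rel_id X) (rel_comp X Y X (rel_adj X Y F) F)"
  shows "qtotal X Y F"
  unfolding qtotal_def
proof (intro ballI impI)
  fix A x assume A: "A \<in> X" and x: "x \<in> carrier A" and 0: "\<forall>B\<in>Y. \<forall>r\<in>F (A, B). r x = \<zero>\<^bsub>B\<^esub>"
  note [simp] = qsetD(1)[OF X A]
  have "op_id A \<in> rel_id X (A, A)"
    using A by (auto simp: rel_id_def intro!: exI[of _ 1])
  then have "op_id A \<in> rel_comp X Y X (rel_adj X Y F) F (A, A)"
    using le A by (auto simp: rel_le_def)
  with X Y X F rel_adj_qRel[OF X Y F] A A have "op_id A x = \<zero>\<^bsub>A\<^esub>"
  proof (induction rule: rel_comp_induct)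
    case (base B s r)
    then obtain r' where r': "r' \<in> F (A, B)" "s = op_adj A B r'" using A by (auto simp: rel_adj_def)
    have "r x = \<zero>\<^bsub>B\<^esub>" using 0 base by blast
    moreover have "s \<in> ops B A" using qRel_ops[OF F A base(1) r'(1)] r'(2) qsetD(1)[OF Y base(1)] by simp
    ultimately show ?case using x qsetD(1)[OF Y base(1)] by simp
  qed (use x in simp_all)
  then show "x = \<zero>\<^bsub>A\<^esub>" using x by simp
qed

lemma fun_star_apply:
  assumes A: "A \<in> X"
  shows "fun_star X Y F b A = (\<Oplus>\<^bsub>lin_ops A A\<^esub> B \<in> {B \<in> Y. F (A, B) \<noteq> {\<zero>\<^bsub>lin_ops A B\<^esub>}}.
       \<Oplus>\<^bsub>lin_ops A A\<^esub> v \<in> some_onb A B (F (A, B)). op_comp A (op_adj A B v) (op_comp A (b B) v))"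
  using A by (simp add: fun_star_def)

section \<open>Orthonormal bases of the hom-spaces of a partial function\<close>

context
  fixes X :: "'v hilb set" and Y :: "'w hilb set" and F
  assumes X: "qset X" and Y: "qset Y" and F: "F \<in> qRel X Y" and fn: "qfunctional X Y F"
begin

text \<open>The scalar exists by functionality and is unique by evaluation at a unit vector of B, so
  the definite description in \<open>fun_inner\<close> denotes it.\<close>

lemma fun_inner_apply:
  assumes A: "A \<in> X" and B: "B \<in> Y" and v: "v \<in> F (A, B)" and w: "w \<in> F (A, B)" and y: "y \<in> carrier B"
  shows "w (op_adj A B v y) = fun_inner A B v w \<odot>\<^bsub>B\<^esub> y"
proof -
  note [simp] = qsetD(1)[OF X A] qsetD(1)[OF Y B]
  have vo: "v \<in> ops A B" and wo: "w \<in> ops A B" using qRel_ops[OF F A B] v w by auto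
  have co: "op_comp B w (op_adj A B v) \<in> ops B B" using vo wo by (intro op_comp_closed[of _ B A]) auto
  obtain c where c: "\<forall>y\<in>carrier B. w (op_adj A B v y) = c \<odot>\<^bsub>B\<^esub> y"
    using qfunctionalD(1)[OF fn A B v w] by blast
  obtain u where u: "u \<in> carrier B" "inner B u u = 1"
    using unit_vector_exists[OF _ qsetD(2)[OF Y B]] by auto
  have eq: "op_comp B w (op_adj A B v) = c \<odot>\<^bsub>lin_ops B B\<^esub> op_id B"
    using co c by (intro ops_eqI[of _ B B]) auto
  have "d = c" if "op_comp B w (op_adj A B v) = d \<odot>\<^bsub>lin_ops B B\<^esub> op_id B" for d
  proof -
    have "c \<odot>\<^bsub>B\<^esub> u = d \<odot>\<^bsub>B\<^esub> u" using fun_cong[OF that, of u] fun_cong[OF eq, of u] u by simp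
    then have "inner B u (c \<odot>\<^bsub>B\<^esub> u) = inner B u (d \<odot>\<^bsub>B\<^esub> u)" by simp
    then show ?thesis using u by simp
  qed
  then have "fun_inner A B v w = c" unfolding fun_inner_def using eq by (intro the_equality) auto
  then show ?thesis using c y by simp
qed

text \<open>For a unit vector y of B, the map v -> v^dagger y is thus an antilinear isometry from
  F(A,B) into A. It transfers the geometry of A to F(A,B), which carries no Hilbert space record of
  its own.\<close>

lemma fun_inner_eq_inner:
  assumes A: "A \<in> X" and B: "B \<in> Y" and v: "v \<in> F (A, B)" and w: "w \<in> F (A, B)"
    and y: "y \<in> carrier B" "z \<in> carrier B"
  shows "inner A (op_adj A B w z) (op_adj A B v y) = fun_inner A B v w * inner B z y"
proof -
  note [simp] = qsetD(1)[OF X A] qsetD(1)[OF Y B]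
  have vo: "v \<in> ops A B" and wo: "w \<in> ops A B" using qRel_ops[OF F A B] v w by auto
  have "inner A (op_adj A B w z) (op_adj A B v y) = inner B z (w (op_adj A B v y))"
    using vo wo y by (intro op_adj_inner_left) auto
  then show ?thesis using fun_inner_apply[OF A B v w y(1)] y by simp
qed

text \<open>If v^dagger y vanishes at a unit vector y, then (v|v) = 0, hence v^dagger vanishes
  everywhere and v = 0.\<close>

lemma adj_eval_inj:
  assumes A: "A \<in> X" and B: "B \<in> Y" and v: "v \<in> F (A, B)"
    and y: "y \<in> carrier B" "inner B y y = 1" and 0: "op_adj A B v y = \<zero>\<^bsub>A\<^esub>"
  shows "v = \<zero>\<^bsub>lin_ops A B\<^esub>"
proof -
  note [simp] = qsetD(1)[OF X A] qsetD(1)[OF Y B]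
  have vo: "v \<in> ops A B" using qRel_ops[OF F A B] v by auto
  have "fun_inner A B v v = 0" using fun_inner_eq_inner[OF A B v v y(1) y(1)] 0 y by simp
  then have "op_adj A B v z = \<zero>\<^bsub>A\<^esub>" if "z \<in> carrier B" for z
    using fun_inner_eq_inner[OF A B v v that that] hinner_self_eq_0[of A "op_adj A B v z"] vo that
    by (simp del: op_adj_inner_right op_adj_inner_left)
  then have "v x = \<zero>\<^bsub>B\<^esub>" if "x \<in> carrier A" for x
    using vo that op_adj_inner_left[of A B v x] by (intro hinner_ext[of B]) (auto simp del: op_adj_inner_left)
  then show ?thesis
    using vo csubspaceD(2)[OF csubspace_carrier, of "lin_ops A B"] by (intro ops_eqI[of v A B]) auto
qed

text \<open>The antilinear isometry phi, evaluation of adjoints at a unit vector y, maps F(A,B) onto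
  a subspace of A; the preimage of an orthonormal basis of that subspace is the required
  basis.\<close>

lemma is_onb_exists:
  assumes A: "A \<in> X" and B: "B \<in> Y"
  shows "\<exists>E. is_onb A B (F (A, B)) E"
proof -
  let ?L = "lin_ops A B" and ?W = "F (A, B)"
  note [simp] = qsetD(1)[OF X A] qsetD(1)[OF Y B]
  note W = qRel_csubspace[OF F A B]
  note WD = csubspaceD[OF W cvs_lin_ops]
  obtain y where y: "y \<in> carrier B" "inner B y y = 1"
    using unit_vector_exists[OF _ qsetD(2)[OF Y B]] by auto
  define \<phi> where "\<phi> r = op_adj A B r y" for r
  have ops: "r \<in> ops A B" if "r \<in> ?W" for r using that WD(1) by simp
  have \<phi>A: "\<phi> r \<in> carrier A" if "r \<in> ?W" for r using ops[OF that] y by (simp add: \<phi>_def)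
  have \<phi>_add: "\<phi> (r \<oplus>\<^bsub>?L\<^esub> s) = \<phi> r \<oplus>\<^bsub>A\<^esub> \<phi> s" if "r \<in> ?W" "s \<in> ?W" for r s
    using that ops y by (simp add: \<phi>_def op_adj_add_apply)
  have \<phi>_smult: "\<phi> (c \<odot>\<^bsub>?L\<^esub> r) = cnj c \<odot>\<^bsub>A\<^esub> \<phi> r" if "r \<in> ?W" for c r
    using that ops y by (simp add: \<phi>_def op_adj_smult_apply)
  have \<phi>_zero: "\<phi> \<zero>\<^bsub>?L\<^esub> = \<zero>\<^bsub>A\<^esub>" using y by (simp add: \<phi>_def op_adj_zero_apply)
  have \<phi>_inj: "r = s" if r: "r \<in> ?W" and s: "s \<in> ?W" and eq: "\<phi> r = \<phi> s" for r s
  proof -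
    have m: "(-1) \<odot>\<^bsub>?L\<^esub> s \<in> ?W" using s WD by simp
    have "\<phi> s \<oplus>\<^bsub>A\<^esub> (-1) \<odot>\<^bsub>A\<^esub> \<phi> s = \<zero>\<^bsub>A\<^esub>"
      using hminus_self[OF _ \<phi>A[OF s]] cvs_minus[OF _ \<phi>A[OF s] \<phi>A[OF s]] by (metis \<open>fd_hilbert A\<close> fd_hilbert_cvs)
    then have "\<phi> (r \<oplus>\<^bsub>?L\<^esub> (-1) \<odot>\<^bsub>?L\<^esub> s) = \<zero>\<^bsub>A\<^esub>"
      using r s m eq by (simp add: \<phi>_add \<phi>_smult)
    then have "r \<oplus>\<^bsub>?L\<^esub> (-1) \<odot>\<^bsub>?L\<^esub> s = \<zero>\<^bsub>?L\<^esub>"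
      using WD(3)[OF _ _ r m] unfolding \<phi>_def by (intro adj_eval_inj[OF A B _ y]) simp_all
    then have "r \<ominus>\<^bsub>?L\<^esub> s = \<zero>\<^bsub>?L\<^esub>" using r s ops by (simp add: cvs_minus)
    then show ?thesis
      using iffD1[OF abelian_group.minus_other_side[OF cvs_abelian_group[OF cvs_lin_ops], of A B r s]] ops r s by auto
  qed
  have image_csubspace: "csubspace A (\<phi> ` V)" if V: "csubspace ?L V" "V \<subseteq> ?W" for V
  proof -
    note VD = csubspaceD[OF V(1) cvs_lin_ops]
    have "\<phi> r \<oplus>\<^bsub>A\<^esub> \<phi> s \<in> \<phi> ` V" if "r \<in> V" "s \<in> V" for r s
      using \<phi>_add[of r s] that VD(3)[of r s] V(2) by (metis \<open>fd_hilbert A\<close> \<open>fd_hilbert B\<close> imageI subset_iff)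
    moreover have "c \<odot>\<^bsub>A\<^esub> \<phi> r \<in> \<phi> ` V" if "r \<in> V" for r c
      using \<phi>_smult[of r "cnj c"] that VD(4)[of r "cnj c"] V(2) by (metis \<open>fd_hilbert A\<close> \<open>fd_hilbert B\<close> complex_cnj_cnj imageI subset_iff)
    moreover have "\<zero>\<^bsub>A\<^esub> \<in> \<phi> ` V" using VD(2) \<phi>_zero by (metis \<open>fd_hilbert A\<close> \<open>fd_hilbert B\<close> imageI)
    ultimately show ?thesis using V(2) \<phi>A by (auto simp: csubspace_iff)
  qed
  obtain E0 where E0: "onb A (\<phi> ` ?W) E0" using onb_exists[OF _ image_csubspace[OF W order_refl]] by auto
  define E where "E = {v \<in> ?W. \<phi> v \<in> E0}"
  have EW: "E \<subseteq> ?W" by (auto simp: E_def)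
  have "\<phi> ` E \<subseteq> E0" "inj_on \<phi> E" using \<phi>_inj EW by (auto simp: E_def inj_on_def)
  then have fin: "finite E" using E0 by (metis finite_imageD finite_subset onb_def)
  have E0E: "E0 \<subseteq> \<phi> ` E" using E0 by (auto simp: onb_def E_def)
  have Eops: "E \<subseteq> ops A B" using EW ops by blast
  note spE = csubspace_cspan[OF cvs_lin_ops Eops]
  have sub: "cspan ?L E \<subseteq> ?W" by (rule cspan_least[OF _ W EW]) simp
  \<comment> \<open>The image of the span under phi is a subspace of A that contains
    \<open>E0\<close>, hence also the expansion of phi r; injectivity of phi then puts r into the
    span.\<close>
  have "r \<in> cspan ?L E" if r: "r \<in> ?W" for r
  proof -
    have cs: "csubspace A (\<phi> ` cspan ?L E)" using image_csubspace spE sub by simp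
    have "E0 \<subseteq> \<phi> ` cspan ?L E" using E0E cspan_superset[OF _ Eops] by (auto simp: subset_iff)
    then have "(\<Oplus>\<^bsub>A\<^esub>e\<in>E0. inner A e (\<phi> r) \<odot>\<^bsub>A\<^esub> e) \<in> \<phi> ` cspan ?L E"
      using E0 cs by (intro csubspace_finsum) (auto simp: onb_def intro: csubspaceD(4)[OF cs])
    moreover have "\<phi> r = (\<Oplus>\<^bsub>A\<^esub>e\<in>E0. inner A e (\<phi> r) \<odot>\<^bsub>A\<^esub> e)" using E0 r by (simp add: onb_def)
    ultimately obtain s where "s \<in> cspan ?L E" "\<phi> r = \<phi> s" by auto
    then show ?thesis using \<phi>_inj[OF r, of s] sub by auto
  qed
  then have span: "cspan ?L E = ?W" using sub by blast
  have "fun_inner A B v w = (if v = w then 1 else 0)" if v: "v \<in> E" and w: "w \<in> E" for v w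
  proof -
    have vw: "v \<in> F (A, B)" "w \<in> F (A, B)" using v w EW by auto
    have "fun_inner A B v w = inner A (\<phi> w) (\<phi> v)"
      using fun_inner_eq_inner[OF A B vw y(1) y(1)] y(2) by (metis \<phi>_def mult.right_neutral)
    also have "\<dots> = (if \<phi> w = \<phi> v then 1 else 0)"
      using v w E0 by (auto simp: E_def onb_def orthonormal_def)
    also have "\<dots> = (if v = w then 1 else 0)" using \<phi>_inj v w EW by auto
    finally show ?thesis .
  qed
  then show ?thesis using fin EW span by (auto simp: is_onb_def)
qed

lemma some_onb:
  assumes "A \<in> X" "B \<in> Y" shows "is_onb A B (F (A, B)) (some_onb A B (F (A, B)))"
  unfolding some_onb_def using is_onb_exists[OF assms] by (rule someI_ex)

text \<open>Each B with F(A,B) nonzero contributes a unit vector r^dagger y of A. For different B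
  these are orthogonal, since s r^dagger = 0, so the finite dimension of A bounds their number. This
  legitimates the outer sum in \<open>fun_star\<close>.\<close>

lemma finite_support:
  assumes A: "A \<in> X"
  shows "finite {B \<in> Y. F (A, B) \<noteq> {\<zero>\<^bsub>lin_ops A B\<^esub>}}" (is "finite ?S")
proof -
  note [simp] = qsetD(1)[OF X A]
  define S where "S = {B \<in> Y. F (A, B) \<noteq> {\<zero>\<^bsub>lin_ops A B\<^esub>}}"
  have SY: "B \<in> Y" if "B \<in> S" for B using that by (simp add: S_def)
  have "\<exists>r y. inner A (op_adj A B r y) (op_adj A B r y) = 1 \<and> r \<in> F (A, B) \<and> y \<in> carrier B" if S: "B \<in> S" for B
  proof -
    have B: "B \<in> Y" using S by (rule SY)
    note [simp] = qsetD(1)[OF Y B]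
    note W = qRel_csubspace[OF F A B]
    obtain r where r: "r \<in> F (A, B)" "r \<noteq> \<zero>\<^bsub>lin_ops A B\<^esub>" using S csubspaceD(2)[OF W] by (auto simp: S_def)
    obtain y where y: "y \<in> carrier B" "inner B y y = 1"
      using unit_vector_exists[OF _ qsetD(2)[OF Y B]] by auto
    have ro: "r \<in> ops A B" using qRel_ops[OF F A B] r by auto
    have "op_adj A B r y \<noteq> \<zero>\<^bsub>A\<^esub>" using adj_eval_inj[OF A B r(1) y] r(2) by blast
    then obtain c where c: "inner A (c \<odot>\<^bsub>A\<^esub> op_adj A B r y) (c \<odot>\<^bsub>A\<^esub> op_adj A B r y) = 1"
      using normalise[of A "op_adj A B r y"] ro y by auto
    have "c \<odot>\<^bsub>A\<^esub> op_adj A B r y = op_adj A B r (c \<odot>\<^bsub>B\<^esub> y)"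
      using ops_smult[OF op_adj_closed[of A B r] y(1)] ro by simp
    then show ?thesis using c r(1) y
      by (intro exI[of _ r] exI[of _ "c \<odot>\<^bsub>B\<^esub> y"]) (simp del: op_adj_inner_right op_adj_inner_left)
  qed
  then obtain r y where ry: "\<And>B. B \<in> S \<Longrightarrow> inner A (op_adj A B (r B) (y B)) (op_adj A B (r B) (y B)) = 1
      \<and> r B \<in> F (A, B) \<and> y B \<in> carrier B" by metis
  define e where "e B = op_adj A B (r B) (y B)" for B
  have e: "inner A (e B) (e B) = 1" "r B \<in> F (A, B)" "y B \<in> carrier B" if "B \<in> S" for B
    using ry[OF that] by (simp_all add: e_def)
  have ro: "r B \<in> ops A B" and eA: "e B \<in> carrier A" if "B \<in> S" for B
    using e[OF that] qRel_ops[OF F A SY[OF that], of "r B"] qsetD(1)[OF Y SY[OF that]] by (simp_all add: e_def)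
  have orth: "inner A (e B') (e B) = 0" if S: "B \<in> S" "B' \<in> S" "B' \<noteq> B" for B B'
  proof -
    have "inner A (e B') (e B) = inner B' (y B') (r B' (e B))"
      using e(3)[OF S(2)] eA[OF S(1)] ro[OF S(2)] qsetD(1)[OF Y SY[OF S(2)]] by (simp add: e_def)
    moreover have "r B' (e B) = \<zero>\<^bsub>B'\<^esub>"
      using qfunctionalD(2)[OF fn A SY[OF S(1)] e(2)[OF S(1)] SY[OF S(2)] S(3) e(2)[OF S(2)] e(3)[OF S(1)]]
      by (simp add: e_def)
    ultimately show ?thesis using e(3)[OF S(2)] qsetD(1)[OF Y SY[OF S(2)]] by simp
  qed
  have inj: "inj_on e S" using e(1) orth by (intro inj_onI) (metis zero_neq_one)
  have "orthonormal A (e ` S)"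
    unfolding orthonormal_def using e(1) orth eA inj by (auto simp: inj_on_eq_iff)
  then show ?thesis using orthonormal_card(1)[of A] finite_imageD[OF _ inj] unfolding S_def by auto
qed

section \<open>The action of a partial function on families of operators\<close>

context
  fixes b assumes b: "\<And>B. B \<in> Y \<Longrightarrow> b B \<in> ops B B"
begin

abbreviation (input) "star_term A B v \<equiv> op_comp A (op_adj A B v) (op_comp A (b B) v)"

lemma star_term_ops:
  assumes A: "A \<in> X" and B: "B \<in> Y" and v: "v \<in> F (A, B)"
  shows "star_term A B v \<in> ops A A"
  using qsetD(1)[OF X A] qsetD(1)[OF Y B] qRel_ops[OF F A B v] b[OF B]
  by (meson op_adj_closed op_comp_closed)

lemma star_sum_ops:
  assumes A: "A \<in> X" and B: "B \<in> Y"
  shows "(\<Oplus>\<^bsub>lin_ops A A\<^esub> v \<in> some_onb A B (F (A, B)). star_term A B v) \<in> ops A A"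
  using qsetD(1)[OF X A] some_onb[OF A B] star_term_ops[OF A B]
  by (intro csubspace_finsum csubspace_carrier cvs_lin_ops) (auto simp: is_onb_def)

lemma fun_star_ops:
  assumes A: "A \<in> X" shows "fun_star X Y F b A \<in> ops A A"
  unfolding fun_star_apply[OF A]
  by (rule csubspace_finsum[OF cvs_lin_ops csubspace_carrier[OF cvs_lin_ops]])
    (use qsetD(1)[OF X A] finite_support[OF A] star_sum_ops[OF A] in simp_all)

text \<open>Both sides are linear in r, so r may be taken to be a basis vector w; then w v^dagger is
  1 for v = w and 0 otherwise. Pairing with z replaces sums in B by sums of complex numbers.\<close>

lemma onb_expansion:
  assumes A: "A \<in> X" and B: "B \<in> Y" and E: "is_onb A B (F (A, B)) E" and r: "r \<in> F (A, B)"
    and x: "x \<in> carrier A" and z: "z \<in> carrier B"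
  shows "(\<Sum>v\<in>E. inner B z (r (star_term A B v x))) = inner B z (b B (r x))"
proof -
  note [simp] = qsetD(1)[OF X A] qsetD(1)[OF Y B]
  have fin: "finite E" and EW: "E \<subseteq> F (A, B)" and span: "cspan (lin_ops A B) E = F (A, B)"
    and on: "\<And>v w. v \<in> E \<Longrightarrow> w \<in> E \<Longrightarrow> fun_inner A B v w = (if v = w then 1 else 0)"
    using E by (auto simp: is_onb_def)
  have Eops: "E \<subseteq> ops A B" using EW qRel_ops[OF F A B] by blast
  have st: "star_term A B v x \<in> carrier A" if "v \<in> E" for v
    using ops_closed[OF star_term_ops[OF A B] x] EW that by blast
  note bB = b[OF B]
  have cvs: "cvs (lin_ops A B)" by simp
  have "r \<in> cspan (lin_ops A B) E" using r span by simp
  from cvs this Eops show ?thesis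
  proof (induction rule: cspan_induct)
    case (base w)
    have "w (star_term A B v x) = (if v = w then 1 else 0) \<odot>\<^bsub>B\<^esub> b B (v x)" if "v \<in> E" for v
      using fun_inner_apply[OF A B, of v w "b B (v x)"] that base EW on bB Eops x
      by (auto simp: subset_iff)
    then have "(\<Sum>v\<in>E. inner B z (w (star_term A B v x)))
        = (\<Sum>v\<in>E. if v = w then inner B z (b B (w x)) else 0)"
      using z x bB Eops by (intro sum.cong) (auto simp: subset_iff)
    then show ?case using fin base by simp
  next
    case (add r s)
    then show ?case using st x z bB by (simp add: sum.distrib)
  next
    case (smult c r)
    then show ?case using st x z bB by (simp add: sum_distrib_left[symmetric])
  qed (use Eops st x z bB in auto)
qed

text \<open>In the sum of the terms r v^dagger b v only those with v in F(A,B) survive, since r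
  v^dagger = 0 for v in F(A,B') with B' different from B; the remaining inner sum is
  \<open>onb_expansion\<close>.\<close>

theorem fun_star_intertwines:
  assumes A: "A \<in> X" and B: "B \<in> Y" and r: "r \<in> F (A, B)" and x: "x \<in> carrier A"
  shows "r (fun_star X Y F b A x) = b B (r x)"
proof -
  note [simp] = qsetD(1)[OF X A] qsetD(1)[OF Y B]
  have ro: "r \<in> ops A B" using qRel_ops[OF F A B r] .
  let ?S = "{B \<in> Y. F (A, B) \<noteq> {\<zero>\<^bsub>lin_ops A B\<^esub>}}"
  let ?E = "\<lambda>B. some_onb A B (F (A, B))"
  let ?T = "\<lambda>B'. \<Oplus>\<^bsub>lin_ops A A\<^esub> v \<in> ?E B'. star_term A B' v"
  have rT: "inner B z (r (?T B' x)) = (\<Sum>v\<in>?E B'. inner B z (r (star_term A B' v x)))"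
    if B': "B' \<in> Y" and z: "z \<in> carrier B" for B' z
  proof -
    have fin: "finite (?E B')" and sub: "?E B' \<subseteq> F (A, B')" using some_onb[OF A B'] by (auto simp: is_onb_def)
    have st: "star_term A B' v \<in> ops A A" "star_term A B' v x \<in> carrier A" if "v \<in> ?E B'" for v
      using star_term_ops[OF A B'] ops_closed[OF star_term_ops[OF A B'] x] sub that by blast+
    have "?T B' x = (\<Oplus>\<^bsub>A\<^esub> v \<in> ?E B'. star_term A B' v x)"
      using fin st x by (intro lin_ops_finsum_apply) auto
    then have "r (?T B' x) = (\<Oplus>\<^bsub>B\<^esub> v \<in> ?E B'. r (star_term A B' v x))"
      using ops_finsum[OF ro _ _ fin st(2)] by simp
    then show ?thesis using hinner_finsum[OF _ fin _ z, of "\<lambda>v. r (star_term A B' v x)"] st(2) ro by simp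
  qed
  have TA: "?T B' x \<in> carrier A" if "B' \<in> Y" for B' using ops_closed[OF star_sum_ops[OF A that] x] .
  have eq: "inner B z (r (fun_star X Y F b A x)) = (\<Sum>B'\<in>?S. inner B z (r (?T B' x)))" if z: "z \<in> carrier B" for z
  proof -
    have "fun_star X Y F b A x = (\<Oplus>\<^bsub>A\<^esub> B' \<in> ?S. ?T B' x)"
      unfolding fun_star_apply[OF A] using finite_support[OF A] star_sum_ops[OF A] x
      by (intro lin_ops_finsum_apply) auto
    then have "r (fun_star X Y F b A x) = (\<Oplus>\<^bsub>B\<^esub> B' \<in> ?S. r (?T B' x))"
      using ops_finsum[OF ro _ _ finite_support[OF A], of "\<lambda>B'. ?T B' x"] TA by simp
    then show ?thesis
      using hinner_finsum[OF _ finite_support[OF A] _ z, of "\<lambda>B'. r (?T B' x)"] TA ro by simp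
  qed
  have 0: "inner B z (r (?T B' x)) = 0" if z: "z \<in> carrier B" and B': "B' \<in> Y" "B' \<noteq> B" for B' z
  proof -
    have "r (star_term A B' v x) = \<zero>\<^bsub>B\<^esub>" if v: "v \<in> ?E B'" for v
    proof -
      have v: "v \<in> F (A, B')" using some_onb[OF A B'(1)] v by (auto simp: is_onb_def)
      have "b B' (v x) \<in> carrier B'" using b[OF B'(1)] qRel_ops[OF F A B'(1) v] x by simp
      then show ?thesis using qfunctionalD(2)[OF fn A B'(1) v B _ r] B'(2) x by simp
    qed
    then show ?thesis using rT[OF B'(1) z] z by simp
  qed
  have Eexp: "inner B z (r (?T B x)) = inner B z (b B (r x))" if z: "z \<in> carrier B" for z
    using onb_expansion[OF A B some_onb[OF A B] r x z] rT[OF B z] by simp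
  show ?thesis
  proof (rule hinner_ext[of B])
    show "r (fun_star X Y F b A x) \<in> carrier B" using ops_closed[OF ro ops_closed[OF fun_star_ops[OF A] x]] .
    show "b B (r x) \<in> carrier B" using b[OF B] ro x by simp
    fix z assume z: "z \<in> carrier B"
    have "(\<Sum>B'\<in>?S. inner B z (r (?T B' x))) = (\<Sum>B'\<in>?S. if B' = B then inner B z (b B (r x)) else 0)"
      using 0[OF z] Eexp[OF z] by (intro sum.cong) auto
    also have "\<dots> = (if B \<in> ?S then inner B z (b B (r x)) else 0)"
      using finite_support[OF A] by simp
    also have "\<dots> = inner B z (b B (r x))"
    proof (cases "B \<in> ?S")
      \<comment> \<open>Here B is missing from the index set, but then r = 0 and both sides
        vanish.\<close>
      case False
      then have "r = \<zero>\<^bsub>lin_ops A B\<^esub>" using r B by auto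
      then show ?thesis using False x z ops_zero[OF b[OF B]] by simp
    qed simp
    finally show "inner B z (r (fun_star X Y F b A x)) = inner B z (b B (r x))" using eq[OF z] by simp
  qed simp
qed

end

end

section \<open>Functions: characterisation, identity, composition and rigidity\<close>

lemma op_comp_lin_right:
  assumes "fd_hilbert A" "fd_hilbert B" "fd_hilbert C" and r: "r \<in> ops B C"
  shows "s \<in> ops A B \<Longrightarrow> t \<in> ops A B \<Longrightarrow>
      op_comp A r (s \<oplus>\<^bsub>lin_ops A B\<^esub> t) = op_comp A r s \<oplus>\<^bsub>lin_ops A C\<^esub> op_comp A r t"
    and "s \<in> ops A B \<Longrightarrow>
      op_comp A r (c \<odot>\<^bsub>lin_ops A B\<^esub> s) = c \<odot>\<^bsub>lin_ops A C\<^esub> op_comp A r s"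
    and "op_comp A r \<zero>\<^bsub>lin_ops A B\<^esub> = \<zero>\<^bsub>lin_ops A C\<^esub>"
  by (intro ops_eqI[of _ A C] op_comp_closed[OF _ r] cvs_closed cvs_lin_ops; use assms in simp)+

lemma op_comp_lin_left:
  assumes "fd_hilbert A" "fd_hilbert B" "fd_hilbert C" and r: "r \<in> ops A B"
  shows "s \<in> ops B C \<Longrightarrow> t \<in> ops B C \<Longrightarrow>
      op_comp A (s \<oplus>\<^bsub>lin_ops B C\<^esub> t) r = op_comp A s r \<oplus>\<^bsub>lin_ops A C\<^esub> op_comp A t r"
    and "s \<in> ops B C \<Longrightarrow>
      op_comp A (c \<odot>\<^bsub>lin_ops B C\<^esub> s) r = c \<odot>\<^bsub>lin_ops A C\<^esub> op_comp A s r"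
    and "op_comp A \<zero>\<^bsub>lin_ops B C\<^esub> r = \<zero>\<^bsub>lin_ops A C\<^esub>"
  by (intro ops_eqI[of _ A C] op_comp_closed[OF r] cvs_closed cvs_lin_ops; use assms in simp)+

lemma op_adj_antilin:
  assumes "fd_hilbert A" "fd_hilbert B"
  shows "s \<in> ops A B \<Longrightarrow> t \<in> ops A B \<Longrightarrow>
      op_adj A B (s \<oplus>\<^bsub>lin_ops A B\<^esub> t) = op_adj A B s \<oplus>\<^bsub>lin_ops B A\<^esub> op_adj A B t"
    and "s \<in> ops A B \<Longrightarrow>
      op_adj A B (c \<odot>\<^bsub>lin_ops A B\<^esub> s) = cnj c \<odot>\<^bsub>lin_ops B A\<^esub> op_adj A B s"
    and op_adj_zero: "op_adj A B \<zero>\<^bsub>lin_ops A B\<^esub> = \<zero>\<^bsub>lin_ops B A\<^esub>"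
  by (intro ops_eqI[of _ B A] op_adj_closed cvs_closed cvs_lin_ops;
      use assms in \<open>simp add: op_adj_add_apply op_adj_smult_apply op_adj_zero_apply\<close>)+

lemma op_adj_id: "fd_hilbert A \<Longrightarrow> op_adj A A (op_id A) = op_id A"
  by (intro op_adj_unique) simp_all

lemma op_comp_id:
  assumes "fd_hilbert A" "fd_hilbert B" and r: "r \<in> ops A B"
  shows "op_comp A r (op_id A) = r" "op_comp A (op_id B) r = r"
  using op_comp_closed[OF op_id_closed[OF assms(1)] r assms(1)] op_comp_closed[OF r op_id_closed[OF assms(2)] assms(1)] assms
  by (intro ops_eqI[of _ A B]; simp)+

text \<open>A trivial common kernel means that an operator on A is determined by its composites with
  the r in F(A,B). The uniqueness of \<open>fun_star\<close> rests on this.\<close>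

lemma qtotal_cancel:
  assumes X: "qset X" and Y: "qset Y" and F: "F \<in> qRel X Y" and tot: "qtotal X Y F" and A: "A \<in> X"
    and a: "a \<in> ops A A" and a': "a' \<in> ops A A"
    and eq: "\<And>B r x. B \<in> Y \<Longrightarrow> r \<in> F (A, B) \<Longrightarrow> x \<in> carrier A \<Longrightarrow> r (a x) = r (a' x)"
  shows "a = a'"
proof (rule ops_eqI[OF a a'])
  note [simp] = qsetD(1)[OF X A]
  fix x assume x: "x \<in> carrier A"
  have "r (a x \<ominus>\<^bsub>A\<^esub> a' x) = \<zero>\<^bsub>B\<^esub>" if "B \<in> Y" "r \<in> F (A, B)" for B r
    using eq[OF that x] qRel_ops[OF F A that] qsetD(1)[OF Y that(1)] a a' x by simp
  then have "a x \<ominus>\<^bsub>A\<^esub> a' x = \<zero>\<^bsub>A\<^esub>"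
    using tot A a a' x unfolding qtotal_def by (metis \<open>fd_hilbert A\<close> cvs_closed(5) fd_hilbert_cvs ops_closed)
  then show "a x = a' x" using a a' x by simp
qed

text \<open>For the converse, F^star(1), the sum of the v^dagger v over the orthonormal bases, lies
  in F^dagger F. Since r F^star(1) = r for all r in F(A,B), cancellation identifies it with the
  identity of A.\<close>

lemma qFun_iff:
  assumes X: "qset X" and Y: "qset Y"
  shows "F \<in> qFun X Y \<longleftrightarrow> F \<in> qRel X Y \<and> qfunctional X Y F \<and> qtotal X Y F"
proof
  assume "F \<in> qFun X Y"
  then have F: "F \<in> qRel X Y" and "rel_le X X (rel_id X) (rel_comp X Y X (rel_adj X Y F) F)"
    and "rel_le Y Y (rel_comp Y X Y F (rel_adj X Y F)) (rel_id Y)" by (simp_all add: qFun_def)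
  then show "F \<in> qRel X Y \<and> qfunctional X Y F \<and> qtotal X Y F"
    using rel_comp_adj_le_id_iff[OF X Y F] id_le_adj_comp_imp_qtotal[OF X Y F] by blast
next
  assume "F \<in> qRel X Y \<and> qfunctional X Y F \<and> qtotal X Y F"
  then have F: "F \<in> qRel X Y" and fn: "qfunctional X Y F" and tot: "qtotal X Y F" by auto
  let ?F' = "rel_adj X Y F"
  let ?K = "rel_comp X Y X ?F' F"
  have K: "?K \<in> qRel X X" by (rule rel_comp_qRel[OF X Y X F rel_adj_qRel[OF X Y F]])
  have idK: "op_id A \<in> ?K (A, A)" if A: "A \<in> X" for A
  proof -
    note [simp] = qsetD(1)[OF X A]
    have bY: "op_id B \<in> ops B B" if "B \<in> Y" for B using qsetD(1)[OF Y that] by simp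
    let ?e = "fun_star X Y F op_id A"
    have "?e = op_id A"
    proof (rule qtotal_cancel[OF X Y F tot A])
      show "?e \<in> ops A A" by (rule fun_star_ops[OF X Y F fn bY A])
      fix B r x assume B: "B \<in> Y" and r: "r \<in> F (A, B)" and x: "x \<in> carrier A"
      show "r (?e x) = r (op_id A x)"
        using fun_star_intertwines[OF X Y F fn bY A B r x] ops_closed[OF qRel_ops[OF F A B r] x] x by simp
    qed simp
    moreover have "?e \<in> ?K (A, A)"
      unfolding fun_star_apply[OF A]
    proof (intro csubspace_finsum[OF cvs_lin_ops qRel_csubspace[OF K A A]] finite_support[OF X Y F fn A])
      fix B v assume "B \<in> {B \<in> Y. F (A, B) \<noteq> {\<zero>\<^bsub>lin_ops A B\<^esub>}}" and v: "v \<in> some_onb A B (F (A, B))"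
      then have B: "B \<in> Y" by simp
      have v: "v \<in> F (A, B)" using some_onb[OF X Y F fn A B] v by (auto simp: is_onb_def)
      have "op_adj A B v \<in> ?F' (B, A)" using A B v by (auto simp: rel_adj_def)
      then have "op_comp A (op_adj A B v) v \<in> ?K (A, A)"
        by (rule rel_comp_base[OF X Y X F rel_adj_qRel[OF X Y F] A A B _ v])
      then show "op_comp A (op_adj A B v) (op_comp A (op_id B) v) \<in> ?K (A, A)"
        using op_comp_id(2)[OF _ qsetD(1)[OF Y B] qRel_ops[OF F A B v]] by simp
    next
      fix B assume "B \<in> {B \<in> Y. F (A, B) \<noteq> {\<zero>\<^bsub>lin_ops A B\<^esub>}}"
      then show "finite (some_onb A B (F (A, B)))"
        using some_onb[OF X Y F fn A, of B] by (simp add: is_onb_def)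
    qed simp_all
    ultimately show ?thesis by simp
  qed
  have "rel_le X X (rel_id X) ?K"
    using idK csubspaceD[OF qRel_csubspace[OF K]] qsetD(1)[OF X]
    by (auto simp: rel_le_def rel_id_def)
  then show "F \<in> qFun X Y" using F fn rel_comp_adj_le_id_iff[OF X Y F] by (simp add: qFun_def)
qed

text \<open>\<open>fun_star\<close> satisfies the same intertwining equations, and by totality they
  determine a family. Later computations of \<open>fun_star\<close> go through this characterisation
  instead of the defining sum.\<close>

lemma fun_star_eqI:
  assumes X: "qset X" and Y: "qset Y" and F: "F \<in> qFun X Y" and b: "\<And>B. B \<in> Y \<Longrightarrow> b B \<in> ops B B"
    and a: "\<And>A. A \<in> X \<Longrightarrow> a A \<in> ops A A" and ext: "a \<in> extensional X"
    and eq: "\<And>A B r x. A \<in> X \<Longrightarrow> B \<in> Y \<Longrightarrow> r \<in> F (A, B) \<Longrightarrow> x \<in> carrier A \<Longrightarrow> r (a A x) = b B (r x)"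
  shows "fun_star X Y F b = a"
proof (rule extensionalityI[of _ X])
  have Fr: "F \<in> qRel X Y" and fn: "qfunctional X Y F" and tot: "qtotal X Y F" using F qFun_iff[OF X Y] by auto
  show "fun_star X Y F b \<in> extensional X" by (simp add: fun_star_def)
  fix A assume A: "A \<in> X"
  show "fun_star X Y F b A = a A"
    using fun_star_intertwines[OF X Y Fr fn b A] fun_star_ops[OF X Y Fr fn b A] a[OF A] eq[OF A]
    by (intro qtotal_cancel[OF X Y Fr tot A]) auto
qed (rule ext)

text \<open>This permits induction over \<open>rel_comp\<close> on the identity operator: a
  statement about r or x is proved by writing 1_A through products s^dagger r with s and r in
  F.\<close>

lemma op_id_mem_adj_comp:
  assumes X: "qset X" and F: "F \<in> qFun X Y" and A: "A \<in> X"
  shows "op_id A \<in> rel_comp X Y X (rel_adj X Y F) F (A, A)"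
proof -
  have "op_id A \<in> rel_id X (A, A)"
    using A qsetD(1)[OF X A] by (auto simp: rel_id_def intro!: exI[of _ 1])
  then show ?thesis using F A unfolding qFun_def rel_le_def by blast
qed

lemma qfunctional_comp_adj:
  assumes X: "qset X" and Y: "qset Y" and F: "F \<in> qRel X Y" and fn: "qfunctional X Y F"
    and "A \<in> X" "B \<in> Y" "B' \<in> Y" "r \<in> F (A, B)" "s \<in> F (A, B')"
  shows "op_comp B s (op_adj A B r) \<in> rel_id Y (B, B')"
proof -
  have "op_adj A B r \<in> rel_adj X Y F (B, A)" using assms by (auto simp: rel_adj_def)
  then have "op_comp B s (op_adj A B r) \<in> rel_comp Y X Y F (rel_adj X Y F) (B, B')"
    using assms by (intro rel_comp_base[OF Y X Y rel_adj_qRel[OF X Y F] F])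
  then show ?thesis
    using rel_comp_adj_le_id_iff[OF X Y F] fn assms(6,7) unfolding rel_le_def by blast
qed

text \<open>Membership in \<open>rel_id\<close> treats equal and different atoms at once, which
  suits arguments about composites.\<close>

lemma qfunctionalI:
  assumes X: "qset X" and Y: "qset Y" and F: "F \<in> qRel X Y"
    and mem: "\<And>A B B' r s. A \<in> X \<Longrightarrow> B \<in> Y \<Longrightarrow> B' \<in> Y \<Longrightarrow> r \<in> F (A, B) \<Longrightarrow> s \<in> F (A, B')
      \<Longrightarrow> op_comp B s (op_adj A B r) \<in> rel_id Y (B, B')"
  shows "qfunctional X Y F"
proof -
  have "rel_le Y Y (rel_comp Y X Y F (rel_adj X Y F)) (rel_id Y)"
    unfolding rel_le_def
  proof (intro ballI rel_comp_least[OF Y X Y rel_adj_qRel[OF X Y F] F])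
    fix B B' A s r' assume h: "B \<in> Y" "B' \<in> Y" "A \<in> X" "s \<in> F (A, B')" "r' \<in> rel_adj X Y F (B, A)"
    then show "op_comp B s r' \<in> rel_id Y (B, B')" using mem by (auto simp: rel_adj_def)
  qed (use Y rel_id_qRel[OF Y] in \<open>auto intro: qRel_csubspace\<close>)
  then show ?thesis using rel_comp_adj_le_id_iff[OF X Y F] by simp
qed

lemma qFun_rel_id:
  assumes X: "qset X" shows "rel_id X \<in> qFun X X"
proof -
  have "qfunctional X X (rel_id X)"
  proof (rule qfunctionalI[OF X X rel_id_qRel[OF X]])
    fix A B B' r s assume h: "A \<in> X" "B \<in> X" "B' \<in> X" "r \<in> rel_id X (A, B)" "s \<in> rel_id X (A, B')"
    note [simp] = qsetD(1)[OF X h(1)] qsetD(1)[OF X h(2)] qsetD(1)[OF X h(3)]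
    note sub = csubspaceD[OF qRel_csubspace[OF rel_id_qRel[OF X]]]
    have s: "s \<in> ops A B'" using qRel_ops[OF rel_id_qRel[OF X] h(1,3,5)] .
    show "op_comp B s (op_adj A B r) \<in> rel_id X (B, B')"
    proof (cases "A = B")
      case True
      then obtain c where r: "r = c \<odot>\<^bsub>lin_ops A A\<^esub> op_id A" using h by (auto simp: rel_id_def)
      note s = s[unfolded True]
      have "op_comp B s (op_adj A B r) = cnj c \<odot>\<^bsub>lin_ops B B'\<^esub> s"
        using s True unfolding r by (simp add: op_adj_antilin op_adj_id op_comp_lin_right[OF _ _ _ s] op_comp_id[OF _ _ s])
      then show ?thesis using sub(4)[OF h(2,3) _ , of s "cnj c"] h True by simp
    next
      case False
      then have "r = \<zero>\<^bsub>lin_ops A B\<^esub>" using h by (auto simp: rel_id_def)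
      then show ?thesis using s sub(2)[OF h(2,3)] by (simp add: op_adj_antilin op_comp_lin_right[OF _ _ _ s])
    qed
  qed
  moreover have "qtotal X X (rel_id X)"
    unfolding qtotal_def
  proof (intro ballI impI)
    fix A x assume A: "A \<in> X" and x: "x \<in> carrier A" "\<forall>B\<in>X. \<forall>r\<in>rel_id X (A, B). r x = \<zero>\<^bsub>B\<^esub>"
    have "op_id A \<in> rel_id X (A, A)"
      using A qsetD(1)[OF X A] by (auto simp: rel_id_def intro!: exI[of _ 1])
    then have "op_id A x = \<zero>\<^bsub>A\<^esub>" using x A by blast
    then show "x = \<zero>\<^bsub>A\<^esub>" using x by simp
  qed
  ultimately show ?thesis using qFun_iff[OF X X] rel_id_qRel[OF X] by blast
qed

text \<open>For products, (s' r') (s r)^dagger = s' (r' r^dagger) s^dagger. The middle factor is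
  zero or a scalar c, and c s' s^dagger lies in the identity relation by functionality of G. Two
  nested inductions extend this to linear combinations.\<close>

lemma qFun_rel_comp:
  assumes X: "qset X" and Y: "qset Y" and Z: "qset Z" and F: "F \<in> qFun X Y" and G: "G \<in> qFun Y Z"
  shows "rel_comp X Y Z G F \<in> qFun X Z"
proof -
  have Fr: "F \<in> qRel X Y" and Ff: "qfunctional X Y F" and Ft: "qtotal X Y F" using F qFun_iff[OF X Y] by auto
  have Gr: "G \<in> qRel Y Z" and Gf: "qfunctional Y Z G" and Gt: "qtotal Y Z G" using G qFun_iff[OF Y Z] by auto
  let ?K = "rel_comp X Y Z G F"
  have K: "?K \<in> qRel X Z" by (rule rel_comp_qRel[OF X Y Z Fr Gr])
  have "qfunctional X Z ?K"
  proof (rule qfunctionalI[OF X Z K])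
    fix A C C' t u assume A: "A \<in> X" and C: "C \<in> Z" and C': "C' \<in> Z" and t: "t \<in> ?K (A, C)" and u: "u \<in> ?K (A, C')"
    note [simp] = qsetD(1)[OF X A] qsetD(1)[OF Z C] qsetD(1)[OF Z C']
    have uo: "u \<in> ops A C'" by (rule qRel_ops[OF K A C' u])
    note W = csubspaceD(2-4)[OF qRel_csubspace[OF rel_id_qRel[OF Z] C C'] cvs_lin_ops]
    show "op_comp C u (op_adj A C t) \<in> rel_id Z (C, C')"
      using X Y Z Fr Gr A C t
    proof (induction rule: rel_comp_induct)
      case (base B s r)
      note [simp] = qsetD(1)[OF Y base(1)]
      have so: "s \<in> ops B C" and ro: "r \<in> ops A B"
        using qRel_ops[OF Gr base(1) C base(2)] qRel_ops[OF Fr A base(1,3)] by auto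
      have adj: "op_adj A C (op_comp A s r) = op_comp C (op_adj A B r) (op_adj B C s)"
        using so ro by (intro op_adj_comp) simp_all
      have ao: "op_adj A C (op_comp A s r) \<in> ops C A" using so ro by (intro op_adj_closed op_comp_closed) simp_all
      show ?case
        using X Y Z Fr Gr A C' u
      proof (induction rule: rel_comp_induct)
        case (base B' s' r')
        note B = \<open>B \<in> Y\<close> and B' = \<open>B' \<in> Y\<close>
        note [simp] = qsetD(1)[OF Y B']
        have so': "s' \<in> ops B' C'" and ro': "r' \<in> ops A B'"
          using qRel_ops[OF Gr B' C' base(2)] qRel_ops[OF Fr A B' base(3)] by auto
        have co: "op_comp C (op_comp A s' r') (op_adj A C (op_comp A s r)) \<in> ops C C'"
          by (rule op_comp_closed[OF ao op_comp_closed[OF ro' so']]) simp_all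
        show ?case
        proof (cases "B' = B")
          case True
          obtain c where c: "\<forall>y\<in>carrier B. r' (op_adj A B r y) = c \<odot>\<^bsub>B\<^esub> y"
            using qfunctionalD(1)[OF Ff A B \<open>r \<in> F (A, B)\<close>, of r'] base True by auto
          have so'': "s' \<in> ops B C'" using so' True by simp
          have co2: "op_comp C s' (op_adj B C s) \<in> ops C C'"
            by (rule op_comp_closed[OF op_adj_closed[OF _ _ so] so'']) simp_all
          have "op_comp C (op_comp A s' r') (op_adj A C (op_comp A s r))
              = c \<odot>\<^bsub>lin_ops C C'\<^esub> op_comp C s' (op_adj B C s)"
            using c so so'' ro co co2 unfolding adj
            by (intro ops_eqI[OF co[unfolded adj]]) simp_all
          moreover have "op_comp C s' (op_adj B C s) \<in> rel_id Z (C, C')"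
            using qfunctional_comp_adj[OF Y Z Gr Gf B C C'] \<open>s \<in> G (B, C)\<close> base(2) True by simp
          ultimately show ?thesis using W(3) by simp
        next
          case False
          have "op_comp C (op_comp A s' r') (op_adj A C (op_comp A s r)) = \<zero>\<^bsub>lin_ops C C'\<^esub>"
            using qfunctionalD(2)[OF Ff A B \<open>r \<in> F (A, B)\<close> B' False base(3)] so so' ro
            unfolding adj by (intro ops_eqI[OF co[unfolded adj]]) simp_all
          then show ?thesis using W(1) by simp
        qed
      qed (use W in \<open>simp_all add: op_comp_lin_left[OF _ _ _ ao]\<close>)
    next
      case zero
      then show ?case using W uo by (simp add: op_adj_antilin op_comp_lin_right[OF _ _ _ uo])
    next
      case (add t t')
      then show ?case using W uo by (simp add: op_adj_antilin op_comp_lin_right[OF _ _ _ uo])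
    next
      case (smult c t)
      then show ?case using W uo by (simp add: op_adj_antilin op_comp_lin_right[OF _ _ _ uo])
    qed
  qed
  moreover have "qtotal X Z ?K"
    unfolding qtotal_def
  proof (intro ballI impI)
    fix A x assume A: "A \<in> X" and x: "x \<in> carrier A" "\<forall>C\<in>Z. \<forall>t\<in>?K (A, C). t x = \<zero>\<^bsub>C\<^esub>"
    have "r x = \<zero>\<^bsub>B\<^esub>" if B: "B \<in> Y" and r: "r \<in> F (A, B)" for B r
    proof -
      have "s (r x) = \<zero>\<^bsub>C\<^esub>" if "C \<in> Z" "s \<in> G (B, C)" for C s
        using rel_comp_base[OF X Y Z Fr Gr A that(1) B that(2) r] x that(1) by fastforce
      moreover have "r x \<in> carrier B" using qRel_ops[OF Fr A B r] x by simp
      ultimately show ?thesis using Gt B unfolding qtotal_def by blast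
    qed
    then show "x = \<zero>\<^bsub>A\<^esub>" using Ft A x unfolding qtotal_def by blast
  qed
  ultimately show ?thesis using qFun_iff[OF X Z] K by blast
qed

text \<open>For r in G(A,B), write r = r 1_A as a combination of products r s^dagger r' with s and
  r' in F. As s also lies in G, r s^dagger is a scalar or zero, so every term is zero or a multiple
  of some r' in F(A,B).\<close>

lemma qFun_le_imp_eq:
  assumes X: "qset X" and Y: "qset Y" and F: "F \<in> qFun X Y" and G: "G \<in> qFun X Y"
    and le: "\<And>A B. A \<in> X \<Longrightarrow> B \<in> Y \<Longrightarrow> F (A, B) \<subseteq> G (A, B)"
  shows "F = G"
proof (rule qRel_eqI)
  show Fr: "F \<in> qRel X Y" and Gr: "G \<in> qRel X Y" using F G by (auto intro: qFun_qRel)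
  have Gf: "qfunctional X Y G" using G qFun_iff[OF X Y] by auto
  fix A B assume A: "A \<in> X" and B: "B \<in> Y"
  note [simp] = qsetD(1)[OF X A] qsetD(1)[OF Y B]
  note FD = csubspaceD(2-4)[OF qRel_csubspace[OF Fr A B] cvs_lin_ops]
  have "r \<in> F (A, B)" if r: "r \<in> G (A, B)" for r
  proof -
    have ro: "r \<in> ops A B" by (rule qRel_ops[OF Gr A B r])
    have "op_comp A r (op_id A) \<in> F (A, B)"
      using X Y X Fr rel_adj_qRel[OF X Y Fr] A A op_id_mem_adj_comp[OF X F A]
    proof (induction rule: rel_comp_induct)
      case (base B' s' r')
      note [simp] = qsetD(1)[OF Y base(1)]
      obtain s where s: "s \<in> F (A, B')" "s' = op_adj A B' s" using base A by (auto simp: rel_adj_def)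
      have so: "s \<in> ops A B'" and ro': "r' \<in> ops A B'"
        using qRel_ops[OF Fr A base(1)] s(1) base(3) by auto
      have sG: "s \<in> G (A, B')" using le[OF A base(1)] s by auto
      have co: "op_comp A r (op_comp A s' r') \<in> ops A B"
        using so ro ro' s(2) by (meson op_adj_closed op_comp_closed \<open>fd_hilbert A\<close> \<open>fd_hilbert B'\<close>)
      show ?case
      proof (cases "B = B'")
        case True
        obtain c where c: "\<forall>y\<in>carrier B'. r (op_adj A B' s y) = c \<odot>\<^bsub>B'\<^esub> y"
          using qfunctionalD(1)[OF Gf A base(1) sG, of r] r True by auto
        have "op_comp A r (op_comp A s' r') = c \<odot>\<^bsub>lin_ops A B\<^esub> r'"
          using c s ro' True csubspaceD(4)[OF csubspace_carrier, of "lin_ops A B" r' c]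
          by (intro ops_eqI[OF co]) auto
        then show ?thesis using FD(3) base(3) True by simp
      next
        case False
        have "op_comp A r (op_comp A s' r') = \<zero>\<^bsub>lin_ops A B\<^esub>"
          using qfunctionalD(2)[OF Gf A base(1) sG B False r] s(2) ro' by (intro ops_eqI[OF co]) simp_all
        then show ?thesis using FD(1) by simp
      qed
    qed (use FD in \<open>simp_all add: op_comp_lin_right[OF _ _ _ ro]\<close>)
    then show ?thesis using op_comp_id(1)[OF _ _ ro] by simp
  qed
  then show "F (A, B) = G (A, B)" using le[OF A B] by blast
qed

text \<open>On a product s r the two intertwining laws combine to s r F^star(G^star(b)) = s
  G^star(b) r = b s r, and linear combinations follow; these equations determine the action of the
  composite.\<close>

lemma fun_star_rel_comp:
  assumes X: "qset X" and Y: "qset Y" and Z: "qset Z" and F: "F \<in> qFun X Y" and G: "G \<in> qFun Y Z"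
    and b: "\<And>C. C \<in> Z \<Longrightarrow> b C \<in> ops C C"
  shows "fun_star X Z (rel_comp X Y Z G F) b = fun_star X Y F (fun_star Y Z G b)"
proof (rule fun_star_eqI[OF X Z qFun_rel_comp[OF X Y Z F G] b])
  have Fr: "F \<in> qRel X Y" and Ff: "qfunctional X Y F" using F qFun_iff[OF X Y] by auto
  have Gr: "G \<in> qRel Y Z" and Gf: "qfunctional Y Z G" using G qFun_iff[OF Y Z] by auto
  have b': "fun_star Y Z G b B \<in> ops B B" if "B \<in> Y" for B by (rule fun_star_ops[OF Y Z Gr Gf b that])
  let ?a = "fun_star X Y F (fun_star Y Z G b)"
  show aA: "?a A \<in> ops A A" if "A \<in> X" for A by (rule fun_star_ops[OF X Y Fr Ff b' that])
  show "?a \<in> extensional X" by (simp add: fun_star_def)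
  fix A C t x assume A: "A \<in> X" and C: "C \<in> Z" and t: "t \<in> rel_comp X Y Z G F (A, C)" and x: "x \<in> carrier A"
  note [simp] = qsetD(1)[OF X A] qsetD(1)[OF Z C]
  note bC = b[OF C]
  have ax: "?a A x \<in> carrier A" using aA[OF A] x by simp
  show "t (?a A x) = b C (t x)"
    using X Y Z Fr Gr A C t
  proof (induction rule: rel_comp_induct)
    case (base B s r)
    have "r x \<in> carrier B" using qRel_ops[OF Fr A base(1,3)] x by simp
    then show ?case
      using fun_star_intertwines[OF X Y Fr Ff b' A base(1,3) x]
        fun_star_intertwines[OF Y Z Gr Gf b base(1) C base(2), of "r x"] x ax by simp
  qed (use x ax bC in simp_all)
qed

section \<open>Inverse images of predicates\<close>

lemma pred_pullback_generators:
  assumes X: "qset X" and Y: "qset Y" and F: "F \<in> qRel X Y" and P: "\<And>B. B \<in> Y \<Longrightarrow> P B \<subseteq> carrier B" and A: "A \<in> X"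
  shows "{op_adj A B r y | B y r. B \<in> Y \<and> y \<in> P B \<and> r \<in> F (A, B)} \<subseteq> carrier A"
proof clarify
  fix B y r assume B: "B \<in> Y" and y: "y \<in> P B" and r: "r \<in> F (A, B)"
  then show "op_adj A B r y \<in> carrier A"
    using op_adj_apply_closed[OF qsetD(1)[OF X A] qsetD(1)[OF Y B] qRel_ops[OF F A B r]] P[OF B] by blast
qed

text \<open>The generators r0^dagger y satisfy the condition since r r0^dagger is a scalar or zero.
  Conversely x = 1_A x is a combination of vectors s^dagger (r x), and r x lies in P(B).\<close>

lemma pred_pullback_eq:
  assumes X: "qset X" and Y: "qset Y" and F: "F \<in> qFun X Y" and P: "\<And>B. B \<in> Y \<Longrightarrow> csubspace B (P B)"
    and A: "A \<in> X"
  shows "pred_pullback X Y F P A = {x \<in> carrier A. \<forall>B\<in>Y. \<forall>r\<in>F (A, B). r x \<in> P B}" (is "?L = ?R")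
proof
  note [simp] = qsetD(1)[OF X A]
  have Fr: "F \<in> qRel X Y" and fn: "qfunctional X Y F" using F qFun_iff[OF X Y] by auto
  note PD = csubspaceD[OF P fd_hilbert_cvs[OF qsetD(1)[OF Y]]]
  let ?G = "{op_adj A B r y | B y r. B \<in> Y \<and> y \<in> P B \<and> r \<in> F (A, B)}"
  have sub: "?G \<subseteq> carrier A" by (rule pred_pullback_generators[OF X Y Fr _ A]) (use PD(1) in blast)
  have L: "?L = cspan A ?G" using A by (simp add: pred_pullback_def)
  have ops: "r \<in> ops A B" if "B \<in> Y" "r \<in> F (A, B)" for B r using qRel_ops[OF Fr A that] .
  have "csubspace A {x \<in> carrier A. \<forall>B\<in>Y. \<forall>r\<in>F (A, B). r x \<in> P B}"
    unfolding csubspace_iff[OF fd_hilbert_cvs[OF qsetD(1)[OF X A]]]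
  proof (intro conjI ballI allI)
    have "r \<zero>\<^bsub>A\<^esub> \<in> P B" if "B \<in> Y" "r \<in> F (A, B)" for B r
      using PD(2)[OF that(1) that(1)] ops_zero[OF ops[OF that] _ qsetD(1)[OF Y that(1)]] by simp
    then show "\<zero>\<^bsub>A\<^esub> \<in> ?R" by simp
    fix x assume x: "x \<in> ?R"
    have "r (x \<oplus>\<^bsub>A\<^esub> y) \<in> P B" if "B \<in> Y" "r \<in> F (A, B)" "y \<in> ?R" for B r y
      using PD(3)[OF that(1) that(1), of "r x" "r y"] ops_add[OF ops[OF that(1,2)], of x y] x that by simp
    then show "x \<oplus>\<^bsub>A\<^esub> y \<in> ?R" if "y \<in> ?R" for y using x that by simp
    have "r (c \<odot>\<^bsub>A\<^esub> x) \<in> P B" if "B \<in> Y" "r \<in> F (A, B)" for B r c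
      using PD(4)[OF that(1) that(1), of "r x" c] ops_smult[OF ops[OF that(1,2)], of x c] x that by simp
    then show "c \<odot>\<^bsub>A\<^esub> x \<in> ?R" for c using x by simp
  qed auto
  then have R: "csubspace A ?R" .
  show "?L \<subseteq> ?R" unfolding L
  proof (rule cspan_least[OF _ R])
    have "r (op_adj A B0 r0 y) \<in> P B" if h: "B0 \<in> Y" "y \<in> P B0" "r0 \<in> F (A, B0)" "B \<in> Y" "r \<in> F (A, B)" for B0 y r0 B r
    proof (cases "B = B0")
      case True
      then show ?thesis using qfunctionalD(1)[OF fn A h(1,3), of r] h PD by auto
    next
      case False
      then show ?thesis using qfunctionalD(2)[OF fn A h(1,3,4) False h(5)] h PD by auto
    qed
    then show "?G \<subseteq> ?R" using sub by blast
  qed simp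
  show "?R \<subseteq> ?L"
  proof
    fix x assume x: "x \<in> ?R"
    note LD = csubspaceD[OF csubspace_cspan[OF _ sub]]
    have "op_id A x \<in> ?L"
      using X Y X Fr rel_adj_qRel[OF X Y Fr] A A op_id_mem_adj_comp[OF X F A]
    proof (induction rule: rel_comp_induct)
      case (base B s' r)
      then obtain s where s: "s \<in> F (A, B)" "s' = op_adj A B s" using A by (auto simp: rel_adj_def)
      have "s' (r x) \<in> ?G" using s base x by blast
      then show ?case unfolding L using cspan_superset[OF _ sub] x by auto
    qed (use x LD in \<open>simp_all add: L\<close>)
    then show "x \<in> ?L" using x by simp
  qed
qed

lemma pred_pullback_csubspace:
  assumes X: "qset X" and Y: "qset Y" and F: "F \<in> qRel X Y" and P: "\<And>B. B \<in> Y \<Longrightarrow> csubspace B (P B)" and A: "A \<in> X"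
  shows "csubspace A (pred_pullback X Y F P A)"
proof -
  have "P B \<subseteq> carrier B" if "B \<in> Y" for B using P[OF that] qsetD(1)[OF Y that] by (simp add: csubspace_iff)
  then show ?thesis
    using csubspace_cspan[OF _ pred_pullback_generators[OF X Y F _ A, of P]] qsetD(1)[OF X A] A
    by (simp add: pred_pullback_def)
qed

text \<open>Orthogonality of x to r^dagger y is orthogonality of r x to y. Compared with
  \<open>pred_pullback_eq\<close>, this says that inverse images commute with
  orthocomplements.\<close>

lemma pred_pullback_orthcomp:
  assumes X: "qset X" and Y: "qset Y" and F: "F \<in> qFun X Y" and P: "\<And>B. B \<in> Y \<Longrightarrow> csubspace B (P B)" and A: "A \<in> X"
  shows "orthcomp A (pred_pullback X Y F P A) = {x \<in> carrier A. \<forall>B\<in>Y. \<forall>r\<in>F (A, B). r x \<in> orthcomp B (P B)}"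
proof -
  note [simp] = qsetD(1)[OF X A]
  have Fr: "F \<in> qRel X Y" using F qFun_qRel by auto
  have PB: "P B \<subseteq> carrier B" if "B \<in> Y" for B using P[OF that] qsetD(1)[OF Y that] by (simp add: csubspace_iff)
  let ?G = "{op_adj A B r y | B y r. B \<in> Y \<and> y \<in> P B \<and> r \<in> F (A, B)}"
  have sub: "?G \<subseteq> carrier A" by (rule pred_pullback_generators[OF X Y Fr PB A])
  have L: "pred_pullback X Y F P A = cspan A ?G" using A by (simp add: pred_pullback_def)
  have 1: "x \<in> orthcomp A (cspan A ?G) \<longleftrightarrow> (\<forall>g\<in>?G. inner A g x = 0)" if x: "x \<in> carrier A" for x
  proof
    assume "x \<in> orthcomp A (cspan A ?G)"
    then show "\<forall>g\<in>?G. inner A g x = 0"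
      using cspan_superset[OF fd_hilbert_cvs[OF qsetD(1)[OF X A]] sub] unfolding orthcomp_def by blast
  next
    assume g: "\<forall>g\<in>?G. inner A g x = 0"
    have "inner A u x = 0" if u: "u \<in> cspan A ?G" for u
      using fd_hilbert_cvs[OF qsetD(1)[OF X A]] u sub
      by (induction rule: cspan_induct) (use g x in auto)
    then show "x \<in> orthcomp A (cspan A ?G)" using x by (simp add: orthcomp_def)
  qed
  have 2: "inner A (op_adj A B r y) x = inner B y (r x)"
    if "B \<in> Y" "y \<in> P B" "r \<in> F (A, B)" "x \<in> carrier A" for B y r x
    using that PB[of B] qRel_ops[OF Fr A, of B r] qsetD(1)[OF Y, of B] by auto
  show ?thesis
  proof (intro Set.set_eqI)
    fix x
    show "x \<in> orthcomp A (pred_pullback X Y F P A) \<longleftrightarrow>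
       x \<in> {x \<in> carrier A. \<forall>B\<in>Y. \<forall>r\<in>F (A, B). r x \<in> orthcomp B (P B)}"
    proof (cases "x \<in> carrier A")
      case True
      have rB: "r x \<in> carrier B" if "B \<in> Y" "r \<in> F (A, B)" for B r using qRel_ops[OF Fr A that] True by simp
      have "(\<forall>g\<in>?G. inner A g x = 0) \<longleftrightarrow> (\<forall>B\<in>Y. \<forall>r\<in>F (A, B). \<forall>y\<in>P B. inner B y (r x) = 0)"
        using 2[OF _ _ _ True] by (auto; metis)
      then show ?thesis unfolding L using 1[OF True] True rB by (auto simp: orthcomp_def)
    qed (auto simp: orthcomp_def)
  qed
qed

section \<open>Ortholattices and transport of functors\<close>

text \<open>The order-theoretic joins, meets and bounds are choices of extremal elements. The
  candidates \<open>ojoin\<close>, \<open>omeet\<close>, b and t have the universal properties and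
  agree with these choices by antisymmetry.\<close>

lemma ortholatticeI:
  fixes L :: "'a ortho" (structure)
  assumes eq: "eq L = (=)"
    and refl: "\<And>x. x \<in> carrier L \<Longrightarrow> x \<sqsubseteq> x"
    and antisym: "\<And>x y. x \<in> carrier L \<Longrightarrow> y \<in> carrier L \<Longrightarrow> x \<sqsubseteq> y \<Longrightarrow> y \<sqsubseteq> x \<Longrightarrow> x = y"
    and trans: "\<And>x y z. x \<in> carrier L \<Longrightarrow> y \<in> carrier L \<Longrightarrow> z \<in> carrier L \<Longrightarrow> x \<sqsubseteq> y \<Longrightarrow> y \<sqsubseteq> z \<Longrightarrow> x \<sqsubseteq> z"
    and joinC: "\<And>x y. x \<in> carrier L \<Longrightarrow> y \<in> carrier L \<Longrightarrow> ojoin L x y \<in> carrier L"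
    and joinU: "\<And>x y. x \<in> carrier L \<Longrightarrow> y \<in> carrier L \<Longrightarrow> x \<sqsubseteq> ojoin L x y \<and> y \<sqsubseteq> ojoin L x y"
    and joinL: "\<And>x y z. x \<in> carrier L \<Longrightarrow> y \<in> carrier L \<Longrightarrow> z \<in> carrier L \<Longrightarrow> x \<sqsubseteq> z \<Longrightarrow> y \<sqsubseteq> z
        \<Longrightarrow> ojoin L x y \<sqsubseteq> z"
    and meetC: "\<And>x y. x \<in> carrier L \<Longrightarrow> y \<in> carrier L \<Longrightarrow> omeet L x y \<in> carrier L"
    and meetU: "\<And>x y. x \<in> carrier L \<Longrightarrow> y \<in> carrier L \<Longrightarrow> omeet L x y \<sqsubseteq> x \<and> omeet L x y \<sqsubseteq> y"
    and meetL: "\<And>x y z. x \<in> carrier L \<Longrightarrow> y \<in> carrier L \<Longrightarrow> z \<in> carrier L \<Longrightarrow> z \<sqsubseteq> x \<Longrightarrow> z \<sqsubseteq> y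
        \<Longrightarrow> z \<sqsubseteq> omeet L x y"
    and bot: "b \<in> carrier L" "\<And>x. x \<in> carrier L \<Longrightarrow> b \<sqsubseteq> x"
    and top: "t \<in> carrier L" "\<And>x. x \<in> carrier L \<Longrightarrow> x \<sqsubseteq> t"
    and cC: "\<And>x. x \<in> carrier L \<Longrightarrow> ocompl L x \<in> carrier L"
    and ci: "\<And>x. x \<in> carrier L \<Longrightarrow> ocompl L (ocompl L x) = x"
    and ca: "\<And>x y. x \<in> carrier L \<Longrightarrow> y \<in> carrier L \<Longrightarrow> x \<sqsubseteq> y \<Longrightarrow> ocompl L y \<sqsubseteq> ocompl L x"
    and cm: "\<And>x. x \<in> carrier L \<Longrightarrow> omeet L x (ocompl L x) \<sqsubseteq> b"
    and cj: "\<And>x. x \<in> carrier L \<Longrightarrow> t \<sqsubseteq> ojoin L x (ocompl L x)"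
  shows "ortholattice L"
proof -
  have po: "partial_order L"
    by unfold_locales (auto simp: eq refl antisym intro: trans)
  interpret partial_order L by (rule po)
  have lub: "least L (ojoin L x y) (Upper L {x, y})" if "x \<in> carrier L" "y \<in> carrier L" for x y
    using that joinC joinU joinL by (auto simp: least_def Upper_def)
  have glb: "greatest L (omeet L x y) (Lower L {x, y})" if "x \<in> carrier L" "y \<in> carrier L" for x y
    using that meetC meetU meetL by (auto simp: greatest_def Lower_def)
  have b: "least L b (carrier L)" and t: "greatest L t (carrier L)"
    using bot top by (auto simp: least_def greatest_def)
  have bl: "Lattice.bounded_lattice L"
    by unfold_locales (use lub glb b t in blast)+
  interpret Lattice.bounded_lattice L by (rule bl)
  have j: "ojoin L x y = x \<squnion> y" if "x \<in> carrier L" "y \<in> carrier L" for x y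
    using antisym[OF joinC[OF that] join_closed[OF that] joinL[OF that join_closed[OF that] join_left[OF that] join_right[OF that]]
        join_le[OF conjunct1[OF joinU[OF that]] conjunct2[OF joinU[OF that]] that joinC[OF that]]] .
  have m: "omeet L x y = x \<sqinter> y" if "x \<in> carrier L" "y \<in> carrier L" for x y
    using antisym[OF meetC[OF that] meet_closed[OF that]
        meet_le[OF conjunct1[OF meetU[OF that]] conjunct2[OF meetU[OF that]] that meetC[OF that]]
        meetL[OF that meet_closed[OF that] meet_left[OF that] meet_right[OF that]]] .
  have b': "b = \<bottom>" and t': "t = \<top>"
    using bot top by (auto intro: bottom_eq top_eq)
  show ?thesis
  proof unfold_locales
    fix x assume x: "x \<in> carrier L"
    show "x \<squnion> ocompl L x = \<top>"
      using cj[OF x] j[OF x cC[OF x]] antisym[OF join_closed[OF x cC[OF x]] top(1)]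
        top(2)[OF join_closed[OF x cC[OF x]]] t' by simp
    show "x \<sqinter> ocompl L x = \<bottom>"
      using cm[OF x] m[OF x cC[OF x]] antisym[OF meet_closed[OF x cC[OF x]] bot(1)]
        bot(2)[OF meet_closed[OF x cC[OF x]]] b' by simp
  qed (auto simp: j m cC ci ca)
qed

context ortholattice
begin

lemma le_antisym': "x \<in> carrier L \<Longrightarrow> y \<in> carrier L \<Longrightarrow> x \<sqsubseteq> y \<Longrightarrow> y \<sqsubseteq> x \<Longrightarrow> x = y"
  using le_antisym by blast

lemma ojoin_closed: "x \<in> carrier L \<Longrightarrow> y \<in> carrier L \<Longrightarrow> ojoin L x y \<in> carrier L"
  by (simp add: ojoin_eq)

lemma omeet_closed: "x \<in> carrier L \<Longrightarrow> y \<in> carrier L \<Longrightarrow> omeet L x y \<in> carrier L"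
  by (simp add: omeet_eq)

lemma le_iff_ojoin: "x \<in> carrier L \<Longrightarrow> y \<in> carrier L \<Longrightarrow> x \<sqsubseteq> y \<longleftrightarrow> ojoin L x y = y"
  by (metis join_closed join_le join_left join_right le_antisym' le_refl ojoin_eq)

text \<open>Reduces joins to meets and complements, so that morphisms can be checked on the
  latter.\<close>

lemma ojoin_de_morgan:
  assumes x: "x \<in> carrier L" and y: "y \<in> carrier L"
  shows "ojoin L x y = ocompl L (omeet L (ocompl L x) (ocompl L y))"
proof -
  let ?m = "ocompl L x \<sqinter> ocompl L y"
  note c = ocompl_closed[OF x] ocompl_closed[OF y]
  have m: "?m \<in> carrier L" using c by simp
  have j: "x \<squnion> y \<in> carrier L" using x y by simp
  show ?thesis
    unfolding ojoin_eq[OF x y] omeet_eq[OF c]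
  proof (rule le_antisym'[OF j ocompl_closed[OF m]])
    show "x \<squnion> y \<sqsubseteq> ocompl L ?m"
    proof (rule join_le)
      show "x \<sqsubseteq> ocompl L ?m" "y \<sqsubseteq> ocompl L ?m"
        using ocompl_antitone[OF m c(1)] ocompl_antitone[OF m c(2)] meet_left[OF c] meet_right[OF c]
          ocompl_involutive x y by auto
    qed (use x y m ocompl_closed in auto)
    have "ocompl L (x \<squnion> y) \<sqsubseteq> ?m"
      using ocompl_antitone[OF x j] ocompl_antitone[OF y j] join_left[OF x y] join_right[OF x y]
        ocompl_closed[OF j] c by (intro meet_le) auto
    from ocompl_antitone[OF ocompl_closed[OF j] m this] show "ocompl L ?m \<sqsubseteq> x \<squnion> y"
      using ocompl_involutive[OF j] by simp
  qed
qed

end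

text \<open>Joins follow by De Morgan's law. The bounds follow since an element and its complement
  have the top as join and the bottom as meet; this is applied to the top and to its image.\<close>

lemma ortho_homI:
  assumes L: "ortholattice L" and M: "ortholattice M" and h: "\<And>x. x \<in> carrier L \<Longrightarrow> h x \<in> carrier M"
    and m: "\<And>x y. x \<in> carrier L \<Longrightarrow> y \<in> carrier L \<Longrightarrow> h (omeet L x y) = omeet M (h x) (h y)"
    and c: "\<And>x. x \<in> carrier L \<Longrightarrow> h (ocompl L x) = ocompl M (h x)"
  shows "h \<in> ortho_hom L M"
proof -
  interpret L: ortholattice L by (rule L)
  interpret M: ortholattice M by (rule M)
  note top = L.top_closed
  have j: "h (ojoin L x y) = ojoin M (h x) (h y)" if "x \<in> carrier L" "y \<in> carrier L" for x y
    using that h by (simp add: L.ojoin_de_morgan M.ojoin_de_morgan c m L.ocompl_closed L.omeet_closed)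
  have ct: "ocompl L \<top>\<^bsub>L\<^esub> \<in> carrier L" "h \<top>\<^bsub>L\<^esub> \<in> carrier M" "ocompl M (h \<top>\<^bsub>L\<^esub>) \<in> carrier M"
    using L.ocompl_closed[OF top] h[OF top] M.ocompl_closed by auto
  have "h (ojoin L \<top>\<^bsub>L\<^esub> (ocompl L \<top>\<^bsub>L\<^esub>)) = \<top>\<^bsub>M\<^esub>" "h (omeet L \<top>\<^bsub>L\<^esub> (ocompl L \<top>\<^bsub>L\<^esub>)) = \<bottom>\<^bsub>M\<^esub>"
    using j[OF top ct(1)] m[OF top ct(1)] c[OF top] M.ojoin_eq[OF ct(2,3)] M.omeet_eq[OF ct(2,3)]
      M.ocompl_join[OF ct(2)] M.ocompl_meet[OF ct(2)] by simp_all
  then have "h \<top>\<^bsub>L\<^esub> = \<top>\<^bsub>M\<^esub>" "h \<bottom>\<^bsub>L\<^esub> = \<bottom>\<^bsub>M\<^esub>"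
    using L.ocompl_join[OF top] L.ocompl_meet[OF top] L.ojoin_eq[OF top ct(1)] L.omeet_eq[OF top ct(1)] by simp_all
  then show ?thesis using h m c j by (auto simp: ortho_hom_def)
qed

lemma ortho_hom_comp:
  assumes "h \<in> ortho_hom L M" "k \<in> ortho_hom M N"
  shows "(\<lambda>x. k (h x)) \<in> ortho_hom L N"
  using assms by (auto simp: ortho_hom_def Pi_iff)

lemma ortho_hom_cong:
  assumes "ortholattice L" and h: "h \<in> ortho_hom L M" and eq: "\<And>x. x \<in> carrier L \<Longrightarrow> k x = h x"
  shows "k \<in> ortho_hom L M"
proof -
  interpret ortholattice L by fact
  show ?thesis
    using h by (simp add: ortho_hom_def Pi_iff eq ojoin_closed omeet_closed ocompl_closed)
qed

lemma ortho_isoI: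
  assumes "ortholattice L" and h: "h \<in> ortho_hom L M" and b: "bij_betw h (carrier L) (carrier M)"
  shows "h \<in> ortho_iso L M"
proof -
  interpret ortholattice L by fact
  let ?k = "inv_into (carrier L) h"
  have k: "?k (h x) = x" if "x \<in> carrier L" for x using b that by (simp add: bij_betw_inv_into_left)
  have hk: "h (?k y) = y" "?k y \<in> carrier L" if "y \<in> carrier M" for y
    using b that by (simp_all add: bij_betw_inv_into_right bij_betw_imp_surj_on inv_into_into)
  note hD = h[unfolded ortho_hom_def, simplified]
  have "?k (ojoin M x y) = ojoin L (?k x) (?k y)" "?k (omeet M x y) = omeet L (?k x) (?k y)"
    if "x \<in> carrier M" "y \<in> carrier M" for x y
    using hD hk[OF that(1)] hk[OF that(2)] k[of "ojoin L (?k x) (?k y)"] k[of "omeet L (?k x) (?k y)"]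
    by (simp_all add: ojoin_closed omeet_closed)
  moreover have "?k (ocompl M x) = ocompl L (?k x)" if "x \<in> carrier M" for x
    using hD hk[OF that] k[of "ocompl L (?k x)"] by (simp add: ocompl_closed)
  moreover have "?k \<top>\<^bsub>M\<^esub> = \<top>\<^bsub>L\<^esub>" "?k \<bottom>\<^bsub>M\<^esub> = \<bottom>\<^bsub>L\<^esub>"
    using hD k[of "\<top>\<^bsub>L\<^esub>"] k[of "\<bottom>\<^bsub>L\<^esub>"] by simp_all
  ultimately have "?k \<in> ortho_hom M L" using hk by (simp add: ortho_hom_def)
  then show ?thesis using h b by (simp add: ortho_iso_def)
qed

text \<open>Suited to \<open>Fun_bool\<close>, whose order and operations are all given
  independently, so that h has to match each of them.\<close>

lemma ortholattice_transport:
  assumes "ortholattice L" and b: "bij_betw h (carrier L) (carrier M)" and eq: "eq M = (=)"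
    and le: "\<And>x y. x \<in> carrier L \<Longrightarrow> y \<in> carrier L \<Longrightarrow> h x \<sqsubseteq>\<^bsub>M\<^esub> h y \<longleftrightarrow> x \<sqsubseteq>\<^bsub>L\<^esub> y"
    and j: "\<And>x y. x \<in> carrier L \<Longrightarrow> y \<in> carrier L \<Longrightarrow> ojoin M (h x) (h y) = h (ojoin L x y)"
    and m: "\<And>x y. x \<in> carrier L \<Longrightarrow> y \<in> carrier L \<Longrightarrow> omeet M (h x) (h y) = h (omeet L x y)"
    and c: "\<And>x. x \<in> carrier L \<Longrightarrow> ocompl M (h x) = h (ocompl L x)"
  shows "ortholattice M" and "h \<in> ortho_iso L M"
proof -
  interpret L: ortholattice L by fact
  have C: "carrier M = h ` carrier L" using b by (simp add: bij_betw_imp_surj_on)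
  note cl = L.ojoin_closed L.omeet_closed L.ocompl_closed
  show M: "ortholattice M"
    by (rule ortholatticeI[of M "h \<bottom>\<^bsub>L\<^esub>" "h \<top>\<^bsub>L\<^esub>"], rule eq)
      (auto simp: C le j m c cl L.ocompl_involutive L.ojoin_eq L.omeet_eq L.join_left L.join_right L.join_le
        L.meet_left L.meet_right L.meet_le L.ocompl_antitone L.ocompl_join L.ocompl_meet
        intro!: arg_cong[where f = h] L.le_antisym' intro: L.le_trans)
  have "h \<in> ortho_hom L M"
    using assms(1) M by (rule ortho_homI) (auto simp: C m c)
  then show "h \<in> ortho_iso L M" using assms(1) b by (intro ortho_isoI)
qed

context
  fixes C :: "'a set" and le_op and c :: "'a \<Rightarrow> 'a"
  assumes antisym: "\<And>x y. x \<in> C \<Longrightarrow> y \<in> C \<Longrightarrow> le_op x y \<Longrightarrow> le_op y x \<Longrightarrow> x = y"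
begin

text \<open>\<open>join\<close> picks some least upper bound; antisymmetry on C pins it down
  although C is not yet known to be a lattice.\<close>

lemma ojoin_ortho_of_order:
  assumes "x \<in> C" "y \<in> C" "s \<in> C" "le_op x s" "le_op y s"
    and "\<And>z. z \<in> C \<Longrightarrow> le_op x z \<Longrightarrow> le_op y z \<Longrightarrow> le_op s z"
  shows "ojoin (ortho_of_order C le_op c) x y = s"
proof -
  have "join \<lparr>carrier = C, eq = (=), le = le_op\<rparr> x y = s"
    unfolding join_def sup_def
  proof (rule some_equality)
    show "least \<lparr>carrier = C, eq = (=), le = le_op\<rparr> s (Upper \<lparr>carrier = C, eq = (=), le = le_op\<rparr> {x, y})"
      using assms by (auto simp: least_def Upper_def)
    show "s' = s" if "least \<lparr>carrier = C, eq = (=), le = le_op\<rparr> s' (Upper \<lparr>carrier = C, eq = (=), le = le_op\<rparr> {x, y})" for s'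
      using that assms by (intro antisym) (auto simp: least_def Upper_def)
  qed
  then show ?thesis by (simp add: ortho_of_order_def Let_def)
qed

lemma omeet_ortho_of_order:
  assumes "x \<in> C" "y \<in> C" "s \<in> C" "le_op s x" "le_op s y"
    and "\<And>z. z \<in> C \<Longrightarrow> le_op z x \<Longrightarrow> le_op z y \<Longrightarrow> le_op z s"
  shows "omeet (ortho_of_order C le_op c) x y = s"
proof -
  have "meet \<lparr>carrier = C, eq = (=), le = le_op\<rparr> x y = s"
    unfolding meet_def inf_def
  proof (rule some_equality)
    show "greatest \<lparr>carrier = C, eq = (=), le = le_op\<rparr> s (Lower \<lparr>carrier = C, eq = (=), le = le_op\<rparr> {x, y})"
      using assms by (auto simp: greatest_def Lower_def)
    show "s' = s" if "greatest \<lparr>carrier = C, eq = (=), le = le_op\<rparr> s' (Lower \<lparr>carrier = C, eq = (=), le = le_op\<rparr> {x, y})" for s'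
      using that assms by (intro antisym) (auto simp: greatest_def Lower_def)
  qed
  then show ?thesis by (simp add: ortho_of_order_def Let_def)
qed

end

lemma ortho_of_order_simps [simp]:
  "carrier (ortho_of_order C le_op c) = C" "eq (ortho_of_order C le_op c) = (=)"
  "le (ortho_of_order C le_op c) = le_op" "ocompl (ortho_of_order C le_op c) = c"
  by (simp_all add: ortho_of_order_def Let_def)

text \<open>An order isomorphism carries least upper and greatest lower bounds along, so for a
  lattice given by order and complement only these two have to be matched.\<close>

lemma ortho_of_order_transport:
  assumes "ortholattice L" and b: "bij_betw h (carrier L) C"
    and le: "\<And>x y. x \<in> carrier L \<Longrightarrow> y \<in> carrier L \<Longrightarrow> le_op (h x) (h y) \<longleftrightarrow> x \<sqsubseteq>\<^bsub>L\<^esub> y"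
    and c: "\<And>x. x \<in> carrier L \<Longrightarrow> c (h x) = h (ocompl L x)"
  shows "ortholattice (ortho_of_order C le_op c)" and "h \<in> ortho_iso L (ortho_of_order C le_op c)"
proof -
  interpret L: ortholattice L by fact
  have C: "C = h ` carrier L" using b by (simp add: bij_betw_imp_surj_on)
  have antisym: "x = y" if "x \<in> C" "y \<in> C" "le_op x y" "le_op y x" for x y
    using that le L.le_antisym' unfolding C by blast
  have j: "ojoin (ortho_of_order C le_op c) (h x) (h y) = h (ojoin L x y)" if "x \<in> carrier L" "y \<in> carrier L" for x y
    using that antisym
    by (intro ojoin_ortho_of_order) (auto simp: C le L.ojoin_eq L.join_left L.join_right L.join_le)
  have m: "omeet (ortho_of_order C le_op c) (h x) (h y) = h (omeet L x y)" if "x \<in> carrier L" "y \<in> carrier L" for x y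
    using that antisym
    by (intro omeet_ortho_of_order) (auto simp: C le L.omeet_eq L.meet_left L.meet_right L.meet_le)
  show "ortholattice (ortho_of_order C le_op c)" "h \<in> ortho_iso L (ortho_of_order C le_op c)"
    using ortholattice_transport[of L h "ortho_of_order C le_op c"] assms j m by simp_all
qed

text \<open>Naturality and bijectivity force the action of Psi to be the inverse of eta, then the
  action of Phi, then eta. Hence Psi inherits the morphism and functor laws, and only the predicates
  require a direct verification.\<close>

lemma contravariant_functor_transport:
  fixes \<Phi> :: "('v, 'a) qfunctor" and \<Psi> :: "('v, 'b) qfunctor"
  assumes \<Phi>: "contravariant_functor \<Phi>"
    and ol: "\<And>X. qset X \<Longrightarrow> ortholattice (obj \<Psi> X)"
    and iso: "\<And>X. qset X \<Longrightarrow> \<eta> X \<in> ortho_iso (obj \<Phi> X) (obj \<Psi> X)"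
    and nat: "\<And>X Y F a. qset X \<Longrightarrow> qset Y \<Longrightarrow> F \<in> qFun X Y \<Longrightarrow> a \<in> carrier (obj \<Phi> Y)
      \<Longrightarrow> \<eta> X (arr \<Phi> X Y F a) = arr \<Psi> X Y F (\<eta> Y a)"
  shows "contravariant_functor \<Psi>" and "naturally_isomorphic \<Phi> \<Psi>"
proof -
  show "naturally_isomorphic \<Phi> \<Psi>"
    unfolding naturally_isomorphic_def using iso nat by blast
  define \<theta> where "\<theta> X = inv_into (carrier (obj \<Phi> X)) (\<eta> X)" for X
  have \<Phi>1: "arr \<Phi> X Y F \<in> ortho_hom (obj \<Phi> Y) (obj \<Phi> X)" if "qset X" "qset Y" "F \<in> qFun X Y" for X Y F
    using \<Phi> that by (simp add: contravariant_functor_def)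
  have \<Phi>2: "arr \<Phi> X X (rel_id X) a = a" if "qset X" "a \<in> carrier (obj \<Phi> X)" for X a
    using \<Phi> that by (simp add: contravariant_functor_def)
  have \<Phi>3: "arr \<Phi> X Z (rel_comp X Y Z G F) a = arr \<Phi> X Y F (arr \<Phi> Y Z G a)"
    if "qset X" "qset Y" "qset Z" "F \<in> qFun X Y" "G \<in> qFun Y Z" "a \<in> carrier (obj \<Phi> Z)" for X Y Z F G a
    using \<Phi> that by (simp add: contravariant_functor_def)
  have \<eta>: "\<eta> X \<in> ortho_hom (obj \<Phi> X) (obj \<Psi> X)" and \<theta>: "\<theta> X \<in> ortho_hom (obj \<Psi> X) (obj \<Phi> X)"
    and \<eta>\<theta>: "b \<in> carrier (obj \<Psi> X) \<Longrightarrow> \<eta> X (\<theta> X b) = b" and \<theta>C: "b \<in> carrier (obj \<Psi> X) \<Longrightarrow> \<theta> X b \<in> carrier (obj \<Phi> X)"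
    if "qset X" for X b
  proof -
    have b: "bij_betw (\<eta> X) (carrier (obj \<Phi> X)) (carrier (obj \<Psi> X))" using iso[OF that] by (simp add: ortho_iso_def)
    show "\<eta> X \<in> ortho_hom (obj \<Phi> X) (obj \<Psi> X)" "\<theta> X \<in> ortho_hom (obj \<Psi> X) (obj \<Phi> X)"
      using iso[OF that] by (simp_all add: ortho_iso_def \<theta>_def)
    show "b \<in> carrier (obj \<Psi> X) \<Longrightarrow> \<eta> X (\<theta> X b) = b"
      unfolding \<theta>_def by (rule bij_betw_inv_into_right[OF b])
    show "b \<in> carrier (obj \<Psi> X) \<Longrightarrow> \<theta> X b \<in> carrier (obj \<Phi> X)"
      unfolding \<theta>_def using b by (simp add: bij_betw_imp_surj_on inv_into_into)
  qed
  have eq: "arr \<Psi> X Y F b = \<eta> X (arr \<Phi> X Y F (\<theta> Y b))"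
    if "qset X" "qset Y" "F \<in> qFun X Y" "b \<in> carrier (obj \<Psi> Y)" for X Y F b
    using nat[OF that(1-3) \<theta>C[OF that(2,4)]] \<eta>\<theta>[OF that(2,4)] by simp
  have hom: "arr \<Psi> X Y F \<in> ortho_hom (obj \<Psi> Y) (obj \<Psi> X)" if "qset X" "qset Y" "F \<in> qFun X Y" for X Y F
    by (rule ortho_hom_cong[OF ol[OF that(2)]
          ortho_hom_comp[OF ortho_hom_comp[OF \<theta>[OF that(2)] \<Phi>1[OF that]] \<eta>[OF that(1)]] eq[OF that]])
  have idl: "arr \<Psi> X X (rel_id X) b = b" if X: "qset X" and b: "b \<in> carrier (obj \<Psi> X)" for X b
    using eq[OF X X qFun_rel_id[OF X] b] \<Phi>2[OF X \<theta>C[OF X b]] \<eta>\<theta>[OF X b] by simp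
  have comp: "arr \<Psi> X Z (rel_comp X Y Z G F) b = arr \<Psi> X Y F (arr \<Psi> Y Z G b)"
    if X: "qset X" and Y: "qset Y" and Z: "qset Z" and F: "F \<in> qFun X Y" and G: "G \<in> qFun Y Z"
      and b: "b \<in> carrier (obj \<Psi> Z)" for X Y Z F G b
  proof -
    have a: "\<theta> Z b \<in> carrier (obj \<Phi> Z)" by (rule \<theta>C[OF Z b])
    have a': "arr \<Phi> Y Z G (\<theta> Z b) \<in> carrier (obj \<Phi> Y)" using \<Phi>1[OF Y Z G] a by (auto simp: ortho_hom_def)
    show ?thesis
      using eq[OF X Z qFun_rel_comp[OF X Y Z F G] b] \<Phi>3[OF X Y Z F G a] nat[OF X Y F a'] eq[OF Y Z G b] by simp
  qed
  show "contravariant_functor \<Psi>"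
    unfolding contravariant_functor_def
    by (intro conjI allI impI ballI; (elim conjE)?) (assumption | rule ol hom idl comp)+
qed

lemma naturally_isomorphic_sym:
  assumes \<Phi>: "contravariant_functor \<Phi>" and \<Psi>: "contravariant_functor \<Psi>" and iso: "naturally_isomorphic \<Phi> \<Psi>"
  shows "naturally_isomorphic \<Psi> \<Phi>"
proof -
  obtain \<eta> where \<eta>: "\<And>X. qset X \<Longrightarrow> \<eta> X \<in> ortho_iso (obj \<Phi> X) (obj \<Psi> X)"
    and nat: "\<And>X Y F a. qset X \<Longrightarrow> qset Y \<Longrightarrow> F \<in> qFun X Y \<Longrightarrow> a \<in> carrier (obj \<Phi> Y)
      \<Longrightarrow> \<eta> X (arr \<Phi> X Y F a) = arr \<Psi> X Y F (\<eta> Y a)"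
    using iso unfolding naturally_isomorphic_def by blast
  define \<theta> where "\<theta> X = inv_into (carrier (obj \<Phi> X)) (\<eta> X)" for X
  have bij: "bij_betw (\<eta> X) (carrier (obj \<Phi> X)) (carrier (obj \<Psi> X))" if "qset X" for X
    using \<eta>[OF that] by (simp add: ortho_iso_def)
  have "\<theta> X \<in> ortho_iso (obj \<Psi> X) (obj \<Phi> X)" if "qset X" for X
    using \<Psi> that \<eta>[OF that] bij_betw_inv_into[OF bij[OF that]] unfolding \<theta>_def
    by (intro ortho_isoI) (auto simp: contravariant_functor_def ortho_iso_def)
  moreover have "\<theta> X (arr \<Psi> X Y F b) = arr \<Phi> X Y F (\<theta> Y b)"
    if X: "qset X" and Y: "qset Y" and F: "F \<in> qFun X Y" and b: "b \<in> carrier (obj \<Psi> Y)" for X Y F b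
  proof -
    have t: "\<theta> Y b \<in> carrier (obj \<Phi> Y)" "\<eta> Y (\<theta> Y b) = b"
      using bij[OF Y] b unfolding \<theta>_def by (auto simp: bij_betw_inv_into_right bij_betw_def inv_into_into)
    have "arr \<Phi> X Y F \<in> ortho_hom (obj \<Phi> Y) (obj \<Phi> X)"
      using \<Phi> X Y F by (simp add: contravariant_functor_def)
    then have "arr \<Phi> X Y F (\<theta> Y b) \<in> carrier (obj \<Phi> X)"
      using t(1) by (auto simp: ortho_hom_def)
    then show ?thesis
      using nat[OF X Y F t(1)] t(2) bij_betw_inv_into_left[OF bij[OF X]] unfolding \<theta>_def by metis
  qed
  ultimately show ?thesis unfolding naturally_isomorphic_def by blast
qed

lemma naturally_isomorphic_trans:
  assumes \<Phi>: "contravariant_functor \<Phi>" and 1: "naturally_isomorphic \<Phi> \<Psi>" and 2: "naturally_isomorphic \<Psi> \<Theta>"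
  shows "naturally_isomorphic \<Phi> \<Theta>"
proof -
  obtain \<eta> where \<eta>: "\<And>X. qset X \<Longrightarrow> \<eta> X \<in> ortho_iso (obj \<Phi> X) (obj \<Psi> X)"
    and \<eta>n: "\<And>X Y F a. qset X \<Longrightarrow> qset Y \<Longrightarrow> F \<in> qFun X Y \<Longrightarrow> a \<in> carrier (obj \<Phi> Y)
      \<Longrightarrow> \<eta> X (arr \<Phi> X Y F a) = arr \<Psi> X Y F (\<eta> Y a)"
    using 1 unfolding naturally_isomorphic_def by blast
  obtain \<theta> where \<theta>: "\<And>X. qset X \<Longrightarrow> \<theta> X \<in> ortho_iso (obj \<Psi> X) (obj \<Theta> X)"
    and \<theta>n: "\<And>X Y F a. qset X \<Longrightarrow> qset Y \<Longrightarrow> F \<in> qFun X Y \<Longrightarrow> a \<in> carrier (obj \<Psi> Y)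
      \<Longrightarrow> \<theta> X (arr \<Psi> X Y F a) = arr \<Theta> X Y F (\<theta> Y a)"
    using 2 unfolding naturally_isomorphic_def by blast
  have "(\<lambda>a. \<theta> X (\<eta> X a)) \<in> ortho_iso (obj \<Phi> X) (obj \<Theta> X)" if X: "qset X" for X
  proof (rule ortho_isoI)
    show "ortholattice (obj \<Phi> X)" using \<Phi> X by (simp add: contravariant_functor_def)
    show "(\<lambda>a. \<theta> X (\<eta> X a)) \<in> ortho_hom (obj \<Phi> X) (obj \<Theta> X)"
      using \<eta>[OF X] \<theta>[OF X] by (auto simp: ortho_iso_def intro: ortho_hom_comp)
    show "bij_betw (\<lambda>a. \<theta> X (\<eta> X a)) (carrier (obj \<Phi> X)) (carrier (obj \<Theta> X))"
      using \<eta>[OF X] \<theta>[OF X] bij_betw_trans[of "\<eta> X" _ _ "\<theta> X"] by (auto simp: ortho_iso_def comp_def)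
  qed
  moreover have "\<theta> X (\<eta> X (arr \<Phi> X Y F a)) = arr \<Theta> X Y F (\<theta> Y (\<eta> Y a))"
    if X: "qset X" and Y: "qset Y" and F: "F \<in> qFun X Y" and a: "a \<in> carrier (obj \<Phi> Y)" for X Y F a
    using \<eta>n[OF X Y F a] \<theta>n[OF X Y F, of "\<eta> Y a"] \<eta>[OF Y] a by (auto simp: ortho_iso_def ortho_hom_def)
  ultimately show ?thesis unfolding naturally_isomorphic_def by (intro exI[of _ "\<lambda>X a. \<theta> X (\<eta> X a)"]) blast
qed

section \<open>The functor of predicates\<close>

lemma carrier_Pred: "P \<in> carrier (Pred X) \<longleftrightarrow> P \<in> extensional X \<and> (\<forall>A\<in>X. csubspace A (P A))"
  by (auto simp: Pred_def PiE_iff)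

lemma Pred_eqI:
  assumes "P \<in> carrier (Pred X)" "Q \<in> carrier (Pred X)" "\<And>A. A \<in> X \<Longrightarrow> P A = Q A"
  shows "P = Q"
  using assms by (intro extensionalityI[of P X Q]) (auto simp: carrier_Pred)

lemma le_Pred: "P \<sqsubseteq>\<^bsub>Pred X\<^esub> Q \<longleftrightarrow> (\<forall>A\<in>X. P A \<subseteq> Q A)"
  by (simp add: Pred_def)

lemma ocompl_Pred: "ocompl (Pred X) P = (\<lambda>A\<in>X. orthcomp A (P A))"
  by (simp add: Pred_def)

lemma csubspace_inter: "cvs V \<Longrightarrow> csubspace V W \<Longrightarrow> csubspace V W' \<Longrightarrow> csubspace V (W \<inter> W')"
  by (auto simp: csubspace_iff)

context
  fixes X :: "'v hilb set"
  assumes X: "qset X"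
begin

lemma Pred_antisym:
  assumes "P \<in> carrier (Pred X)" "Q \<in> carrier (Pred X)" "P \<sqsubseteq>\<^bsub>Pred X\<^esub> Q" "Q \<sqsubseteq>\<^bsub>Pred X\<^esub> P"
  shows "P = Q"
  using assms by (intro Pred_eqI) (auto simp: le_Pred)

lemma csub_subset: "csubspace A W \<Longrightarrow> A \<in> X \<Longrightarrow> W \<subseteq> carrier A"
  using qsetD(1)[OF X] by (simp add: csubspace_iff)

lemma omeet_Pred:
  assumes P: "P \<in> carrier (Pred X)" and Q: "Q \<in> carrier (Pred X)"
  shows "omeet (Pred X) P Q = (\<lambda>A\<in>X. P A \<inter> Q A)"
  unfolding Pred_def using assms Pred_antisym qsetD(1)[OF X]
  by (intro omeet_ortho_of_order) (auto simp: carrier_Pred Pred_def PiE_iff intro: csubspace_inter)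

lemma ojoin_Pred:
  assumes P: "P \<in> carrier (Pred X)" and Q: "Q \<in> carrier (Pred X)"
  shows "ojoin (Pred X) P Q = (\<lambda>A\<in>X. cspan A (P A \<union> Q A))"
proof -
  have sub: "P A \<union> Q A \<subseteq> carrier A" if "A \<in> X" for A
    using P Q that csub_subset by (auto simp: carrier_Pred)
  have sup: "P A \<subseteq> cspan A (P A \<union> Q A)" "Q A \<subseteq> cspan A (P A \<union> Q A)" if "A \<in> X" for A
    using cspan_superset[OF _ sub[OF that]] qsetD(1)[OF X that] by auto
  have cs: "csubspace A (cspan A (P A \<union> Q A))" if "A \<in> X" for A
    by (rule csubspace_cspan[OF fd_hilbert_cvs[OF qsetD(1)[OF X that]] sub[OF that]])
  have least: "cspan A (P A \<union> Q A) \<subseteq> R A"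
    if "R \<in> carrier (Pred X)" "\<forall>A\<in>X. P A \<subseteq> R A" "\<forall>A\<in>X. Q A \<subseteq> R A" "A \<in> X" for R A
    using that qsetD(1)[OF X that(4)] by (intro cspan_least) (auto simp: carrier_Pred)
  have eq: "Pred X = ortho_of_order (carrier (Pred X)) (\<lambda>P Q. \<forall>A\<in>X. P A \<subseteq> Q A) (\<lambda>P. \<lambda>A\<in>X. orthcomp A (P A))"
    by (simp add: Pred_def)
  show ?thesis
  proof (subst eq, rule ojoin_ortho_of_order[OF _ P Q])
    show "R = S" if "R \<in> carrier (Pred X)" "S \<in> carrier (Pred X)" "\<forall>A\<in>X. R A \<subseteq> S A" "\<forall>A\<in>X. S A \<subseteq> R A" for R S
      using Pred_antisym[OF that(1,2)] that(3,4) by (simp add: le_Pred)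
    show "(\<lambda>A\<in>X. cspan A (P A \<union> Q A)) \<in> carrier (Pred X)" using cs by (simp add: carrier_Pred)
  qed (use sup least in auto)
qed

lemma ortholattice_Pred: "ortholattice (Pred X)"
proof -
  have sub: "P A \<subseteq> carrier A" if "P \<in> carrier (Pred X)" "A \<in> X" for P A
    using that csub_subset by (auto simp: carrier_Pred)
  have jC: "ojoin (Pred X) P Q \<in> carrier (Pred X)" and jU: "P \<sqsubseteq>\<^bsub>Pred X\<^esub> ojoin (Pred X) P Q" "Q \<sqsubseteq>\<^bsub>Pred X\<^esub> ojoin (Pred X) P Q"
    if P: "P \<in> carrier (Pred X)" and Q: "Q \<in> carrier (Pred X)" for P Q
  proof -
    have s: "P A \<union> Q A \<subseteq> carrier A" if "A \<in> X" for A using sub[OF P that] sub[OF Q that] by simp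
    show "ojoin (Pred X) P Q \<in> carrier (Pred X)"
      using csubspace_cspan[OF fd_hilbert_cvs[OF qsetD(1)[OF X]] s] by (simp add: ojoin_Pred[OF P Q] carrier_Pred)
    show "P \<sqsubseteq>\<^bsub>Pred X\<^esub> ojoin (Pred X) P Q" "Q \<sqsubseteq>\<^bsub>Pred X\<^esub> ojoin (Pred X) P Q"
      using cspan_superset[OF _ s] qsetD(1)[OF X] by (fastforce simp: ojoin_Pred[OF P Q] le_Pred)+
  qed
  have jL: "ojoin (Pred X) P Q \<sqsubseteq>\<^bsub>Pred X\<^esub> R"
    if P: "P \<in> carrier (Pred X)" and Q: "Q \<in> carrier (Pred X)" and R: "R \<in> carrier (Pred X)"
      and PR: "P \<sqsubseteq>\<^bsub>Pred X\<^esub> R" and QR: "Q \<sqsubseteq>\<^bsub>Pred X\<^esub> R" for P Q R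
  proof -
    have "cspan A (P A \<union> Q A) \<subseteq> R A" if "A \<in> X" for A
      using that R PR QR qsetD(1)[OF X that] by (intro cspan_least) (auto simp: carrier_Pred le_Pred)
    then show ?thesis by (simp add: le_Pred ojoin_Pred[OF P Q])
  qed
  have cC: "ocompl (Pred X) P \<in> carrier (Pred X)" if P: "P \<in> carrier (Pred X)" for P
    using sub[OF P] qsetD(1)[OF X] by (auto simp: ocompl_Pred carrier_Pred intro: orthcomp_csubspace)
  have botC: "(\<lambda>A\<in>X. {\<zero>\<^bsub>A\<^esub>}) \<in> carrier (Pred X)" and topC: "(\<lambda>A\<in>X. carrier A) \<in> carrier (Pred X)"
    using qsetD(1)[OF X] by (auto simp: carrier_Pred intro: csubspace_zero csubspace_carrier)
  have cj: "carrier A \<subseteq> cspan A (P A \<union> orthcomp A (P A))" if P: "P \<in> carrier (Pred X)" and A: "A \<in> X" for P A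
  proof
    note [simp] = qsetD(1)[OF X A]
    have W: "csubspace A (P A)" using P A by (simp add: carrier_Pred)
    have s: "P A \<union> orthcomp A (P A) \<subseteq> carrier A" using sub[OF P A] by (auto simp: orthcomp_def)
    note ss = cspan_superset[OF fd_hilbert_cvs[OF qsetD(1)[OF X A]] s]
    fix x assume x: "x \<in> carrier A"
    have 1: "proj A (P A) x \<in> cspan A (P A \<union> orthcomp A (P A))"
      using proj_spec(1)[OF _ W x] ss by auto
    have 2: "x \<ominus>\<^bsub>A\<^esub> proj A (P A) x \<in> cspan A (P A \<union> orthcomp A (P A))"
      using minus_proj_orth[OF _ W x] ss by auto
    have "x = proj A (P A) x \<oplus>\<^bsub>A\<^esub> (x \<ominus>\<^bsub>A\<^esub> proj A (P A) x)"
      using x proj_carrier[OF _ W x] by (intro hinner_ext[of A]) simp_all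
    then show "x \<in> cspan A (P A \<union> orthcomp A (P A))"
      using csubspaceD(3)[OF csubspace_cspan[OF _ s] _ 1 2] by simp
  qed
  have cm: "x = \<zero>\<^bsub>A\<^esub>" if P: "P \<in> carrier (Pred X)" and A: "A \<in> X" and x: "x \<in> P A" "x \<in> orthcomp A (P A)" for P A x
    using x hinner_self_eq_0[OF qsetD(1)[OF X A], of x] by (auto simp: orthcomp_def)
  show ?thesis
  proof (rule ortholatticeI[of "Pred X" "\<lambda>A\<in>X. {\<zero>\<^bsub>A\<^esub>}" "\<lambda>A\<in>X. carrier A"])
    show "eq (Pred X) = (=)" by (simp add: Pred_def)
    show "omeet (Pred X) P Q \<in> carrier (Pred X)" if "P \<in> carrier (Pred X)" "Q \<in> carrier (Pred X)" for P Q
      using that qsetD(1)[OF X] by (auto simp: omeet_Pred carrier_Pred intro: csubspace_inter)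
    show "ocompl (Pred X) (ocompl (Pred X) P) = P" if P: "P \<in> carrier (Pred X)" for P
      using P cC[OF cC[OF P]] qsetD(1)[OF X]
      by (intro Pred_eqI) (auto simp: ocompl_Pred carrier_Pred orthcomp_orthcomp)
    show "(\<lambda>A\<in>X. {\<zero>\<^bsub>A\<^esub>}) \<sqsubseteq>\<^bsub>Pred X\<^esub> P" if "P \<in> carrier (Pred X)" for P
      using that qsetD(1)[OF X] by (auto simp: le_Pred carrier_Pred csubspace_iff)
    show "omeet (Pred X) P (ocompl (Pred X) P) \<sqsubseteq>\<^bsub>Pred X\<^esub> (\<lambda>A\<in>X. {\<zero>\<^bsub>A\<^esub>})" if P: "P \<in> carrier (Pred X)" for P
      unfolding omeet_Pred[OF P cC[OF P]] using cm[OF P] by (auto simp: le_Pred ocompl_Pred)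
    show "(\<lambda>A\<in>X. carrier A) \<sqsubseteq>\<^bsub>Pred X\<^esub> ojoin (Pred X) P (ocompl (Pred X) P)" if P: "P \<in> carrier (Pred X)" for P
      unfolding ojoin_Pred[OF P cC[OF P]] using cj[OF P] by (auto simp: le_Pred ocompl_Pred)
    show "P \<sqsubseteq>\<^bsub>Pred X\<^esub> (\<lambda>A\<in>X. carrier A)" if P: "P \<in> carrier (Pred X)" for P
      using sub[OF P] by (auto simp: le_Pred)
    show "ocompl (Pred X) Q \<sqsubseteq>\<^bsub>Pred X\<^esub> ocompl (Pred X) P" if "P \<sqsubseteq>\<^bsub>Pred X\<^esub> Q" for P Q
      using that by (auto simp: le_Pred ocompl_Pred orthcomp_def)
  qed (use jC jU jL cC botC topC Pred_antisym in \<open>auto simp: le_Pred omeet_Pred\<close>)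
qed

end

lemma pred_pullback_closed:
  assumes "qset X" "qset Y" "F \<in> qFun X Y" "P \<in> carrier (Pred Y)"
  shows "pred_pullback X Y F P \<in> carrier (Pred X)"
  using assms pred_pullback_csubspace[OF assms(1,2) qFun_qRel[OF assms(3)]]
  by (auto simp: carrier_Pred) (simp add: pred_pullback_def)

text \<open>All laws are read off from the description of inverse images by r x in P(B):
  intersections are immediate, complements come from \<open>pred_pullback_orthcomp\<close>, and for
  composites the condition on products s r extends to combinations since P(C) is a subspace.\<close>

lemma contravariant_functor_PredF: "contravariant_functor PredF"
proof -
  have hom: "pred_pullback X Y F \<in> ortho_hom (Pred Y) (Pred X)"
    if X: "qset X" and Y: "qset Y" and F: "F \<in> qFun X Y" for X Y :: "'v hilb set" and F
  proof (rule ortho_homI[OF ortholattice_Pred[OF Y] ortholattice_Pred[OF X] pred_pullback_closed[OF X Y F]])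
    interpret PY: ortholattice "Pred Y" by (rule ortholattice_Pred[OF Y])
    interpret PX: ortholattice "Pred X" by (rule ortholattice_Pred[OF X])
    note cl = pred_pullback_closed[OF X Y F]
    fix P assume P: "P \<in> carrier (Pred Y)"
    have PB: "csubspace B (P B)" if "B \<in> Y" for B using P that by (simp add: carrier_Pred)
    show "pred_pullback X Y F (ocompl (Pred Y) P) = ocompl (Pred X) (pred_pullback X Y F P)"
    proof (rule Pred_eqI[OF cl[OF PY.ocompl_closed[OF P]] PX.ocompl_closed[OF cl[OF P]]])
      fix A assume A: "A \<in> X"
      have "csubspace B (ocompl (Pred Y) P B)" if "B \<in> Y" for B
        using PY.ocompl_closed[OF P] that by (simp add: carrier_Pred)
      then show "pred_pullback X Y F (ocompl (Pred Y) P) A = ocompl (Pred X) (pred_pullback X Y F P) A"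
        using pred_pullback_eq[OF X Y F _ A] pred_pullback_orthcomp[OF X Y F PB A] A
        by (auto simp: ocompl_Pred)
    qed
    fix Q assume Q: "Q \<in> carrier (Pred Y)"
    show "pred_pullback X Y F (omeet (Pred Y) P Q) = omeet (Pred X) (pred_pullback X Y F P) (pred_pullback X Y F Q)"
    proof (rule Pred_eqI[OF cl[OF PY.omeet_closed[OF P Q]] PX.omeet_closed[OF cl[OF P] cl[OF Q]]])
      fix A assume A: "A \<in> X"
      have QB: "csubspace B (Q B)" if "B \<in> Y" for B using Q that by (simp add: carrier_Pred)
      have "csubspace B (omeet (Pred Y) P Q B)" if "B \<in> Y" for B
        using PY.omeet_closed[OF P Q] that by (simp add: carrier_Pred)
      then show "pred_pullback X Y F (omeet (Pred Y) P Q) A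
          = omeet (Pred X) (pred_pullback X Y F P) (pred_pullback X Y F Q) A"
        using pred_pullback_eq[OF X Y F _ A] PB QB A
        by (auto simp: omeet_Pred[OF Y P Q] omeet_Pred[OF X cl[OF P] cl[OF Q]])
    qed
  qed
  have idl: "pred_pullback X X (rel_id X) P = P" if X: "qset X" and P: "P \<in> carrier (Pred X)" for X :: "'v hilb set" and P
  proof (rule Pred_eqI[OF pred_pullback_closed[OF X X qFun_rel_id[OF X] P] P])
    fix A assume A: "A \<in> X"
    note [simp] = qsetD(1)[OF X A]
    have PA: "csubspace A (P A)" if "A \<in> X" for A using P that by (simp add: carrier_Pred)
    note PD = csubspaceD[OF PA fd_hilbert_cvs[OF qsetD(1)[OF X]]]
    have 1: "op_id A \<in> rel_id X (A, A)" using A by (auto simp: rel_id_def intro!: exI[of _ 1])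
    have 2: "r x \<in> P B" if x: "x \<in> P A" and B: "B \<in> X" and r: "r \<in> rel_id X (A, B)" for x B r
    proof (cases "A = B")
      case True
      then obtain c where "r = c \<odot>\<^bsub>lin_ops A A\<^esub> op_id A" using r A by (auto simp: rel_id_def)
      then show ?thesis using True PD(1,4)[OF A A x] by simp
    next
      case False
      then have "r = \<zero>\<^bsub>lin_ops A B\<^esub>" using r A B by (auto simp: rel_id_def)
      then show ?thesis using PD(2)[OF B B] PD(1)[OF A A x] by simp
    qed
    have "{x \<in> carrier A. \<forall>B\<in>X. \<forall>r\<in>rel_id X (A, B). r x \<in> P B} = P A" (is "?S = _")
    proof
      show "?S \<subseteq> P A"
      proof
        fix x assume x: "x \<in> ?S"
        then have "op_id A x \<in> P A" using 1 A by blast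
        then show "x \<in> P A" using x by simp
      qed
      show "P A \<subseteq> ?S" using 2 PD(1)[OF A A] by blast
    qed
    then show "pred_pullback X X (rel_id X) P A = P A"
      by (simp add: pred_pullback_eq[OF X X qFun_rel_id[OF X] PA A])
  qed
  have comp: "pred_pullback X Z (rel_comp X Y Z G F) P = pred_pullback X Y F (pred_pullback Y Z G P)"
    if X: "qset X" and Y: "qset Y" and Z: "qset Z" and F: "F \<in> qFun X Y" and G: "G \<in> qFun Y Z"
      and P: "P \<in> carrier (Pred Z)" for X Y Z :: "'v hilb set" and F G P
  proof (rule Pred_eqI)
    note GF = qFun_rel_comp[OF X Y Z F G]
    have GP: "pred_pullback Y Z G P \<in> carrier (Pred Y)" by (rule pred_pullback_closed[OF Y Z G P])
    show "pred_pullback X Z (rel_comp X Y Z G F) P \<in> carrier (Pred X)" by (rule pred_pullback_closed[OF X Z GF P])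
    show "pred_pullback X Y F (pred_pullback Y Z G P) \<in> carrier (Pred X)" by (rule pred_pullback_closed[OF X Y F GP])
    fix A assume A: "A \<in> X"
    note [simp] = qsetD(1)[OF X A]
    have PC: "csubspace C (P C)" if "C \<in> Z" for C using P that by (simp add: carrier_Pred)
    have GPB: "csubspace B (pred_pullback Y Z G P B)" if "B \<in> Y" for B using GP that by (simp add: carrier_Pred)
    note Fr = qFun_qRel[OF F] and Gr = qFun_qRel[OF G]
    have "(\<forall>C\<in>Z. \<forall>t\<in>rel_comp X Y Z G F (A, C). t x \<in> P C) \<longleftrightarrow> (\<forall>B\<in>Y. \<forall>r\<in>F (A, B). r x \<in> pred_pullback Y Z G P B)"
      if x: "x \<in> carrier A" for x
    proof
      assume h: "\<forall>C\<in>Z. \<forall>t\<in>rel_comp X Y Z G F (A, C). t x \<in> P C"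
      have "s (r x) \<in> P C" if "B \<in> Y" "r \<in> F (A, B)" "C \<in> Z" "s \<in> G (B, C)" for B r C s
        using bspec[OF bspec[OF h that(3)] rel_comp_base[OF X Y Z Fr Gr A that(3,1,4,2)]] x by simp
      moreover have "r x \<in> carrier B" if "B \<in> Y" "r \<in> F (A, B)" for B r using qRel_ops[OF Fr A that] x by simp
      ultimately show "\<forall>B\<in>Y. \<forall>r\<in>F (A, B). r x \<in> pred_pullback Y Z G P B"
        using pred_pullback_eq[OF Y Z G PC] by auto
    next
      assume h: "\<forall>B\<in>Y. \<forall>r\<in>F (A, B). r x \<in> pred_pullback Y Z G P B"
      show "\<forall>C\<in>Z. \<forall>t\<in>rel_comp X Y Z G F (A, C). t x \<in> P C"
      proof (intro ballI)
        fix C t assume C: "C \<in> Z" and t: "t \<in> rel_comp X Y Z G F (A, C)"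
        note PD = csubspaceD[OF PC[OF C] fd_hilbert_cvs[OF qsetD(1)[OF Z C]]]
        show "t x \<in> P C" using X Y Z Fr Gr A C t
        proof (induction rule: rel_comp_induct)
          case (base B s r)
          then have "r x \<in> pred_pullback Y Z G P B" using h by blast
          then have "s (r x) \<in> P C" using pred_pullback_eq[OF Y Z G PC base(1)] base C by auto
          then show ?case using x by simp
        qed (use PD x in simp_all)
      qed
    qed
    then show "pred_pullback X Z (rel_comp X Y Z G F) P A = pred_pullback X Y F (pred_pullback Y Z G P) A"
      using pred_pullback_eq[OF X Z GF _ A, of P] pred_pullback_eq[OF X Y F _ A, of "pred_pullback Y Z G P"] PC GPB
      by auto
  qed
  show ?thesis
    unfolding contravariant_functor_def PredF_def qfunctor.simps
    by (intro conjI allI impI ballI; (elim conjE)?) (assumption | rule ortholattice_Pred hom idl comp)+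
qed

lemma Pred_subset:
  assumes "qset X" "P \<in> carrier (Pred X)" "A \<in> X" shows "P A \<subseteq> carrier A"
proof -
  have "csubspace A (P A)" using assms by (simp add: carrier_Pred)
  then show ?thesis by (simp add: csubspace_iff[OF fd_hilbert_cvs[OF qsetD(1)[OF assms(1,3)]]])
qed

section \<open>Relations to the one-atom quantum set\<close>

lemma cplx_simps [simp]:
  "carrier cplx = UNIV" "x \<oplus>\<^bsub>cplx\<^esub> y = x + y" "\<zero>\<^bsub>cplx\<^esub> = 0" "x \<odot>\<^bsub>cplx\<^esub> y = x * y" "inner cplx x y = cnj x * y"
  by (simp_all add: cplx_def)

lemma qset_q_one: "qset q_one"
proof -
  have "(1 :: complex) \<notin> {0}" by simp
  then have "(UNIV :: complex set) \<noteq> {0}" by blast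
  then show ?thesis by (simp add: qset_def q_one_def)
qed

text \<open>The Riesz vector of the functional s; \<open>bra\<close> is the inverse correspondence.
  It is antilinear, but subspaces still correspond to subspaces.\<close>

definition ket :: "'v hilb \<Rightarrow> ('v \<Rightarrow> complex) \<Rightarrow> 'v" where
  "ket A s = op_adj A cplx s 1"

definition bra :: "'v hilb \<Rightarrow> 'v \<Rightarrow> 'v \<Rightarrow> complex" where
  "bra A z = (\<lambda>x\<in>carrier A. inner A z x)"

context
  fixes A :: "'v hilb"
  assumes A [simp]: "fd_hilbert A"
begin

lemma ket_closed [simp]: "s \<in> ops A cplx \<Longrightarrow> ket A s \<in> carrier A"
  by (simp add: ket_def)

lemma bra_ops [simp]: "z \<in> carrier A \<Longrightarrow> bra A z \<in> ops A cplx"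
  unfolding bra_def by (rule ops_restrictI) simp_all

lemma inner_ket: "s \<in> ops A cplx \<Longrightarrow> x \<in> carrier A \<Longrightarrow> inner A (ket A s) x = s x"
  using op_adj_inner_left[of A cplx s x 1] by (simp add: ket_def)

lemma ket_bra [simp]: "z \<in> carrier A \<Longrightarrow> ket A (bra A z) = z"
proof (rule hinner_ext[of A])
  fix y assume z: "z \<in> carrier A" and y: "y \<in> carrier A"
  have "inner A (ket A (bra A z)) y = inner A z y" using z y by (simp add: inner_ket) (simp add: bra_def)
  then show "inner A y (ket A (bra A z)) = inner A y z"
    using z y cnj_hinner[of A "ket A (bra A z)" y] cnj_hinner[of A z y] by simp
qed simp_all

lemma ket_inj: "s \<in> ops A cplx \<Longrightarrow> t \<in> ops A cplx \<Longrightarrow> ket A s = ket A t \<Longrightarrow> s = t"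
  using inner_ket by (intro ops_eqI[of s A cplx t]) metis+

lemma ket_antilin:
  "s \<in> ops A cplx \<Longrightarrow> t \<in> ops A cplx \<Longrightarrow> ket A (s \<oplus>\<^bsub>lin_ops A cplx\<^esub> t) = ket A s \<oplus>\<^bsub>A\<^esub> ket A t"
  "s \<in> ops A cplx \<Longrightarrow> ket A (c \<odot>\<^bsub>lin_ops A cplx\<^esub> s) = cnj c \<odot>\<^bsub>A\<^esub> ket A s"
  "ket A \<zero>\<^bsub>lin_ops A cplx\<^esub> = \<zero>\<^bsub>A\<^esub>"
  by (simp_all add: ket_def op_adj_add_apply op_adj_smult_apply op_adj_zero_apply)

lemma ket_preimage_csubspace:
  assumes W: "csubspace A W" shows "csubspace (lin_ops A cplx) {s \<in> ops A cplx. ket A s \<in> W}"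
  using csubspaceD[OF W fd_hilbert_cvs[OF A]] by (auto simp: csubspace_iff ket_antilin)

lemma ket_image_csubspace:
  assumes R: "csubspace (lin_ops A cplx) R" shows "csubspace A (ket A ` R)"
proof -
  note RD = csubspaceD[OF R cvs_lin_ops[OF A fd_hilbert_cplx]]
  have "ket A s \<oplus>\<^bsub>A\<^esub> ket A t \<in> ket A ` R" if "s \<in> R" "t \<in> R" for s t
    using ket_antilin(1)[of s t, symmetric] RD(1,3) that by auto
  moreover have "c \<odot>\<^bsub>A\<^esub> ket A s \<in> ket A ` R" if "s \<in> R" for c s
    using ket_antilin(2)[of s "cnj c", symmetric] RD(1,4) that by auto
  moreover have "\<zero>\<^bsub>A\<^esub> \<in> ket A ` R" using ket_antilin(3)[symmetric] RD(2) by auto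
  ultimately show ?thesis using RD(1) by (auto simp: csubspace_iff)
qed

end

text \<open>For a predicate P these are the functionals that vanish on the orthocomplement of P(A).
  Annihilators of P(A) would reverse the order.\<close>

definition Pred_to_Rel :: "'v hilb set \<Rightarrow> ('v hilb \<Rightarrow> 'v set) \<Rightarrow> ('v, complex) qrel" where
  "Pred_to_Rel X P = (\<lambda>(A, B)\<in>X \<times> q_one. {s \<in> ops A cplx. ket A s \<in> P A})"

lemma Pred_to_Rel_apply: "A \<in> X \<Longrightarrow> Pred_to_Rel X P (A, cplx) = {s \<in> ops A cplx. ket A s \<in> P A}"
  by (simp add: Pred_to_Rel_def q_one_def)

lemma qRel_q_one_eqI:
  assumes "R \<in> qRel X q_one" "S \<in> qRel X q_one" "\<And>A. A \<in> X \<Longrightarrow> R (A, cplx) = S (A, cplx)"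
  shows "R = S"
  using assms by (intro qRel_eqI[of R X q_one S]) (auto simp: q_one_def)

lemma Pred_to_Rel_qRel:
  assumes X: "qset X" and P: "P \<in> carrier (Pred X)"
  shows "Pred_to_Rel X P \<in> qRel X q_one"
  using P ket_preimage_csubspace[OF qsetD(1)[OF X]]
  by (auto simp: qRel_iff q_one_def Pred_to_Rel_apply carrier_Pred) (simp add: Pred_to_Rel_def q_one_def)

lemma bij_Pred_to_Rel:
  assumes X: "qset X" shows "bij_betw (Pred_to_Rel X) (carrier (Pred X)) (qRel X q_one)"
proof (rule bij_betwI[where g = "\<lambda>R. \<lambda>A\<in>X. ket A ` R (A, cplx)"])
  have one: "cplx \<in> q_one" by (simp add: q_one_def)
  show "Pred_to_Rel X \<in> carrier (Pred X) \<rightarrow> qRel X q_one" using Pred_to_Rel_qRel[OF X] by auto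
  have Rs: "csubspace (lin_ops A cplx) (R (A, cplx))" if "R \<in> qRel X q_one" "A \<in> X" for R A
    using that one by (auto intro: qRel_csubspace)
  have gC: "(\<lambda>A\<in>X. ket A ` R (A, cplx)) \<in> carrier (Pred X)" if "R \<in> qRel X q_one" for R
    using Rs[OF that] ket_image_csubspace[OF qsetD(1)[OF X]] by (auto simp: carrier_Pred)
  then show "(\<lambda>R. \<lambda>A\<in>X. ket A ` R (A, cplx)) \<in> qRel X q_one \<rightarrow> carrier (Pred X)" by auto
  show "(\<lambda>A\<in>X. ket A ` Pred_to_Rel X P (A, cplx)) = P" if P: "P \<in> carrier (Pred X)" for P
  proof (rule Pred_eqI[OF gC[OF Pred_to_Rel_qRel[OF X P]] P])
    fix A assume A: "A \<in> X"
    note [simp] = qsetD(1)[OF X A]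
    have sub: "P A \<subseteq> carrier A" by (rule Pred_subset[OF X P A])
    have "y \<in> ket A ` {s \<in> ops A cplx. ket A s \<in> P A}" if "y \<in> P A" for y
      using that sub by (intro image_eqI[of _ _ "bra A y"]) auto
    then show "(\<lambda>A\<in>X. ket A ` Pred_to_Rel X P (A, cplx)) A = P A"
      using A by (auto simp: Pred_to_Rel_apply)
  qed
  show "Pred_to_Rel X (\<lambda>A\<in>X. ket A ` R (A, cplx)) = R" if R: "R \<in> qRel X q_one" for R
  proof (rule qRel_q_one_eqI[OF Pred_to_Rel_qRel[OF X gC[OF R]] R])
    fix A assume A: "A \<in> X"
    note [simp] = qsetD(1)[OF X A]
    have "R (A, cplx) \<subseteq> ops A cplx" using qRel_ops[OF R A one] by blast
    then show "Pred_to_Rel X (\<lambda>A\<in>X. ket A ` R (A, cplx)) (A, cplx) = R (A, cplx)"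
      using A ket_inj[of A] by (auto simp: Pred_to_Rel_apply subset_iff)
  qed
qed

lemma Pred_to_Rel_le:
  assumes X: "qset X" and P: "P \<in> carrier (Pred X)"
  shows "rel_le X q_one (Pred_to_Rel X P) (Pred_to_Rel X Q) \<longleftrightarrow> P \<sqsubseteq>\<^bsub>Pred X\<^esub> Q"
proof -
  have "({s \<in> ops A cplx. ket A s \<in> P A} \<subseteq> {s \<in> ops A cplx. ket A s \<in> Q A}) \<longleftrightarrow> P A \<subseteq> Q A" if A: "A \<in> X" for A
  proof
    note [simp] = qsetD(1)[OF X A]
    assume h: "{s \<in> ops A cplx. ket A s \<in> P A} \<subseteq> {s \<in> ops A cplx. ket A s \<in> Q A}"
    show "P A \<subseteq> Q A"
    proof
      fix y assume y: "y \<in> P A"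
      then have "y \<in> carrier A" using Pred_subset[OF X P A] by blast
      then have "bra A y \<in> {s \<in> ops A cplx. ket A s \<in> P A}" using y by simp
      then have "ket A (bra A y) \<in> Q A" using h by blast
      then show "y \<in> Q A" using \<open>y \<in> carrier A\<close> by simp
    qed
  qed auto
  then show ?thesis by (simp add: rel_le_def le_Pred q_one_def Pred_to_Rel_apply)
qed

lemma Pred_to_Rel_ocompl:
  assumes X: "qset X" and P: "P \<in> carrier (Pred X)"
  shows "(\<lambda>(A, B)\<in>X \<times> q_one. orthcomp (dual A) (Pred_to_Rel X P (A, B))) = Pred_to_Rel X (ocompl (Pred X) P)"
proof (intro extensionalityI[of _ "X \<times> q_one"])
  fix AB assume "AB \<in> X \<times> q_one"
  then obtain A where A: "A \<in> X" and AB: "AB = (A, cplx)" by (auto simp: q_one_def)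
  note [simp] = qsetD(1)[OF X A]
  have PA: "P A \<subseteq> carrier A" by (rule Pred_subset[OF X P A])
  \<comment> \<open>The inner product of the dual swaps its arguments, since \<open>ket\<close> is
    antilinear; conjugation swaps them back and preserves orthogonality.\<close>
  have iff: "(\<forall>r\<in>{s \<in> ops A cplx. ket A s \<in> P A}. inner A (ket A s) (ket A r) = 0) \<longleftrightarrow> (\<forall>y\<in>P A. inner A y (ket A s) = 0)"
    if s: "s \<in> ops A cplx" for s
  proof
    assume h: "\<forall>r\<in>{s \<in> ops A cplx. ket A s \<in> P A}. inner A (ket A s) (ket A r) = 0"
    show "\<forall>y\<in>P A. inner A y (ket A s) = 0"
    proof
      fix y assume y: "y \<in> P A"
      then have yA: "y \<in> carrier A" using PA by blast
      then have "inner A (ket A s) (ket A (bra A y)) = 0" using bspec[OF h, of "bra A y"] y by simp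
      then show "inner A y (ket A s) = 0" using yA s cnj_hinner[of A "ket A s" y] by simp
    qed
  next
    assume h: "\<forall>y\<in>P A. inner A y (ket A s) = 0"
    show "\<forall>r\<in>{s \<in> ops A cplx. ket A s \<in> P A}. inner A (ket A s) (ket A r) = 0"
    proof
      fix r assume r: "r \<in> {s \<in> ops A cplx. ket A s \<in> P A}"
      then show "inner A (ket A s) (ket A r) = 0" using h s cnj_hinner[of A "ket A r" "ket A s"] by simp
    qed
  qed
  have "orthcomp (dual A) {s \<in> ops A cplx. ket A s \<in> P A} = {s \<in> ops A cplx.
      \<forall>r\<in>{s \<in> ops A cplx. ket A s \<in> P A}. inner A (ket A s) (ket A r) = 0}"
    unfolding orthcomp_def dual_def ket_def hilb.simps module.simps partial_object.simps by simp
  also have "\<dots> = {s \<in> ops A cplx. ket A s \<in> orthcomp A (P A)}"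
  proof (rule Collect_cong, rule conj_cong[OF HOL.refl])
    fix s assume s: "s \<in> ops A cplx"
    show "(\<forall>r\<in>{s \<in> ops A cplx. ket A s \<in> P A}. inner A (ket A s) (ket A r) = 0) \<longleftrightarrow> ket A s \<in> orthcomp A (P A)"
      unfolding iff[OF s] using s by (simp add: orthcomp_def)
  qed
  finally have "orthcomp (dual A) {s \<in> ops A cplx. ket A s \<in> P A} = {s \<in> ops A cplx. ket A s \<in> orthcomp A (P A)}" .
  then show "(\<lambda>(A, B)\<in>X \<times> q_one. orthcomp (dual A) (Pred_to_Rel X P (A, B))) AB = Pred_to_Rel X (ocompl (Pred X) P) AB"
    using A AB by (simp add: q_one_def Pred_to_Rel_apply[unfolded q_one_def] Pred_to_Rel_apply ocompl_Pred)
qed (auto simp: Pred_to_Rel_def)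

text \<open>The identity (s r)^dagger 1 = r^dagger (s^dagger 1) matches generators of the composite
  with generators of the inverse image; both are spans, compared through the antilinear bijection
  \<open>ket\<close>.\<close>

lemma Pred_to_Rel_pullback:
  assumes X: "qset X" and Y: "qset Y" and F: "F \<in> qFun X Y" and P: "P \<in> carrier (Pred Y)"
  shows "Pred_to_Rel X (pred_pullback X Y F P) = rel_comp X Y q_one (Pred_to_Rel Y P) F"
proof (rule qRel_q_one_eqI)
  note Fr = qFun_qRel[OF F] and one = qset_q_one
  have 1: "cplx \<in> q_one" by (simp add: q_one_def)
  have R: "Pred_to_Rel Y P \<in> qRel Y q_one" by (rule Pred_to_Rel_qRel[OF Y P])
  let ?K = "rel_comp X Y q_one (Pred_to_Rel Y P) F"
  show K: "?K \<in> qRel X q_one" by (rule rel_comp_qRel[OF X Y one Fr R])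
  have FP: "pred_pullback X Y F P \<in> carrier (Pred X)" by (rule pred_pullback_closed[OF X Y F P])
  show FPr: "Pred_to_Rel X (pred_pullback X Y F P) \<in> qRel X q_one" by (rule Pred_to_Rel_qRel[OF X FP])
  fix A assume A: "A \<in> X"
  note [simp] = qsetD(1)[OF X A]
  have PB: "P B \<subseteq> carrier B" if "B \<in> Y" for B by (rule Pred_subset[OF Y P that])
  let ?G = "{op_adj A B r y | B y r. B \<in> Y \<and> y \<in> P B \<and> r \<in> F (A, B)}"
  have G: "?G \<subseteq> carrier A" by (rule pred_pullback_generators[OF X Y Fr PB A])
  have FPA: "pred_pullback X Y F P A = cspan A ?G" using A by (simp add: pred_pullback_def)
  have ket_comp: "ket A (op_comp A s r) = op_adj A B r (ket B s)"
    if "B \<in> Y" "s \<in> ops B cplx" "r \<in> F (A, B)" for B s r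
    using that qsetD(1)[OF Y] qRel_ops[OF Fr A] by (simp add: ket_def op_adj_comp[of A B cplx])
  have "?K (A, cplx) \<subseteq> Pred_to_Rel X (pred_pullback X Y F P) (A, cplx)"
  proof (rule rel_comp_least[OF X Y one Fr R A 1 qRel_csubspace[OF FPr A 1]])
    fix B s r assume B: "B \<in> Y" and s: "s \<in> Pred_to_Rel Y P (B, cplx)" and r: "r \<in> F (A, B)"
    have s': "s \<in> ops B cplx" "ket B s \<in> P B" using s B by (auto simp: Pred_to_Rel_apply)
    have "op_adj A B r (ket B s) \<in> ?G" using B s' r by blast
    then have "ket A (op_comp A s r) \<in> cspan A ?G"
      using ket_comp[OF B s'(1) r] cspan_superset[OF _ G] by auto
    then show "op_comp A s r \<in> Pred_to_Rel X (pred_pullback X Y F P) (A, cplx)"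
      using op_comp_closed[OF qRel_ops[OF Fr A B r] s'(1)] A by (simp add: Pred_to_Rel_apply FPA)
  qed
  moreover have "t \<in> ?K (A, cplx)" if t: "t \<in> Pred_to_Rel X (pred_pullback X Y F P) (A, cplx)" for t
  proof -
    \<comment> \<open>A generator r^dagger y is the Riesz vector of the product of
      \<open>bra B y\<close> with r.\<close>
    have "?G \<subseteq> ket A ` ?K (A, cplx)"
    proof clarify
      fix B y r assume B: "B \<in> Y" and y: "y \<in> P B" and r: "r \<in> F (A, B)"
      have yB: "y \<in> carrier B" using y PB[OF B] by blast
      have b: "bra B y \<in> Pred_to_Rel Y P (B, cplx)" using yB y B qsetD(1)[OF Y B] by (simp add: Pred_to_Rel_apply)
      show "op_adj A B r y \<in> ket A ` ?K (A, cplx)"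
        using rel_comp_base[OF X Y one Fr R A 1 B b r] ket_comp[OF B _ r, of "bra B y"] yB qsetD(1)[OF Y B]
        by (intro image_eqI[of _ _ "op_comp A (bra B y) r"]) simp_all
    qed
    then have "cspan A ?G \<subseteq> ket A ` ?K (A, cplx)"
      using qRel_csubspace[OF K A 1] by (intro cspan_least ket_image_csubspace) simp_all
    then obtain u where u: "u \<in> ?K (A, cplx)" "ket A t = ket A u"
      using t A by (auto simp: Pred_to_Rel_apply FPA)
    have "t = u" using u t A qRel_ops[OF K A 1 u(1)] by (intro ket_inj[of A]) (auto simp: Pred_to_Rel_apply)
    then show ?thesis using u by simp
  qed
  ultimately show "Pred_to_Rel X (pred_pullback X Y F P) (A, cplx) = ?K (A, cplx)" by blast
qed

lemma RelF_natural_iso: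
  "contravariant_functor (RelF :: ('v, ('v, complex) qrel) qfunctor)"
  "naturally_isomorphic (PredF :: ('v, 'v hilb \<Rightarrow> 'v set) qfunctor) RelF"
proof -
  have tr: "ortholattice (Rel_one X)" "Pred_to_Rel X \<in> ortho_iso (Pred X) (Rel_one X)" if X: "qset X" for X :: "'v hilb set"
    unfolding Rel_one_def
    by (rule ortho_of_order_transport[OF ortholattice_Pred[OF X] bij_Pred_to_Rel[OF X]];
        rule Pred_to_Rel_le[OF X] Pred_to_Rel_ocompl[OF X]; assumption)+
  note T = contravariant_functor_transport[of "PredF :: ('v, 'v hilb \<Rightarrow> 'v set) qfunctor" RelF Pred_to_Rel,
      OF contravariant_functor_PredF]
  show "contravariant_functor (RelF :: ('v, ('v, complex) qrel) qfunctor)"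
    "naturally_isomorphic (PredF :: ('v, 'v hilb \<Rightarrow> 'v set) qfunctor) RelF"
    by (rule T; simp add: RelF_def PredF_def tr Pred_to_Rel_pullback)+
qed

section \<open>Projections\<close>

text \<open>The difference |x|^2 - |p x|^2 = |x - p x|^2 is nonnegative. The uniform bound puts
  every family of projections into \<open>ell_inf\<close>.\<close>

lemma is_proj_op_norm_le_1:
  assumes A [simp]: "fd_hilbert A" and p: "is_proj A p"
  shows "op_norm A p \<le> 1"
proof -
  note [simp] = ops_closed[OF is_projD(1)[OF p]]
  have "hnorm A (p x) \<le> 1" if x: "x \<in> carrier A" "hnorm A x \<le> 1" for x
  proof -
    have 1: "inner A (p x) (p x) = inner A x (p x)" "inner A (p x) x = inner A x (p x)"
      using is_projD(3)[OF p] is_projD(2)[OF p] x by simp_all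
    have "inner A (x \<ominus>\<^bsub>A\<^esub> p x) (x \<ominus>\<^bsub>A\<^esub> p x) = inner A x x - inner A (p x) (p x)"
      using x 1 by simp
    moreover have "0 \<le> Re (inner A (x \<ominus>\<^bsub>A\<^esub> p x) (x \<ominus>\<^bsub>A\<^esub> p x))" using x by (intro hinner_self_nonneg) simp_all
    ultimately have "Re (inner A (p x) (p x)) \<le> Re (inner A x x)" by simp
    then show ?thesis using x(2) unfolding hnorm_def by (meson order_trans real_sqrt_le_iff)
  qed
  moreover have "{x \<in> carrier A. hnorm A x \<le> 1} \<noteq> {}"
    by (auto intro!: exI[of _ "\<zero>\<^bsub>A\<^esub>"] simp: hnorm_def)
  ultimately show ?thesis unfolding op_norm_def by (intro cSUP_least) auto
qed

lemma carrier_Proj: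
  assumes X: "qset X"
  shows "p \<in> carrier (Proj X) \<longleftrightarrow> p \<in> extensional X \<and> (\<forall>A\<in>X. is_proj A (p A))"
proof
  assume p: "p \<in> carrier (Proj X)"
  then have ell: "p \<in> ell X" and m: "ell_mult X p p = p" and st: "ell_star X p = p"
    by (auto simp: Proj_def ell_inf_def)
  have "is_proj A (p A)" if A: "A \<in> X" for A
  proof -
    note [simp] = qsetD(1)[OF X A]
    have o: "p A \<in> ops A A" using ell A by (auto simp: ell_def)
    have "op_comp A (p A) (p A) = p A" using fun_cong[OF m, of A] A by (simp add: ell_mult_def)
    then have "p A (p A x) = p A x" if "x \<in> carrier A" for x
      using op_comp_apply[OF that, of "p A" "p A"] by simp
    moreover have "op_adj A A (p A) = p A" using fun_cong[OF st, of A] A by (simp add: ell_star_def)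
    then have "inner A (p A x) y = inner A x (p A y)" if "x \<in> carrier A" "y \<in> carrier A" for x y
      using op_adj_inner_right[OF _ _ o that] by simp
    ultimately show ?thesis using o by (simp add: is_proj_def)
  qed
  then show "p \<in> extensional X \<and> (\<forall>A\<in>X. is_proj A (p A))" using ell by (auto simp: ell_def PiE_iff)
next
  assume p: "p \<in> extensional X \<and> (\<forall>A\<in>X. is_proj A (p A))"
  then have pA: "is_proj A (p A)" if "A \<in> X" for A using that by blast
  have "ell_mult X p p = p"
  proof (rule extensionalityI[of _ X])
    fix A assume A: "A \<in> X"
    have "op_comp A (p A) (p A) = p A"
      using is_projD[OF pA[OF A]] op_comp_closed[OF is_projD(1)[OF pA[OF A]] is_projD(1)[OF pA[OF A]]] qsetD(1)[OF X A]
      by (intro ops_eqI[of _ A A]) simp_all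
    then show "ell_mult X p p A = p A" using A by (simp add: ell_mult_def)
  qed (use p in \<open>simp_all add: ell_mult_def\<close>)
  moreover have "ell_star X p = p"
  proof (rule extensionalityI[of _ X])
    fix A assume A: "A \<in> X"
    have "op_adj A A (p A) = p A"
      using is_projD[OF pA[OF A]] qsetD(1)[OF X A] by (intro op_adj_unique) simp_all
    then show "ell_star X p A = p A" using A by (simp add: ell_star_def)
  qed (use p in \<open>simp_all add: ell_star_def\<close>)
  moreover have "p \<in> ell_inf X"
    using p is_projD(1)[OF pA] is_proj_op_norm_le_1[OF qsetD(1)[OF X] pA]
    by (auto simp: ell_inf_def ell_def PiE_iff intro!: bdd_aboveI[of _ 1])
  ultimately show "p \<in> carrier (Proj X)" by (simp add: Proj_def)
qed

lemma Proj_ops: "qset X \<Longrightarrow> p \<in> carrier (Proj X) \<Longrightarrow> A \<in> X \<Longrightarrow> p A \<in> ops A A"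
  by (simp add: carrier_Proj is_projD(1))

definition Pred_to_Proj :: "'v hilb set \<Rightarrow> ('v hilb \<Rightarrow> 'v set) \<Rightarrow> 'v hilb \<Rightarrow> 'v \<Rightarrow> 'v" where
  "Pred_to_Proj X P = (\<lambda>A\<in>X. proj A (P A))"

lemma Pred_to_Proj_closed: "qset X \<Longrightarrow> P \<in> carrier (Pred X) \<Longrightarrow> Pred_to_Proj X P \<in> carrier (Proj X)"
  by (auto simp: carrier_Proj carrier_Pred Pred_to_Proj_def qsetD intro: is_proj_proj)

lemma bij_Pred_to_Proj:
  assumes X: "qset X" shows "bij_betw (Pred_to_Proj X) (carrier (Pred X)) (carrier (Proj X))"
proof (rule bij_betwI[where g = "\<lambda>p. \<lambda>A\<in>X. fixed A (p A)"])
  have gC: "(\<lambda>A\<in>X. fixed A (p A)) \<in> carrier (Pred X)" if "p \<in> carrier (Proj X)" for p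
    using that qsetD(1)[OF X] Proj_ops[OF X that] by (auto simp: carrier_Pred intro: csubspace_fixed)
  then show "(\<lambda>p. \<lambda>A\<in>X. fixed A (p A)) \<in> carrier (Proj X) \<rightarrow> carrier (Pred X)" by auto
  show "Pred_to_Proj X \<in> carrier (Pred X) \<rightarrow> carrier (Proj X)" using Pred_to_Proj_closed[OF X] by auto
  show "(\<lambda>A\<in>X. fixed A (Pred_to_Proj X P A)) = P" if P: "P \<in> carrier (Pred X)" for P
    using gC[OF Pred_to_Proj_closed[OF X P]] P qsetD(1)[OF X]
    by (intro Pred_eqI) (auto simp: Pred_to_Proj_def carrier_Pred fixed_proj)
  show "Pred_to_Proj X (\<lambda>A\<in>X. fixed A (p A)) = p" if p: "p \<in> carrier (Proj X)" for p
    using p qsetD(1)[OF X]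
    by (intro extensionalityI[of _ X]) (auto simp: Pred_to_Proj_def carrier_Proj[OF X] proj_fixed)
qed

text \<open>Taking adjoints turns p q = p into q p = p, which says that q fixes the range of
  p.\<close>

lemma is_proj_le_iff:
  assumes A [simp]: "fd_hilbert A" and p: "is_proj A p" and q: "is_proj A q"
  shows "op_comp A p q = p \<longleftrightarrow> fixed A p \<subseteq> fixed A q"
proof
  note [simp] = ops_closed[OF is_projD(1)[OF p]] ops_closed[OF is_projD(1)[OF q]]
  assume eq: "op_comp A p q = p"
  have pq: "p (q x) = p x" if "x \<in> carrier A" for x using op_comp_apply[OF that, of p q] eq by simp
  have "q (p x) = p x" if x: "x \<in> carrier A" for x
  proof (rule hinner_ext[of A])
    fix z assume z: "z \<in> carrier A"
    have "inner A z (q (p x)) = inner A (p (q z)) x"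
      using is_projD(3)[OF q] is_projD(3)[OF p] x z by simp
    then show "inner A z (q (p x)) = inner A z (p x)" using pq[OF z] is_projD(3)[OF p z x] by simp
  qed (use x in simp_all)
  then show "fixed A p \<subseteq> fixed A q" unfolding fixed_def by force
next
  note [simp] = ops_closed[OF is_projD(1)[OF p]] ops_closed[OF is_projD(1)[OF q]]
  assume le: "fixed A p \<subseteq> fixed A q"
  have qp: "q (p x) = p x" if "x \<in> carrier A" for x
  proof -
    have "p x \<in> fixed A p" using that is_projD(2)[OF p] by (simp add: fixed_def)
    then show ?thesis using le by (auto simp: fixed_def)
  qed
  have "p (q x) = p x" if x: "x \<in> carrier A" for x
  proof (rule hinner_ext[of A])
    fix z assume z: "z \<in> carrier A"
    have "inner A z (p (q x)) = inner A (q (p z)) x"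
      using is_projD(3)[OF q] is_projD(3)[OF p] x z by simp
    then show "inner A z (p (q x)) = inner A z (p x)" using qp[OF z] is_projD(3)[OF p z x] by simp
  qed (use x in simp_all)
  then show "op_comp A p q = p"
    using op_comp_closed[OF is_projD(1)[OF q] is_projD(1)[OF p] A] is_projD(1)[OF p]
    by (intro ops_eqI[of _ A A]) simp_all
qed

lemma Pred_to_Proj_le:
  assumes X: "qset X" and P: "P \<in> carrier (Pred X)" and Q: "Q \<in> carrier (Pred X)"
  shows "ell_mult X (Pred_to_Proj X P) (Pred_to_Proj X Q) = Pred_to_Proj X P \<longleftrightarrow> P \<sqsubseteq>\<^bsub>Pred X\<^esub> Q"
proof -
  have "op_comp A (proj A (P A)) (proj A (Q A)) = proj A (P A) \<longleftrightarrow> P A \<subseteq> Q A" if A: "A \<in> X" for A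
    using is_proj_le_iff[of A "proj A (P A)" "proj A (Q A)"] P Q A qsetD(1)[OF X A]
    by (simp add: carrier_Pred is_proj_proj fixed_proj)
  moreover have "ell_mult X (Pred_to_Proj X P) (Pred_to_Proj X Q) = Pred_to_Proj X P
      \<longleftrightarrow> (\<forall>A\<in>X. op_comp A (proj A (P A)) (proj A (Q A)) = proj A (P A))"
    unfolding ell_mult_def Pred_to_Proj_def by (auto simp: fun_eq_iff restrict_def)
  ultimately show ?thesis by (simp add: le_Pred)
qed

lemma Pred_to_Proj_ocompl:
  assumes X: "qset X" and P: "P \<in> carrier (Pred X)"
  shows "ell_compl X (Pred_to_Proj X P) = Pred_to_Proj X (ocompl (Pred X) P)"
proof (rule extensionalityI[of _ X])
  fix A assume A: "A \<in> X"
  note [simp] = qsetD(1)[OF X A]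
  have W: "csubspace A (P A)" using P A by (simp add: carrier_Pred)
  let ?p = "proj A (P A)"
  have p: "is_proj A ?p" by (rule is_proj_proj[OF _ W]) simp
  have "op_id A \<ominus>\<^bsub>lin_ops A A\<^esub> ?p = proj A (orthcomp A (P A))"
    using proj_fixed[OF _ is_proj_compl(1)[OF _ p]] is_proj_compl(2)[OF _ p] fixed_proj[OF _ W] by simp
  then show "ell_compl X (Pred_to_Proj X P) A = Pred_to_Proj X (ocompl (Pred X) P) A"
    using A by (simp add: ell_compl_def Pred_to_Proj_def ocompl_Pred)
qed (simp_all add: ell_compl_def Pred_to_Proj_def)

text \<open>Split x into w in F^star(P)(A) and a remainder in its orthocomplement. Then r w lies in
  P(B) and r maps the remainder into the orthocomplement of P(B), so r w is the projection of r x.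
  This is the intertwining law that characterises \<open>fun_star\<close>.\<close>

lemma Pred_to_Proj_pullback:
  assumes X: "qset X" and Y: "qset Y" and F: "F \<in> qFun X Y" and P: "P \<in> carrier (Pred Y)"
  shows "Pred_to_Proj X (pred_pullback X Y F P) = fun_star X Y F (Pred_to_Proj Y P)"
proof (rule fun_star_eqI[OF X Y F, symmetric])
  have PB: "csubspace B (P B)" if "B \<in> Y" for B using P that by (simp add: carrier_Pred)
  note FP = pred_pullback_closed[OF X Y F P]
  show "Pred_to_Proj Y P B \<in> ops B B" if "B \<in> Y" for B by (rule Proj_ops[OF Y Pred_to_Proj_closed[OF Y P] that])
  show "Pred_to_Proj X (pred_pullback X Y F P) A \<in> ops A A" if "A \<in> X" for A
    by (rule Proj_ops[OF X Pred_to_Proj_closed[OF X FP] that])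
  show "Pred_to_Proj X (pred_pullback X Y F P) \<in> extensional X" by (simp add: Pred_to_Proj_def)
  fix A B r x assume A: "A \<in> X" and B: "B \<in> Y" and r: "r \<in> F (A, B)" and x: "x \<in> carrier A"
  note [simp] = qsetD(1)[OF X A] qsetD(1)[OF Y B]
  let ?W = "pred_pullback X Y F P A"
  have W: "csubspace A ?W" using FP A by (simp add: carrier_Pred)
  have ro: "r \<in> ops A B" by (rule qRel_ops[OF qFun_qRel[OF F] A B r])
  have W_eq: "?W = {x \<in> carrier A. \<forall>B\<in>Y. \<forall>r\<in>F (A, B). r x \<in> P B}"
    and Wo_eq: "orthcomp A ?W = {x \<in> carrier A. \<forall>B\<in>Y. \<forall>r\<in>F (A, B). r x \<in> orthcomp B (P B)}"
    using pred_pullback_eq[OF X Y F _ A, of P] pred_pullback_orthcomp[OF X Y F _ A, of P] PB by auto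
  let ?w = "proj A ?W x"
  have wA: "?w \<in> carrier A" using proj_carrier[OF _ W x] by simp
  have w: "r ?w \<in> P B" using proj_spec(1)[OF _ W x] W_eq B r by auto
  have "r (x \<ominus>\<^bsub>A\<^esub> ?w) \<in> orthcomp B (P B)" using minus_proj_orth[OF _ W x] Wo_eq B r by auto
  then have "inner B u (r ?w) = inner B u (r x)" if "u \<in> P B" for u
    using that ro x wA csubspaceD(1)[OF PB[OF B] _ that] by (auto simp: orthcomp_def)
  then have "proj B (P B) (r x) = r ?w"
    using ro x w by (intro proj_eqI[OF _ PB[OF B]]) simp_all
  then show "r (Pred_to_Proj X (pred_pullback X Y F P) A x) = Pred_to_Proj Y P B (r x)"
    using A B by (simp add: Pred_to_Proj_def)
qed

lemma ortholattice_Proj: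
  assumes X: "qset X"
  shows "ortholattice (Proj X)" "Pred_to_Proj X \<in> ortho_iso (Pred X) (Proj X)"
proof -
  have "carrier (Proj X) = {p \<in> ell_inf X. ell_mult X p p = p \<and> ell_star X p = p}" by (simp add: Proj_def)
  then have b: "bij_betw (Pred_to_Proj X) (carrier (Pred X)) {p \<in> ell_inf X. ell_mult X p p = p \<and> ell_star X p = p}"
    using bij_Pred_to_Proj[OF X] by simp
  show "ortholattice (Proj X)" "Pred_to_Proj X \<in> ortho_iso (Pred X) (Proj X)"
    unfolding Proj_def
    by (rule ortho_of_order_transport[OF ortholattice_Pred[OF X] b];
        rule Pred_to_Proj_le[OF X] Pred_to_Proj_ocompl[OF X]; assumption)+
qed

text \<open>Idempotence and self-adjointness are inherited from the predicate that corresponds to p.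
  The types of X and Y may differ, so functions to \<open>q_bool\<close> are covered.\<close>

lemma fun_star_Proj:
  assumes X: "qset X" and Y: "qset Y" and F: "F \<in> qFun X Y" and p: "p \<in> carrier (Proj Y)"
  shows "fun_star X Y F p \<in> carrier (Proj X)"
proof -
  obtain P where P: "P \<in> carrier (Pred Y)" "p = Pred_to_Proj Y P"
    using bij_Pred_to_Proj[OF Y] p by (auto simp: bij_betw_def)
  then show ?thesis
    using Pred_to_Proj_pullback[OF X Y F P(1)] Pred_to_Proj_closed[OF X pred_pullback_closed[OF X Y F P(1)]] by simp
qed

lemma ProjF_natural_iso:
  "contravariant_functor (ProjF :: ('v, 'v hilb \<Rightarrow> 'v \<Rightarrow> 'v) qfunctor)"
  "naturally_isomorphic (PredF :: ('v, 'v hilb \<Rightarrow> 'v set) qfunctor) ProjF"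
proof -
  note T = contravariant_functor_transport[of "PredF :: ('v, 'v hilb \<Rightarrow> 'v set) qfunctor" ProjF Pred_to_Proj,
      OF contravariant_functor_PredF]
  show "contravariant_functor (ProjF :: ('v, 'v hilb \<Rightarrow> 'v \<Rightarrow> 'v) qfunctor)"
    "naturally_isomorphic (PredF :: ('v, 'v hilb \<Rightarrow> 'v set) qfunctor) ProjF"
    by (rule T; simp add: ProjF_def PredF_def ortholattice_Proj Pred_to_Proj_pullback)+
qed

section \<open>Relations of intertwiners\<close>

text \<open>The index type is \<open>unit\<close> for a single projection, which gives functions to
  \<open>q_bool\<close>, and \<open>bool\<close> for a pair, which gives functions to the
  product.\<close>

definition intertwiners :: "'v hilb set \<Rightarrow> 'w hilb set \<Rightarrow> ('i \<Rightarrow> 'v hilb \<Rightarrow> 'v \<Rightarrow> 'v)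
    \<Rightarrow> ('i \<Rightarrow> 'w hilb \<Rightarrow> 'w \<Rightarrow> 'w) \<Rightarrow> ('v, 'w) qrel" where
  "intertwiners X Y a b = (\<lambda>(A, B)\<in>X \<times> Y. {r \<in> ops A B. \<forall>i. \<forall>x\<in>carrier A. r (a i A x) = b i B (r x)})"

lemma intertwiners_apply:
  "A \<in> X \<Longrightarrow> B \<in> Y \<Longrightarrow> intertwiners X Y a b (A, B) = {r \<in> ops A B. \<forall>i. \<forall>x\<in>carrier A. r (a i A x) = b i B (r x)}"
  by (simp add: intertwiners_def)

text \<open>Taking adjoints of r p = q r, with p and q self-adjoint, gives r^dagger q = p
  r^dagger.\<close>

lemma adj_intertwines:
  assumes A: "fd_hilbert A" and B: "fd_hilbert B" and p: "is_proj A p" and q: "is_proj B q" and r: "r \<in> ops A B"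
    and eq: "\<And>x. x \<in> carrier A \<Longrightarrow> r (p x) = q (r x)" and y: "y \<in> carrier B"
  shows "op_adj A B r (q y) = p (op_adj A B r y)"
proof (rule hinner_ext[OF A])
  note [simp] = A B r ops_closed[OF r] ops_closed[OF is_projD(1)[OF p]] ops_closed[OF is_projD(1)[OF q]]
  show "op_adj A B r (q y) \<in> carrier A" "p (op_adj A B r y) \<in> carrier A" using y by simp_all
  fix x assume x: "x \<in> carrier A"
  have "inner A x (op_adj A B r (q y)) = inner B (r (p x)) y"
    using x y is_projD(3)[OF q, of "r x" y] eq[OF x] by simp
  also have "\<dots> = inner A x (p (op_adj A B r y))"
    using x y is_projD(3)[OF p, of x "op_adj A B r y"] op_adj_inner_right[OF A B r, of "p x" y] by simp
  finally show "inner A x (op_adj A B r (q y)) = inner A x (p (op_adj A B r y))" .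
qed

context
  fixes X :: "'v hilb set" and Y :: "'w hilb set"
    and a :: "'i \<Rightarrow> 'v hilb \<Rightarrow> 'v \<Rightarrow> 'v" and b :: "'i \<Rightarrow> 'w hilb \<Rightarrow> 'w \<Rightarrow> 'w"
  assumes X: "qset X" and Y: "qset Y"
    and a: "\<And>i. a i \<in> carrier (Proj X)" and b: "\<And>i. b i \<in> carrier (Proj Y)"
begin

lemma a_proj: "A \<in> X \<Longrightarrow> is_proj A (a i A)" and b_proj: "B \<in> Y \<Longrightarrow> is_proj B (b i B)"
  using a b carrier_Proj X Y by blast+

lemma intertwiners_qRel: "intertwiners X Y a b \<in> qRel X Y"
proof -
  have "csubspace (lin_ops A B) (intertwiners X Y a b (A, B))" if A: "A \<in> X" and B: "B \<in> Y" for A B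
  proof -
    note [simp] = qsetD(1)[OF X A] qsetD(1)[OF Y B]
      ops_closed[OF is_projD(1)[OF a_proj[OF A]]] is_projD(1)[OF b_proj[OF B]]
    have b0: "b i B \<zero>\<^bsub>B\<^esub> = \<zero>\<^bsub>B\<^esub>" for i by (rule ops_zero[of _ B]) simp_all
    have ba: "b i B (x \<oplus>\<^bsub>B\<^esub> y) = b i B x \<oplus>\<^bsub>B\<^esub> b i B y" if "x \<in> carrier B" "y \<in> carrier B" for i x y
      by (rule ops_add[of _ B]) (simp_all add: that)
    have bs: "b i B (c \<odot>\<^bsub>B\<^esub> x) = c \<odot>\<^bsub>B\<^esub> b i B x" if "x \<in> carrier B" for i c x
      by (rule ops_smult[of _ B]) (simp_all add: that)
    show ?thesis
      using A B by (auto simp: csubspace_iff intertwiners_apply b0 ba bs)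
  qed
  then show ?thesis by (auto simp: qRel_iff intertwiners_def extensional_def)
qed

text \<open>If r and s intertwine, so does s r^dagger, between the families on the atoms of Y.
  Functionality thus reduces to a Schur property of Y; totality is proved separately for each choice
  of Y.\<close>

lemma intertwiners_qFun:
  assumes schur: "\<And>B B' t. B \<in> Y \<Longrightarrow> B' \<in> Y \<Longrightarrow> t \<in> ops B B' \<Longrightarrow>
      (\<And>i y. y \<in> carrier B \<Longrightarrow> t (b i B y) = b i B' (t y)) \<Longrightarrow> t \<in> rel_id Y (B, B')"
    and tot: "qtotal X Y (intertwiners X Y a b)"
  shows "intertwiners X Y a b \<in> qFun X Y"
proof -
  have "qfunctional X Y (intertwiners X Y a b)"
  proof (rule qfunctionalI[OF X Y intertwiners_qRel], rule schur)
    fix A B B' r s i y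
    assume A: "A \<in> X" and B: "B \<in> Y" and B': "B' \<in> Y"
      and r: "r \<in> intertwiners X Y a b (A, B)" and s: "s \<in> intertwiners X Y a b (A, B')"
    note [simp] = qsetD(1)[OF X A] qsetD(1)[OF Y B] qsetD(1)[OF Y B']
    have ro: "r \<in> ops A B" and re: "\<And>i x. x \<in> carrier A \<Longrightarrow> r (a i A x) = b i B (r x)"
      and so: "s \<in> ops A B'" and se: "\<And>i x. x \<in> carrier A \<Longrightarrow> s (a i A x) = b i B' (s x)"
      using r s A B B' by (simp_all add: intertwiners_apply)
    show "op_comp B s (op_adj A B r) \<in> ops B B'"
      by (rule op_comp_closed[OF op_adj_closed so]) (simp_all add: ro)
    assume y: "y \<in> carrier B"
    have "b i B y \<in> carrier B" by (rule ops_closed[OF is_projD(1)[OF b_proj[OF B]] y])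
    moreover have "op_adj A B r (b i B y) = a i A (op_adj A B r y)"
      using adj_intertwines[of A B "a i A" "b i B" r y] a_proj[OF A] b_proj[OF B] ro re y by simp
    ultimately show "op_comp B s (op_adj A B r) (b i B y) = b i B' (op_comp B s (op_adj A B r) y)"
      using y ro se by simp
  qed
  then show ?thesis using qFun_iff[OF X Y] intertwiners_qRel tot by blast
qed

lemma fun_star_intertwiners:
  assumes F: "intertwiners X Y a b \<in> qFun X Y"
  shows "fun_star X Y (intertwiners X Y a b) (b i) = a i"
  using a[of i] Proj_ops[OF X a] Proj_ops[OF Y b] carrier_Proj[OF X]
  by (intro fun_star_eqI[OF X Y F]) (auto simp: intertwiners_apply)

text \<open>By the intertwining law, G lies below the relation of all intertwiners, and one function
  below another equals it. With \<open>fun_star_intertwiners\<close> this sets up a bijection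
  between families a and functions.\<close>

lemma eq_intertwiners:
  assumes F: "intertwiners X Y a b \<in> qFun X Y" and G: "G \<in> qFun X Y" and eq: "\<And>i. fun_star X Y G (b i) = a i"
  shows "G = intertwiners X Y a b"
proof (rule qFun_le_imp_eq[OF X Y G F])
  have Gr: "G \<in> qRel X Y" and fn: "qfunctional X Y G" using G qFun_iff[OF X Y] by auto
  fix A B assume A: "A \<in> X" and B: "B \<in> Y"
  show "G (A, B) \<subseteq> intertwiners X Y a b (A, B)"
  proof
    fix r assume r: "r \<in> G (A, B)"
    have "r (a i A x) = b i B (r x)" if "x \<in> carrier A" for i x
      using fun_star_intertwines[OF X Y Gr fn Proj_ops[OF Y b[of i]] A B r that] eq[of i] by simp
    then show "r \<in> intertwiners X Y a b (A, B)"
      using qRel_ops[OF Gr A B r] A B by (simp add: intertwiners_apply)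
  qed
qed

end

section \<open>Functions to the two-element quantum set\<close>

lemma is_proj_op_id: "fd_hilbert A \<Longrightarrow> is_proj A (op_id A)"
  by (simp add: is_proj_def)

lemma is_proj_zero: "fd_hilbert A \<Longrightarrow> is_proj A \<zero>\<^bsub>lin_ops A A\<^esub>"
  using csubspaceD(2)[OF csubspace_carrier, of "lin_ops A A"] by (simp add: is_proj_def)

lemma q_bool_eq: "q_bool = {ell2 {0}, ell2 {1}}"
  by (auto simp: q_bool_def)

text \<open>The spaces are isomorphic but differ as records: at 0 an extensional function on {1} has
  the value \<open>undefined\<close>, while functions on {0} take all values there.\<close>

lemma ell2_neq: "ell2 {0 :: nat} \<noteq> ell2 {1}"
proof
  assume "ell2 {0 :: nat} = ell2 {1}"
  then have eq: "carrier (ell2 {0 :: nat}) = carrier (ell2 {1})" by simp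
  have "(\<lambda>i\<in>{0 :: nat}. c :: complex) \<in> carrier (ell2 {1})" for c
    unfolding eq[symmetric] by (simp add: ell2_def)
  then have "c = (undefined :: complex)" for c
    using extensional_arb[of "\<lambda>i\<in>{0}. c" "{1 :: nat}" 0] by (simp add: ell2_def)
  from this[of 0] this[of 1] show False by simp
qed

definition ell2_unit :: "'i \<Rightarrow> 'i \<Rightarrow> complex" where
  "ell2_unit k = (\<lambda>i\<in>{k}. 1)"

lemma ell2_unit_carrier: "ell2_unit k \<in> carrier (ell2 {k})"
  by (simp add: ell2_def ell2_unit_def)

lemma ell2_eq_smult_unit:
  assumes "f \<in> carrier (ell2 {k})" shows "f = f k \<odot>\<^bsub>ell2 {k}\<^esub> ell2_unit k"
  using assms by (intro extensionalityI[of f "{k}"]) (auto simp: ell2_def ell2_unit_def)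

lemma ell2_unit_nonzero: "ell2_unit k \<noteq> \<zero>\<^bsub>ell2 {k}\<^esub>"
proof
  assume "ell2_unit k = \<zero>\<^bsub>ell2 {k}\<^esub>"
  from fun_cong[OF this, of k] show False by (simp add: ell2_def ell2_unit_def)
qed

lemma ell2_smult_unit_eq_0:
  assumes "c \<odot>\<^bsub>ell2 {k}\<^esub> ell2_unit k = \<zero>\<^bsub>ell2 {k}\<^esub>" shows "c = 0"
  using fun_cong[OF assms, of k] by (simp add: ell2_def ell2_unit_def)

lemma qset_q_bool: "qset q_bool"
proof -
  have "carrier (ell2 {k}) \<noteq> {\<zero>\<^bsub>ell2 {k}\<^esub>}" for k :: nat
    using ell2_unit_carrier[of k] ell2_unit_nonzero[of k] by blast
  then show ?thesis by (simp add: qset_def q_bool_eq)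
qed

lemma q_true_simps:
  "q_true (ell2 {1}) = op_id (ell2 {1})" "q_true (ell2 {0}) = \<zero>\<^bsub>lin_ops (ell2 {0}) (ell2 {0})\<^esub>"
  using ell2_neq by (simp_all add: q_true_def q_bool_eq)

lemma q_true_Proj: "q_true \<in> carrier (Proj q_bool)"
proof -
  have "q_true \<in> extensional q_bool" by (simp add: q_true_def)
  moreover have "is_proj A (q_true A)" if A: "A \<in> q_bool" for A
  proof -
    consider "A = ell2 {0}" | "A = ell2 {1}" using A by (auto simp: q_bool_eq)
    then show ?thesis by cases (simp_all only: q_true_simps is_proj_op_id is_proj_zero fd_hilbert_ell2)
  qed
  ultimately show ?thesis using carrier_Proj[OF qset_q_bool] by blast
qed

text \<open>Atoms are lines, so an endomorphism is a scalar. Between different atoms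
  \<open>q_true\<close> is the identity on one side and zero on the other, which forces t =
  0.\<close>

lemma q_bool_schur:
  assumes B: "B \<in> q_bool" and B': "B' \<in> q_bool" and t: "t \<in> ops B B'"
    and eq: "\<And>y. y \<in> carrier B \<Longrightarrow> t (q_true B y) = q_true B' (t y)"
  shows "t \<in> rel_id q_bool (B, B')"
proof -
  note fd = qsetD(1)[OF qset_q_bool B] qsetD(1)[OF qset_q_bool B']
  obtain k l where k: "B = ell2 {k}" and l: "B' = ell2 {l}" and kl: "k \<in> {0, 1}" "l \<in> {0, 1}"
    using B B' by (auto simp: q_bool_eq)
  show ?thesis
  proof (cases "B = B'")
    case True
    define c where "c = t (ell2_unit k) k"
    have tu: "t (ell2_unit k) = c \<odot>\<^bsub>B\<^esub> ell2_unit k"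
      using ell2_eq_smult_unit[of "t (ell2_unit k)" k] ops_closed[OF t, of "ell2_unit k"] ell2_unit_carrier[of k] k True
      by (simp add: c_def)
    have "t y = c \<odot>\<^bsub>B\<^esub> y" if y: "y \<in> carrier B" for y
    proof -
      have yk: "y = y k \<odot>\<^bsub>B\<^esub> ell2_unit k" using ell2_eq_smult_unit[of y k] y k by simp
      have u: "ell2_unit k \<in> carrier B" using ell2_unit_carrier[of k] k by simp
      have "t (y k \<odot>\<^bsub>B\<^esub> ell2_unit k) = y k \<odot>\<^bsub>B\<^esub> (c \<odot>\<^bsub>B\<^esub> ell2_unit k)"
        using ops_smult[OF t u] tu True by simp
      also have "\<dots> = c \<odot>\<^bsub>B\<^esub> (y k \<odot>\<^bsub>B\<^esub> ell2_unit k)"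
        using u fd by (simp add: mult.commute)
      finally show ?thesis using yk by metis
    qed
    then have "t = c \<odot>\<^bsub>lin_ops B B\<^esub> op_id B"
      using t True fd csubspaceD(4)[OF csubspace_carrier, of "lin_ops B B" "op_id B" c]
      by (intro ops_eqI[of _ B B]) simp_all
    then show ?thesis using B True by (auto simp: rel_id_def)
  next
    case False
    have u: "ell2_unit k \<in> carrier B" using ell2_unit_carrier[of k] k by simp
    have 0: "t (ell2_unit k) = \<zero>\<^bsub>B'\<^esub>"
    proof -
      consider "k = 0" "l = 1" | "k = 1" "l = 0" using kl False k l by auto
      then show ?thesis
      proof cases
        case 1
        then show ?thesis using eq[OF u] ops_closed[OF t u] ops_zero[OF t fd] u q_true_simps k l by simp
      next
        case 2
        then show ?thesis using eq[OF u] ops_closed[OF t u] u q_true_simps k l by simp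
      qed
    qed
    have "t y = \<zero>\<^bsub>B'\<^esub>" if y: "y \<in> carrier B" for y
    proof -
      have yk: "y = y k \<odot>\<^bsub>B\<^esub> ell2_unit k" using ell2_eq_smult_unit[of y k] y k by simp
      have "t (y k \<odot>\<^bsub>B\<^esub> ell2_unit k) = \<zero>\<^bsub>B'\<^esub>" using ops_smult[OF t u] 0 fd by simp
      then show ?thesis using yk by metis
    qed
    then have "t = \<zero>\<^bsub>lin_ops B B'\<^esub>"
      using t fd csubspaceD(2)[OF csubspace_carrier, of "lin_ops B B'"] by (intro ops_eqI[of _ B B']) simp_all
    then show ?thesis using B B' False by (simp add: rel_id_def)
  qed
qed

lemma bra_vector_ops:
  assumes "fd_hilbert A" "fd_hilbert B" "z \<in> carrier A" "u \<in> carrier B"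
  shows "(\<lambda>x\<in>carrier A. inner A z x \<odot>\<^bsub>B\<^esub> u) \<in> ops A B"
  using assms by (intro ops_restrictI) (simp_all add: cvs_distrib)

text \<open>At \<open>ell2 {1}\<close> these are the r with r p = r, at \<open>ell2 {0}\<close>
  those with r p = 0.\<close>

definition Proj_to_Fun :: "'v hilb set \<Rightarrow> ('v hilb \<Rightarrow> 'v \<Rightarrow> 'v) \<Rightarrow> ('v, nat \<Rightarrow> complex) qrel" where
  "Proj_to_Fun X p = intertwiners X q_bool (\<lambda>_ :: unit. p) (\<lambda>_. q_true)"

context
  fixes X :: "'v hilb set"
  assumes X: "qset X"
begin

lemma Proj_to_Fun_qFun:
  assumes p: "p \<in> carrier (Proj X)"
  shows "Proj_to_Fun X p \<in> qFun X q_bool"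
  unfolding Proj_to_Fun_def
proof (rule intertwiners_qFun[OF X qset_q_bool p q_true_Proj])
  show "t \<in> rel_id q_bool (B, B')" if "B \<in> q_bool" "B' \<in> q_bool" "t \<in> ops B B'"
    "\<And>i y. y \<in> carrier B \<Longrightarrow> t (q_true B y) = q_true B' (t y)" for B B' t
    using q_bool_schur[OF that(1-3)] that(4) by blast
  show "qtotal X q_bool (intertwiners X q_bool (\<lambda>_ :: unit. p) (\<lambda>_. q_true))"
    unfolding qtotal_def
  proof (intro ballI impI)
    fix A x
    assume A: "A \<in> X" and x: "x \<in> carrier A"
      and 0: "\<forall>B\<in>q_bool. \<forall>r\<in>intertwiners X q_bool (\<lambda>_ :: unit. p) (\<lambda>_. q_true) (A, B). r x = \<zero>\<^bsub>B\<^esub>"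
    note [simp] = qsetD(1)[OF X A]
    have pA: "is_proj A (p A)" using p A carrier_Proj[OF X] by blast
    note [simp] = ops_closed[OF is_projD(1)[OF pA]]
    have B: "ell2 {0} \<in> q_bool" "ell2 {1} \<in> q_bool" by (simp_all add: q_bool_eq)
    have "inner A z x = 0" if z: "z \<in> carrier A" for z
    proof -
      \<comment> \<open>The functionals <p z, -> and <z - p z, ->, with values in the two lines,
        intertwine p with \<open>q_true\<close>. If both kill x, then x is orthogonal to p z and to
        z - p z, hence to z.\<close>
      let ?r1 = "\<lambda>x\<in>carrier A. inner A (p A z) x \<odot>\<^bsub>ell2 {1}\<^esub> ell2_unit (1 :: nat)"
      let ?r0 = "\<lambda>x\<in>carrier A. inner A (z \<ominus>\<^bsub>A\<^esub> p A z) x \<odot>\<^bsub>ell2 {0}\<^esub> ell2_unit (0 :: nat)"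
      have r1: "?r1 \<in> ops A (ell2 {1})" using z ell2_unit_carrier by (intro bra_vector_ops) simp_all
      have r0: "?r0 \<in> ops A (ell2 {0})" using z ell2_unit_carrier by (intro bra_vector_ops) simp_all
      have sm: "c \<odot>\<^bsub>ell2 {k}\<^esub> ell2_unit k \<in> carrier (ell2 {k})" for c and k :: nat
        using ell2_unit_carrier[of k] by simp
      have z0: "0 \<odot>\<^bsub>ell2 {k}\<^esub> ell2_unit k = \<zero>\<^bsub>ell2 {k}\<^esub>" for k :: nat
        using ell2_unit_carrier[of k] by simp
      have "?r1 \<in> intertwiners X q_bool (\<lambda>_ :: unit. p) (\<lambda>_. q_true) (A, ell2 {1})"
        using A B r1 z is_projD(2,3)[OF pA] sm by (simp add: intertwiners_apply q_true_simps del: One_nat_def)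
      then have "?r1 x = \<zero>\<^bsub>ell2 {1}\<^esub>" using 0 B by blast
      then have 1: "inner A (p A z) x = 0" using x ell2_smult_unit_eq_0 by simp
      have "inner A (z \<ominus>\<^bsub>A\<^esub> p A z) (p A y) = 0" if y: "y \<in> carrier A" for y
        using y z is_projD(2)[OF pA] is_projD(3)[OF pA, of z y] is_projD(3)[OF pA, of z "p A y"] is_projD(3)[OF pA, of "p A z" y] by simp
      then have "?r0 \<in> intertwiners X q_bool (\<lambda>_ :: unit. p) (\<lambda>_. q_true) (A, ell2 {0})"
        using A B r0 sm z0 by (simp add: intertwiners_apply q_true_simps del: hinner)
      then have "?r0 x = \<zero>\<^bsub>ell2 {0}\<^esub>" using 0 B by blast
      then have "inner A (z \<ominus>\<^bsub>A\<^esub> p A z) x \<odot>\<^bsub>ell2 {0}\<^esub> ell2_unit (0 :: nat) = \<zero>\<^bsub>ell2 {0}\<^esub>"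
        using x by (simp del: hinner)
      then have "inner A (z \<ominus>\<^bsub>A\<^esub> p A z) x = 0" by (rule ell2_smult_unit_eq_0)
      then show ?thesis using 1 x z by simp
    qed
    then show "x = \<zero>\<^bsub>A\<^esub>" using x by (intro hinner_ext[of A]) simp_all
  qed
qed

lemma fun_star_Proj_to_Fun:
  assumes p: "p \<in> carrier (Proj X)" shows "fun_star X q_bool (Proj_to_Fun X p) q_true = p"
  using fun_star_intertwiners[OF X qset_q_bool p q_true_Proj] Proj_to_Fun_qFun[OF p] by (simp add: Proj_to_Fun_def)

lemma Proj_to_Fun_fun_star:
  assumes F: "F \<in> qFun X q_bool" shows "Proj_to_Fun X (fun_star X q_bool F q_true) = F"
proof -
  have p: "fun_star X q_bool F q_true \<in> carrier (Proj X)" by (rule fun_star_Proj[OF X qset_q_bool F q_true_Proj])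
  show ?thesis
    using eq_intertwiners[OF X qset_q_bool p q_true_Proj Proj_to_Fun_qFun[OF p, unfolded Proj_to_Fun_def] F]
    by (simp add: Proj_to_Fun_def)
qed

lemma fun_star_q_true_inj:
  "F \<in> qFun X q_bool \<Longrightarrow> G \<in> qFun X q_bool \<Longrightarrow> fun_star X q_bool F q_true = fun_star X q_bool G q_true \<Longrightarrow> F = G"
  by (metis Proj_to_Fun_fun_star)

lemma bij_Proj_to_Fun: "bij_betw (Proj_to_Fun X) (carrier (Proj X)) (qFun X q_bool)"
  by (rule bij_betwI[where g = "\<lambda>F. fun_star X q_bool F q_true"])
    (auto simp: Proj_to_Fun_qFun fun_star_Proj_to_Fun Proj_to_Fun_fun_star fun_star_Proj[OF X qset_q_bool _ q_true_Proj])

text \<open>Evaluates the descriptions by which \<open>q_or\<close>, \<open>q_and\<close> and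
  \<open>q_not\<close> are defined.\<close>

lemma the_fun_star_q_true:
  assumes p: "p \<in> carrier (Proj X)"
  shows "(THE V. V \<in> qFun X q_bool \<and> fun_star X q_bool V q_true = p) = Proj_to_Fun X p"
  using Proj_to_Fun_qFun[OF p] fun_star_Proj_to_Fun[OF p] fun_star_q_true_inj by (intro the_equality) auto

end

section \<open>Eigenvectors and dimension\<close>

lemma onb_nonempty:
  assumes "fd_hilbert H" "carrier H \<noteq> {\<zero>\<^bsub>H\<^esub>}" "onb H (carrier H) E" shows "E \<noteq> {}"
proof
  assume E: "E = {}"
  interpret abelian_group H by (rule cvs_abelian_group[OF fd_hilbert_cvs[OF assms(1)]])
  have "x = \<zero>\<^bsub>H\<^esub>" if "x \<in> carrier H" for x
    using assms(3) that finsum_empty[of "\<lambda>e. inner H e x \<odot>\<^bsub>H\<^esub> e"] unfolding onb_def E by metis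
  moreover have "\<zero>\<^bsub>H\<^esub> \<in> carrier H" by simp
  ultimately show False using assms(2) by blast
qed

lemma onb_ext:
  assumes H: "fd_hilbert H" and E: "onb H (carrier H) E" and u: "u \<in> carrier H" and w: "w \<in> carrier H"
    and eq: "\<And>e. e \<in> E \<Longrightarrow> inner H e u = inner H e w"
  shows "u = w"
proof -
  interpret abelian_group H by (rule cvs_abelian_group[OF fd_hilbert_cvs[OF H]])
  have sub: "E \<subseteq> carrier H" using E by (simp add: onb_def)
  have "(\<Oplus>\<^bsub>H\<^esub>e\<in>E. inner H e u \<odot>\<^bsub>H\<^esub> e) = (\<Oplus>\<^bsub>H\<^esub>e\<in>E. inner H e w \<odot>\<^bsub>H\<^esub> e)"
    using sub eq H by (intro finsum_cong') auto
  moreover have "u = (\<Oplus>\<^bsub>H\<^esub>e\<in>E. inner H e u \<odot>\<^bsub>H\<^esub> e)" "w = (\<Oplus>\<^bsub>H\<^esub>e\<in>E. inner H e w \<odot>\<^bsub>H\<^esub> e)"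
    using E u w unfolding onb_def by blast+
  ultimately show ?thesis by (rule_tac trans[OF _ trans[OF _ sym]])
qed

text \<open>The matrix of t in an orthonormal basis has nonempty complex spectrum; an eigenvector v
  of the matrix gives x as the sum of the v_j f_j, whose coordinates are those of v.\<close>

lemma eigenvector_exists:
  assumes H: "fd_hilbert H" and nz: "carrier H \<noteq> {\<zero>\<^bsub>H\<^esub>}" and t: "t \<in> ops H H"
  shows "\<exists>c. \<exists>x\<in>carrier H. x \<noteq> \<zero>\<^bsub>H\<^esub> \<and> t x = c \<odot>\<^bsub>H\<^esub> x"
proof -
  interpret abelian_group H by (rule cvs_abelian_group[OF fd_hilbert_cvs[OF H]])
  note [simp] = H ops_closed[OF t]
  obtain E where E: "onb H (carrier H) E" using onb_exists[OF H csubspace_carrier] by auto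
  have fin: "finite E" and sub: "E \<subseteq> carrier H" and on: "orthonormal H E" using E by (auto simp: onb_def)
  define n where "n = card E"
  have n: "n > 0" using onb_nonempty[OF H nz E] fin by (simp add: n_def card_gt_0_iff)
  obtain f where f: "bij_betw f {0..<n} E" using ex_bij_betw_nat_finite[OF fin] n_def by blast
  have fE: "f i \<in> E" if "i < n" for i using f that by (auto simp: bij_betw_def)
  have fH: "f i \<in> carrier H" if "i < n" for i using fE[OF that] sub by blast
  have ff: "inner H (f i) (f j) = (if i = j then 1 else 0)" if "i < n" "j < n" for i j
    using on fE[OF that(1)] fE[OF that(2)] f that unfolding orthonormal_def bij_betw_def
    by (auto simp: inj_on_eq_iff)
  define M where "M = mat n n (\<lambda>(i, j). inner H (f i) (t (f j)))"
  have M: "M \<in> carrier_mat n n" by (simp add: M_def)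
  obtain c v where v: "v \<in> carrier_vec n" "v \<noteq> 0\<^sub>v n" "M *\<^sub>v v = c \<cdot>\<^sub>v v"
    using spectrum_non_empty[OF M n] M unfolding spectrum_def eigenvalue_def eigenvector_def by auto
  define x where "x = (\<Oplus>\<^bsub>H\<^esub>j\<in>{0..<n}. (v $ j) \<odot>\<^bsub>H\<^esub> f j)"
  have summand: "(v $ j) \<odot>\<^bsub>H\<^esub> f j \<in> carrier H" if "j \<in> {0..<n}" for j using fH that by simp
  have x: "x \<in> carrier H" unfolding x_def using summand by (intro finsum_closed) auto
  have fx: "inner H (f i) x = v $ i" if i: "i < n" for i
  proof -
    have "inner H (f i) x = (\<Sum>j\<in>{0..<n}. inner H (f i) ((v $ j) \<odot>\<^bsub>H\<^esub> f j))"
      unfolding x_def using summand fH[OF i] by (intro hinner_finsum) auto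
    also have "\<dots> = (\<Sum>j\<in>{0..<n}. if i = j then v $ j else 0)"
      using fH i ff by (intro sum.cong) auto
    finally show ?thesis using i by simp
  qed
  have ftx: "inner H (f i) (t x) = c * (v $ i)" if i: "i < n" for i
  proof -
    have "t x = (\<Oplus>\<^bsub>H\<^esub>j\<in>{0..<n}. t ((v $ j) \<odot>\<^bsub>H\<^esub> f j))"
      unfolding x_def using summand by (intro ops_finsum[OF t]) auto
    then have "inner H (f i) (t x) = (\<Sum>j\<in>{0..<n}. inner H (f i) (t ((v $ j) \<odot>\<^bsub>H\<^esub> f j)))"
      using ops_closed[OF t summand] fH[OF i] by (simp only:) (intro hinner_finsum, simp_all)
    also have "\<dots> = (\<Sum>j\<in>{0..<n}. M $$ (i, j) * (v $ j))"
    proof (rule sum.cong[OF refl])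
      fix j assume j: "j \<in> {0..<n}"
      show "inner H (f i) (t ((v $ j) \<odot>\<^bsub>H\<^esub> f j)) = M $$ (i, j) * (v $ j)"
        using ops_smult[OF t, of "f j" "v $ j"] fH j i by (simp add: M_def mult.commute)
    qed
    also have "\<dots> = (M *\<^sub>v v) $ i"
      using M v(1) i by (simp add: scalar_prod_def)
    also have "\<dots> = c * (v $ i)" using v i by simp
    finally show ?thesis .
  qed
  have tx: "t x = c \<odot>\<^bsub>H\<^esub> x"
  proof (rule onb_ext[OF H E])
    fix e assume "e \<in> E"
    then obtain i where i: "i < n" "e = f i" using f by (auto simp: bij_betw_def)
    show "inner H e (t x) = inner H e (c \<odot>\<^bsub>H\<^esub> x)" using ftx[OF i(1)] fx[OF i(1)] fH[OF i(1)] i(2) x by simp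
  qed (use x in simp_all)
  have "x \<noteq> \<zero>\<^bsub>H\<^esub>"
  proof
    assume "x = \<zero>\<^bsub>H\<^esub>"
    then have "v $ i = 0" if "i < n" for i using fx[OF that] fH[OF that] by simp
    then have "v = 0\<^sub>v n" using v(1) by (intro eq_vecI) auto
    then show False using v(2) by simp
  qed
  then show ?thesis using x tx by blast
qed

text \<open>On subspaces this is the dimension, expressed inside H so that W is not turned into a
  space of its own. It serves as a strictly monotone measure.\<close>

definition odim :: "'v hilb \<Rightarrow> 'v set \<Rightarrow> nat" where
  "odim H W = Max (card ` {E. orthonormal H E \<and> E \<subseteq> W})"

text \<open>A largest orthonormal subset of V is enlarged by the normalised component, orthogonal to
  V, of a vector of W outside V.\<close>

lemma odim_psubset:
  assumes H [simp]: "fd_hilbert H" and V: "csubspace H V" and W: "csubspace H W" and VW: "V \<subset> W"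
  shows "odim H V < odim H W"
proof -
  have fin: "finite (card ` {E. orthonormal H E \<and> E \<subseteq> U})" for U
    using orthonormal_card(2)[OF H] by (intro finite_subset[OF _ finite_atMost[of "vectorspace.dim class_ring H"]]) auto
  have ne: "card ` {E. orthonormal H E \<and> E \<subseteq> U} \<noteq> {}" for U
    by (auto simp: orthonormal_def)
  obtain E where E: "orthonormal H E" "E \<subseteq> V" "odim H V = card E"
    using Max_in[OF fin ne, of V] unfolding odim_def by auto
  obtain x where x: "x \<in> W" "x \<notin> V" using VW by blast
  have xH: "x \<in> carrier H" using csubspaceD(1)[OF W _ x(1)] by simp
  obtain v where v: "v \<in> V" "\<forall>u\<in>V. inner H u x = inner H u v"
    using orthogonal_decomposition[OF H V xH] by blast
  have vH: "v \<in> carrier H" using csubspaceD(1)[OF V _ v(1)] by simp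
  let ?y = "x \<ominus>\<^bsub>H\<^esub> v"
  have yW: "?y \<in> W" using csubspaceD(5)[OF W _ x(1)] v(1) VW by auto
  have "?y \<noteq> \<zero>\<^bsub>H\<^esub>" using x v xH vH by auto
  then obtain c where c: "inner H (c \<odot>\<^bsub>H\<^esub> ?y) (c \<odot>\<^bsub>H\<^esub> ?y) = 1" using normalise[OF H, of ?y] xH vH by auto
  define z where "z = c \<odot>\<^bsub>H\<^esub> ?y"
  have z: "z \<in> W" "z \<in> carrier H" "inner H z z = 1"
    using csubspaceD(4)[OF W _ yW] xH vH c by (simp_all add: z_def del: hinner)
  have ez: "inner H e z = 0" if "e \<in> E" for e
  proof -
    have eH: "e \<in> carrier H" "e \<in> V" using that E by (auto simp: orthonormal_def)
    then show ?thesis using v xH vH by (simp add: z_def)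
  qed
  have ze: "inner H z e = 0" if "e \<in> E" for e
    using ez[OF that] cnj_hinner[OF H, of e z] z E that by (auto simp: orthonormal_def)
  have zE: "z \<notin> E" using z(3) ez by force
  have "orthonormal H (insert z E)"
    using E z ez ze zE unfolding orthonormal_def by simp blast
  then have "card (insert z E) \<in> card ` {E. orthonormal H E \<and> E \<subseteq> W}" using E z VW by auto
  then have "card (insert z E) \<le> odim H W" unfolding odim_def using fin by (intro Max_ge)
  then show ?thesis using E zE orthonormal_card(1)[OF H E(1)] by simp
qed

section \<open>Irreducible families of operators\<close>

definition invariant :: "'v hilb \<Rightarrow> ('i \<Rightarrow> 'v \<Rightarrow> 'v) \<Rightarrow> 'v set \<Rightarrow> bool" where
  "invariant A a W \<longleftrightarrow> csubspace A W \<and> (\<forall>i. \<forall>x\<in>W. a i x \<in> W)"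

text \<open>The zero space qualifies; nonzero carriers are demanded separately in
  \<open>irr_pairs\<close>.\<close>

definition irreducible :: "'v hilb \<Rightarrow> ('i \<Rightarrow> 'v \<Rightarrow> 'v) \<Rightarrow> bool" where
  "irreducible A a \<longleftrightarrow> (\<forall>W. invariant A a W \<longrightarrow> W = {\<zero>\<^bsub>A\<^esub>} \<or> W = carrier A)"

lemma invariant_kernel:
  assumes A: "fd_hilbert A" and B: "fd_hilbert B" and t: "t \<in> ops A B"
    and a: "\<And>i. a i \<in> ops A A" and b: "\<And>i. b i \<in> ops B B"
    and eq: "\<And>i x. x \<in> carrier A \<Longrightarrow> t (a i x) = b i (t x)"
  shows "invariant A a {x \<in> carrier A. t x = \<zero>\<^bsub>B\<^esub>}"
  unfolding invariant_def
proof (intro conjI allI ballI)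
  show "csubspace A {x \<in> carrier A. t x = \<zero>\<^bsub>B\<^esub>}"
    using A B t by (auto simp: csubspace_iff)
  show "a i x \<in> {x \<in> carrier A. t x = \<zero>\<^bsub>B\<^esub>}" if "x \<in> {x \<in> carrier A. t x = \<zero>\<^bsub>B\<^esub>}" for i x
    using that eq[of x i] ops_closed[OF a] ops_zero[OF b B B] by simp
qed

text \<open>Half of Schur's lemma: the kernel of a nonzero intertwiner is an invariant subspace
  other than the whole space.\<close>

lemma irreducible_inj:
  assumes A: "fd_hilbert A" and B: "fd_hilbert B" and t: "t \<in> ops A B"
    and a: "\<And>i. a i \<in> ops A A" and b: "\<And>i. b i \<in> ops B B"
    and eq: "\<And>i x. x \<in> carrier A \<Longrightarrow> t (a i x) = b i (t x)"
    and irr: "irreducible A a" and nz: "t \<noteq> \<zero>\<^bsub>lin_ops A B\<^esub>" and x: "x \<in> carrier A" "t x = \<zero>\<^bsub>B\<^esub>"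
  shows "x = \<zero>\<^bsub>A\<^esub>"
proof -
  have "\<zero>\<^bsub>lin_ops A B\<^esub> \<in> ops A B" using csubspaceD(2)[OF csubspace_carrier, of "lin_ops A B"] A B by simp
  then have "{x \<in> carrier A. t x = \<zero>\<^bsub>B\<^esub>} \<noteq> carrier A" using nz ops_eqI[OF t] by fastforce
  then have "{x \<in> carrier A. t x = \<zero>\<^bsub>B\<^esub>} = {\<zero>\<^bsub>A\<^esub>}"
    using irr invariant_kernel[of A B t a b, OF A B t a b eq] unfolding irreducible_def by blast
  then show ?thesis using x by blast
qed

text \<open>For an eigenvalue c of t, the intertwiner t - c 1 kills an eigenvector, so it is not
  injective and must be zero.\<close>

lemma irreducible_scalar:
  assumes A: "fd_hilbert A" and nz: "carrier A \<noteq> {\<zero>\<^bsub>A\<^esub>}" and t: "t \<in> ops A A" and a: "\<And>i. a i \<in> ops A A"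
    and eq: "\<And>i x. x \<in> carrier A \<Longrightarrow> t (a i x) = a i (t x)" and irr: "irreducible A a"
  shows "\<exists>c. t = c \<odot>\<^bsub>lin_ops A A\<^esub> op_id A"
proof -
  note [simp] = A
  obtain c v where v: "v \<in> carrier A" "v \<noteq> \<zero>\<^bsub>A\<^esub>" "t v = c \<odot>\<^bsub>A\<^esub> v" using eigenvector_exists[OF A nz t] by blast
  have s: "c \<odot>\<^bsub>lin_ops A A\<^esub> op_id A \<in> ops A A" by simp
  let ?u = "t \<ominus>\<^bsub>lin_ops A A\<^esub> (c \<odot>\<^bsub>lin_ops A A\<^esub> op_id A)"
  have u: "?u \<in> ops A A" using t s by simp
  have ux: "?u x = t x \<ominus>\<^bsub>A\<^esub> c \<odot>\<^bsub>A\<^esub> x" if "x \<in> carrier A" for x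
    using lin_ops_minus_apply[OF A A t s that] that by simp
  have "?u (a i x) = a i (?u x)" if x: "x \<in> carrier A" for i x
    using ux[OF x] ux[OF ops_closed[OF a x], of i] eq[OF x, of i] ops_minus[OF a A A, of "t x" "c \<odot>\<^bsub>A\<^esub> x" i]
      ops_smult[OF a x, of i c] ops_closed[OF t x] x by simp
  moreover have "?u v = \<zero>\<^bsub>A\<^esub>" using ux[OF v(1)] v by simp
  ultimately have "?u = \<zero>\<^bsub>lin_ops A A\<^esub>"
    using irreducible_inj[of A A ?u a a, OF A A u a a _ irr _ v(1)] v(2) by blast
  then have "t = c \<odot>\<^bsub>lin_ops A A\<^esub> op_id A"
    using abelian_group.minus_other_side[OF cvs_abelian_group[OF cvs_lin_ops[OF A A]] t s] by simp
  then show ?thesis by blast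
qed

text \<open>A nonzero invariant subspace of least \<open>odim\<close> is minimal, since
  \<open>odim\<close> drops strictly on proper subspaces.\<close>

lemma minimal_invariant:
  assumes A: "fd_hilbert A" and N: "invariant A a N" "N \<noteq> {\<zero>\<^bsub>A\<^esub>}"
  shows "\<exists>M\<subseteq>N. invariant A a M \<and> M \<noteq> {\<zero>\<^bsub>A\<^esub>} \<and> (\<forall>W\<subseteq>M. invariant A a W \<longrightarrow> W = {\<zero>\<^bsub>A\<^esub>} \<or> W = M)"
proof -
  let ?P = "\<lambda>M. M \<subseteq> N \<and> invariant A a M \<and> M \<noteq> {\<zero>\<^bsub>A\<^esub>}"
  obtain M where M: "?P M" and min: "\<And>W. ?P W \<Longrightarrow> odim A M \<le> odim A W"
    using ex_has_least_nat[of ?P N "odim A"] N by blast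
  have "W = {\<zero>\<^bsub>A\<^esub>} \<or> W = M" if W: "W \<subseteq> M" "invariant A a W" for W
  proof (rule ccontr)
    assume h: "\<not> (W = {\<zero>\<^bsub>A\<^esub>} \<or> W = M)"
    then have "odim A W < odim A M"
      using W M by (intro odim_psubset[OF A]) (auto simp: invariant_def)
    moreover have "odim A M \<le> odim A W" using h W M by (intro min) auto
    ultimately show False by simp
  qed
  then show ?thesis using M by blast
qed

text \<open>Finite dimension follows from an orthonormal basis of M. The value m is arbitrary so
  that \<open>encode\<close> can be stored there.\<close>

lemma fd_hilbert_subspace:
  assumes A: "fd_hilbert A" and M: "csubspace A M"
  shows "fd_hilbert (A\<lparr>carrier := M, mult := m\<rparr>)"
proof -
  let ?M = "A\<lparr>carrier := M, mult := m\<rparr>"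
  note [simp] = A
  note MD = csubspaceD[OF M fd_hilbert_cvs[OF A]]
  interpret A: abelian_group A by (rule cvs_abelian_group[OF fd_hilbert_cvs[OF A]])
  have vs: "cvs ?M"
  proof (rule vs_criteria[OF class_field])
    show "\<forall>v\<in>carrier ?M. \<exists>neg_v\<in>carrier ?M. v \<oplus>\<^bsub>?M\<^esub> neg_v = \<zero>\<^bsub>?M\<^esub>"
    proof
      fix v assume "v \<in> carrier ?M"
      then have v: "v \<in> M" "v \<in> carrier A" using MD(1) by auto
      have "v \<oplus>\<^bsub>A\<^esub> (-1) \<odot>\<^bsub>A\<^esub> v = \<zero>\<^bsub>A\<^esub>" using v A.r_neg[OF v(2)] cvs_uminus[OF fd_hilbert_cvs[OF A] v(2)] by simp
      then show "\<exists>neg_v\<in>carrier ?M. v \<oplus>\<^bsub>?M\<^esub> neg_v = \<zero>\<^bsub>?M\<^esub>" using MD(4)[OF v(1)] by auto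
    qed
  qed (use MD in \<open>auto simp: A.a_ac cvs_distrib\<close>)
  interpret vectorspace "class_ring :: complex ring" ?M by (rule vs)
  obtain E where E: "onb A M E" using onb_exists[OF A M] by blast
  have fin: "finite E" and EM: "E \<subseteq> carrier ?M" using E by (auto simp: onb_def)
  have T: "csubspace ?M (cspan ?M E)" by (rule csubspace_cspan[OF vs EM])
  \<comment> \<open>The Fourier expansion is a sum formed in A, so the span taken in the smaller
    space is first recognised as a subspace of A.\<close>
  then have TA: "csubspace A (cspan ?M E)"
    using MD(1) by (auto simp: csubspace_iff[OF vs] csubspace_iff)
  have "x \<in> cspan ?M E" if x: "x \<in> M" for x
  proof -
    have "(\<Oplus>\<^bsub>A\<^esub>e\<in>E. inner A e x \<odot>\<^bsub>A\<^esub> e) \<in> cspan ?M E"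
      using cspan_superset[OF vs EM] csubspaceD(4)[OF TA] by (intro csubspace_finsum[OF _ TA fin]) auto
    then show ?thesis using E x by (simp add: onb_def)
  qed
  then have "fin_dim"
    unfolding fin_dim_def using fin EM T by (intro exI[of _ E]) (auto simp: csubspace_iff[OF vs])
  moreover have "0 < Re (inner A x x)" if "x \<in> M" "x \<noteq> \<zero>\<^bsub>A\<^esub>" for x
    using fd_hilbert.inner_pos[OF A, of x] MD(1) that by simp
  ultimately show ?thesis
    using vs MD(1) unfolding fd_hilbert_def fd_hilbert_axioms_def
    by (intro conjI allI impI) (simp_all add: cnj_hinner)
qed

section \<open>The product of the two-element quantum set with itself\<close>

text \<open>A pair of projections on a Hilbert space is stored in the field \<open>mult\<close>, which carries
  no other meaning; inequivalent pairs on one space thereby give distinct atoms.\<close>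

definition encode :: "'v hilb \<Rightarrow> (bool \<Rightarrow> 'v \<Rightarrow> 'v) \<Rightarrow> 'v \<Rightarrow> 'v \<Rightarrow> 'v" where
  "encode A a = (\<lambda>x y. if y = \<zero>\<^bsub>A\<^esub> then a True x else a False x)"

text \<open>The second argument of \<open>mult\<close> selects the operator: zero for
  \<open>True\<close>, a nonzero vector for \<open>False\<close>. It does not matter which nonzero
  vector is chosen, because \<open>encode\<close> distinguishes only zero from nonzero.\<close>

definition decode :: "bool \<Rightarrow> 'v hilb \<Rightarrow> 'v \<Rightarrow> 'v" where
  "decode i B = (\<lambda>x\<in>carrier B. x \<otimes>\<^bsub>B\<^esub> (if i then \<zero>\<^bsub>B\<^esub> else (SOME y. y \<in> carrier B \<and> y \<noteq> \<zero>\<^bsub>B\<^esub>)))"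

lemma decode_encode:
  assumes "y \<in> M" "y \<noteq> \<zero>\<^bsub>A\<^esub>"
  shows "decode i (A\<lparr>carrier := M, mult := encode A a\<rparr>) = restrict (a i) M"
proof -
  have "(SOME y. y \<in> M \<and> y \<noteq> \<zero>\<^bsub>A\<^esub>) \<noteq> \<zero>\<^bsub>A\<^esub>" using someI[of "\<lambda>y. y \<in> M \<and> y \<noteq> \<zero>\<^bsub>A\<^esub>" y] assms by blast
  then show ?thesis by (cases i) (simp_all add: decode_def encode_def)
qed

section \<open>Irreducible pairs of projections up to equivalence\<close>

definition irr_pairs :: "'v hilb set" where
  "irr_pairs = {B. fd_hilbert B \<and> carrier B \<noteq> {\<zero>\<^bsub>B\<^esub>} \<and> (\<forall>i. is_proj B (decode i B)) \<and> irreducible B (\<lambda>i. decode i B)}"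

text \<open>Equivalence of irreducible pairs, expressed by a nonzero intertwiner instead of a
  unitary one: symmetry then needs only adjoints, and transitivity only injectivity.\<close>

definition linked :: "'v hilb \<Rightarrow> 'v hilb \<Rightarrow> bool" where
  "linked B B' \<longleftrightarrow> (\<exists>t\<in>ops B B'. t \<noteq> \<zero>\<^bsub>lin_ops B B'\<^esub> \<and> (\<forall>i. \<forall>x\<in>carrier B. t (decode i B x) = decode i B' (t x)))"

definition irr_rep :: "'v hilb \<Rightarrow> 'v hilb" where
  "irr_rep B = (SOME B'. B' \<in> irr_pairs \<and> linked B B')"

definition irr_reps :: "'v hilb set" where
  "irr_reps = irr_rep ` irr_pairs"

lemma irr_pairsD:
  assumes "B \<in> irr_pairs"
  shows "fd_hilbert B" "carrier B \<noteq> {\<zero>\<^bsub>B\<^esub>}" "is_proj B (decode i B)" "decode i B \<in> ops B B"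
    "irreducible B (\<lambda>i. decode i B)"
  using assms is_projD(1) by (auto simp: irr_pairs_def)

lemma zero_op_closed: "fd_hilbert A \<Longrightarrow> fd_hilbert B \<Longrightarrow> \<zero>\<^bsub>lin_ops A B\<^esub> \<in> ops A B"
  using csubspaceD(2)[OF csubspace_carrier, of "lin_ops A B"] by simp

lemma nonzero_op_witness:
  assumes "fd_hilbert A" "fd_hilbert B" "t \<in> ops A B" "t \<noteq> \<zero>\<^bsub>lin_ops A B\<^esub>"
  shows "\<exists>x\<in>carrier A. t x \<noteq> \<zero>\<^bsub>B\<^esub>"
proof (rule ccontr)
  assume "\<not> (\<exists>x\<in>carrier A. t x \<noteq> \<zero>\<^bsub>B\<^esub>)"
  then have "t = \<zero>\<^bsub>lin_ops A B\<^esub>" using assms zero_op_closed by (intro ops_eqI[of t A B]) simp_all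
  then show False using assms by simp
qed

lemma linked_refl:
  assumes B: "B \<in> irr_pairs" shows "linked B B"
proof -
  note [simp] = irr_pairsD(1)[OF B]
  have "\<zero>\<^bsub>B\<^esub> \<in> carrier B" by simp
  then obtain x where x: "x \<in> carrier B" "x \<noteq> \<zero>\<^bsub>B\<^esub>" using irr_pairsD(2)[OF B] by blast
  have "op_id B \<noteq> \<zero>\<^bsub>lin_ops B B\<^esub>"
  proof
    assume "op_id B = \<zero>\<^bsub>lin_ops B B\<^esub>"
    from fun_cong[OF this, of x] show False using x by simp
  qed
  then show ?thesis
    unfolding linked_def using ops_closed[OF irr_pairsD(4)[OF B]] by (intro bexI[of _ "op_id B"]) simp_all
qed

lemma linked_sym:
  assumes B: "B \<in> irr_pairs" and C: "C \<in> irr_pairs" and BC: "linked B C" shows "linked C B"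
proof -
  note [simp] = irr_pairsD(1)[OF B] irr_pairsD(1)[OF C]
  obtain t where t: "t \<in> ops B C" "t \<noteq> \<zero>\<^bsub>lin_ops B C\<^esub>"
    and eq: "\<And>i x. x \<in> carrier B \<Longrightarrow> t (decode i B x) = decode i C (t x)"
    using BC unfolding linked_def by blast
  have "op_adj B C t \<noteq> \<zero>\<^bsub>lin_ops C B\<^esub>"
  proof
    assume "op_adj B C t = \<zero>\<^bsub>lin_ops C B\<^esub>"
    then have "t = op_adj C B \<zero>\<^bsub>lin_ops C B\<^esub>" using op_adj_adj[of B C t] t by simp
    then show False using t op_adj_zero[of C B] by simp
  qed
  moreover have "op_adj B C t (decode i C y) = decode i B (op_adj B C t y)" if "y \<in> carrier C" for i y
    using adj_intertwines[of B C "decode i B" "decode i C" t y] irr_pairsD(3)[OF B] irr_pairsD(3)[OF C] t eq that by simp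
  moreover have "op_adj B C t \<in> ops C B" using t by simp
  ultimately show ?thesis unfolding linked_def by blast
qed

text \<open>A composite of nonzero operators could vanish; here s is injective because the pair on C
  is irreducible.\<close>

lemma linked_trans:
  assumes B: "B \<in> irr_pairs" and C: "C \<in> irr_pairs" and D: "D \<in> irr_pairs"
    and BC: "linked B C" and CD: "linked C D" shows "linked B D"
proof -
  note fd = irr_pairsD(1)[OF B] irr_pairsD(1)[OF C] irr_pairsD(1)[OF D]
  obtain t where t: "t \<in> ops B C" "t \<noteq> \<zero>\<^bsub>lin_ops B C\<^esub>"
    and te: "\<And>i x. x \<in> carrier B \<Longrightarrow> t (decode i B x) = decode i C (t x)"
    using BC unfolding linked_def by blast
  obtain s where s: "s \<in> ops C D" "s \<noteq> \<zero>\<^bsub>lin_ops C D\<^esub>"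
    and se: "\<And>i x. x \<in> carrier C \<Longrightarrow> s (decode i C x) = decode i D (s x)"
    using CD unfolding linked_def by blast
  obtain x where x: "x \<in> carrier B" "t x \<noteq> \<zero>\<^bsub>C\<^esub>" using nonzero_op_witness[OF fd(1,2) t] by blast
  have tx: "t x \<in> carrier C" using ops_closed[OF t(1) x(1)] .
  have "s (t x) \<noteq> \<zero>\<^bsub>D\<^esub>"
    using irreducible_inj[of C D s "\<lambda>i. decode i C" "\<lambda>i. decode i D",
        OF fd(2,3) s(1) irr_pairsD(4)[OF C] irr_pairsD(4)[OF D] se irr_pairsD(5)[OF C] s(2) tx] x(2) by blast
  have st: "op_comp B s t \<in> ops B D" by (rule op_comp_closed[OF t(1) s(1) fd(1)])
  have "op_comp B s t \<noteq> \<zero>\<^bsub>lin_ops B D\<^esub>"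
  proof
    assume "op_comp B s t = \<zero>\<^bsub>lin_ops B D\<^esub>"
    from fun_cong[OF this, of x] show False using x \<open>s (t x) \<noteq> \<zero>\<^bsub>D\<^esub>\<close> by simp
  qed
  moreover have "op_comp B s t (decode i B y) = decode i D (op_comp B s t y)" if y: "y \<in> carrier B" for i y
    using te[OF y] se[OF ops_closed[OF t(1) y]] y ops_closed[OF irr_pairsD(4)[OF B] y] by simp
  ultimately show ?thesis unfolding linked_def using st by blast
qed

lemma irr_rep:
  assumes "B \<in> irr_pairs" shows "irr_rep B \<in> irr_pairs" "linked B (irr_rep B)"
proof -
  have "\<exists>B'. B' \<in> irr_pairs \<and> linked B B'" using assms linked_refl[OF assms] by blast
  from someI_ex[OF this] show "irr_rep B \<in> irr_pairs" "linked B (irr_rep B)" unfolding irr_rep_def by blast+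
qed

lemma irr_reps_subset: "irr_reps \<subseteq> irr_pairs"
  using irr_rep(1) by (auto simp: irr_reps_def)

text \<open>Linked pairs have the same equivalence class, so the choice in \<open>irr_rep\<close> is
  made from the same set and gives the same representative.\<close>

lemma irr_reps_linked_eq:
  assumes B: "B \<in> irr_reps" and C: "C \<in> irr_reps" and BC: "linked B C" shows "B = C"
proof -
  obtain B' where B': "B' \<in> irr_pairs" "B = irr_rep B'" using B by (auto simp: irr_reps_def)
  obtain C' where C': "C' \<in> irr_pairs" "C = irr_rep C'" using C by (auto simp: irr_reps_def)
  have Bp: "B \<in> irr_pairs" and Cp: "C \<in> irr_pairs" using B C irr_reps_subset by auto
  have "linked B' C'"
    using linked_trans[OF B'(1) Cp C'(1) linked_trans[OF B'(1) Bp Cp _ BC] linked_sym[OF C'(1) Cp]]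
      irr_rep(2)[OF B'(1)] irr_rep(2)[OF C'(1)] B'(2) C'(2) by simp
  then have "linked B' D \<longleftrightarrow> linked C' D" if "D \<in> irr_pairs" for D
    using linked_trans[OF B'(1) C'(1) that] linked_trans[OF C'(1) B'(1) that] linked_sym[OF B'(1) C'(1)] by blast
  then have "(\<lambda>D. D \<in> irr_pairs \<and> linked B' D) = (\<lambda>D. D \<in> irr_pairs \<and> linked C' D)" by blast
  then show ?thesis unfolding B'(2) C'(2) irr_rep_def by simp
qed

lemma qset_irr_reps: "qset (irr_reps :: 'v hilb set)"
  using irr_reps_subset irr_pairsD(1,2) unfolding qset_def by blast

definition irr_proj :: "bool \<Rightarrow> 'v hilb \<Rightarrow> 'v \<Rightarrow> 'v" where
  "irr_proj i = (\<lambda>B\<in>irr_reps. decode i B)"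

lemma irr_proj_apply: "B \<in> irr_reps \<Longrightarrow> irr_proj i B = decode i B"
  by (simp add: irr_proj_def)

lemma irr_proj_Proj: "irr_proj i \<in> carrier (Proj irr_reps)"
proof -
  have "is_proj B (irr_proj i B)" if "B \<in> irr_reps" for B
    using that irr_reps_subset irr_pairsD(3)[of B i] by (auto simp: irr_proj_apply)
  moreover have "irr_proj i \<in> extensional irr_reps" by (simp add: irr_proj_def)
  ultimately show ?thesis using carrier_Proj[OF qset_irr_reps] by blast
qed

text \<open>A nonzero t links B and C, hence B = C since classes have one representative each; then
  t is an endomorphism of an irreducible pair, hence a scalar.\<close>

lemma irr_reps_schur:
  assumes B: "B \<in> irr_reps" and C: "C \<in> irr_reps" and t: "t \<in> ops B C"
    and eq: "\<And>i y. y \<in> carrier B \<Longrightarrow> t (irr_proj i B y) = irr_proj i C (t y)"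
  shows "t \<in> rel_id irr_reps (B, C)"
proof -
  have Bp: "B \<in> irr_pairs" and Cp: "C \<in> irr_pairs" using B C irr_reps_subset by auto
  have eq': "t (decode i B y) = decode i C (t y)" if "y \<in> carrier B" for i y
    using eq[OF that, of i] B C by (simp add: irr_proj_apply)
  show ?thesis
  proof (cases "t = \<zero>\<^bsub>lin_ops B C\<^esub>")
    case True
    then show ?thesis
      using csubspaceD(2)[OF qRel_csubspace[OF rel_id_qRel[OF qset_irr_reps] B C]] irr_pairsD(1)[OF Bp] irr_pairsD(1)[OF Cp] by simp
  next
    case False
    then have "linked B C" unfolding linked_def using t eq' by blast
    then have BC: "B = C" by (rule irr_reps_linked_eq[OF B C])
    have "\<exists>c. t = c \<odot>\<^bsub>lin_ops B B\<^esub> op_id B"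
      using irreducible_scalar[of B t "\<lambda>i. decode i B"] irr_pairsD[OF Bp] t eq' BC by simp
    then show ?thesis using B BC by (auto simp: rel_id_def)
  qed
qed

text \<open>The subspace M itself, with the restricted projections stored in it, becomes a member of
  \<open>irr_pairs\<close> over the same type as A. So every irreducible constituent of an atom is
  available as an atom.\<close>

lemma minimal_invariant_irr_pairs:
  assumes A: "fd_hilbert A" and a: "\<And>i. is_proj A (a i)" and M: "invariant A a M" "M \<noteq> {\<zero>\<^bsub>A\<^esub>}"
    and min: "\<And>W. W \<subseteq> M \<Longrightarrow> invariant A a W \<Longrightarrow> W = {\<zero>\<^bsub>A\<^esub>} \<or> W = M"
  shows "A\<lparr>carrier := M, mult := encode A a\<rparr> \<in> irr_pairs" (is "?H \<in> _")
    and "decode i (A\<lparr>carrier := M, mult := encode A a\<rparr>) = restrict (a i) M"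
proof -
  have Ms: "csubspace A M" and aM: "\<And>i x. x \<in> M \<Longrightarrow> a i x \<in> M" using M by (auto simp: invariant_def)
  note MD = csubspaceD[OF Ms fd_hilbert_cvs[OF A]]
  obtain y where y: "y \<in> M" "y \<noteq> \<zero>\<^bsub>A\<^esub>" using M(2) MD(2) by blast
  show dec: "decode i ?H = restrict (a i) M" for i by (rule decode_encode[OF y])
  have H: "fd_hilbert ?H" by (rule fd_hilbert_subspace[OF A Ms])
  have "is_proj ?H (decode i ?H)" for i
    unfolding is_proj_def dec
  proof (intro conjI ballI)
    note ao = is_projD(1)[OF a[of i]]
    have "(\<lambda>x\<in>carrier ?H. a i x) \<in> ops ?H ?H"
      by (rule ops_restrictI[OF _ _ _ H]) (use aM MD(1) ops_add[OF ao] ops_smult[OF ao] in simp_all)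
    then show "restrict (a i) M \<in> ops ?H ?H" by simp
  qed (use aM MD(1) is_projD(2,3)[OF a[of i]] in simp_all)
  moreover have "irreducible ?H (\<lambda>i. decode i ?H)"
    unfolding irreducible_def
  proof (intro allI impI)
    fix W assume W: "invariant ?H (\<lambda>i. decode i ?H) W"
    then have WH: "csubspace ?H W" by (simp add: invariant_def)
    then have WM: "W \<subseteq> M" using csubspace_iff[OF fd_hilbert_cvs[OF H]] by simp
    have "csubspace A W"
      using WH WM MD(1) unfolding csubspace_iff[OF fd_hilbert_cvs[OF H]] csubspace_iff[OF fd_hilbert_cvs[OF A]] by auto
    moreover have "a i x \<in> W" if "x \<in> W" for i x
    proof -
      have "decode i ?H x \<in> W" using W that by (simp add: invariant_def)
      then show ?thesis using that WM by (auto simp: dec)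
    qed
    ultimately have "invariant A a W" by (simp add: invariant_def)
    then show "W = {\<zero>\<^bsub>?H\<^esub>} \<or> W = carrier ?H" using min[OF WM] by simp
  qed
  moreover have "carrier ?H \<noteq> {\<zero>\<^bsub>?H\<^esub>}" using M(2) by simp
  ultimately show "?H \<in> irr_pairs" using H unfolding irr_pairs_def by blast
qed

text \<open>The common kernel N is invariant. If it were nonzero, it would contain a minimal
  invariant M, whose pair is linked by some nonzero s to its representative. Projecting A onto M and
  applying s is then an intertwiner that does not vanish on M, although M lies in N.\<close>

lemma irr_reps_total:
  fixes X :: "'v hilb set"
  assumes X: "qset X" and a: "\<And>i. a i \<in> carrier (Proj X)"
  shows "qtotal X (irr_reps :: 'v hilb set) (intertwiners X irr_reps a irr_proj)" (is "qtotal X ?R _")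
  unfolding qtotal_def
proof (intro ballI impI)
  fix A x assume A: "A \<in> X" and x: "x \<in> carrier A"
    and 0: "\<forall>B\<in>?R. \<forall>r\<in>intertwiners X ?R a irr_proj (A, B). r x = \<zero>\<^bsub>B\<^esub>"
  note fd = qsetD(1)[OF X A]
  note qs = qset_irr_reps[where 'v = 'v]
  have aA: "is_proj A (a i A)" for i using a[of i] A carrier_Proj[OF X] by blast
  note Iq = intertwiners_qRel[of X ?R a irr_proj, OF X qs a irr_proj_Proj]
  define N where "N = {x \<in> carrier A. \<forall>B\<in>?R. \<forall>r\<in>intertwiners X ?R a irr_proj (A, B). r x = \<zero>\<^bsub>B\<^esub>}"
  have NI: "z \<in> N" if "z \<in> carrier A"
    "\<And>B r. B \<in> ?R \<Longrightarrow> r \<in> intertwiners X ?R a irr_proj (A, B) \<Longrightarrow> r z = \<zero>\<^bsub>B\<^esub>" for z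
    using that by (simp add: N_def)
  have NC: "z \<in> carrier A" if "z \<in> N" for z using that by (simp add: N_def)
  have NZ: "r z = \<zero>\<^bsub>B\<^esub>" if "z \<in> N" "B \<in> ?R" "r \<in> intertwiners X ?R a irr_proj (A, B)" for z B r
    using that unfolding N_def by blast
  have N: "invariant A (\<lambda>i. a i A) N"
    unfolding invariant_def csubspace_iff[OF fd_hilbert_cvs[OF fd]]
  proof (intro conjI ballI allI)
    show "N \<subseteq> carrier A" by (auto simp: N_def)
    have ro: "r \<in> ops A B" "fd_hilbert B" if "B \<in> ?R" "r \<in> intertwiners X ?R a irr_proj (A, B)" for B r
      using qRel_ops[OF Iq A that] qsetD(1)[OF qs that(1)] by auto
    have "r \<zero>\<^bsub>A\<^esub> = \<zero>\<^bsub>B\<^esub>" if "B \<in> ?R" "r \<in> intertwiners X ?R a irr_proj (A, B)" for B r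
      using ops_zero[OF ro(1)[OF that] fd ro(2)[OF that]] .
    then show "\<zero>\<^bsub>A\<^esub> \<in> N" using fd by (intro NI) simp_all
    fix x assume x: "x \<in> N"
    have "r (x \<oplus>\<^bsub>A\<^esub> y) = \<zero>\<^bsub>B\<^esub>"
      if B: "B \<in> ?R" and r: "r \<in> intertwiners X ?R a irr_proj (A, B)" and y: "y \<in> N" for B r y
      using ops_add[OF ro(1)[OF B r] NC[OF x] NC[OF y]] NZ[OF x B r] NZ[OF y B r] ro(2)[OF B r] by simp
    then show "x \<oplus>\<^bsub>A\<^esub> y \<in> N" if "y \<in> N" for y
      using that NC[OF x] NC[OF that] fd by (intro NI) simp_all
    have "r (c \<odot>\<^bsub>A\<^esub> x) = \<zero>\<^bsub>B\<^esub>"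
      if "B \<in> ?R" "r \<in> intertwiners X ?R a irr_proj (A, B)" for B r c
      using ops_smult[OF ro(1)[OF that] NC[OF x], of c] NZ[OF x that] ro(2)[OF that] by simp
    then show "c \<odot>\<^bsub>A\<^esub> x \<in> N" for c using NC[OF x] fd by (intro NI) simp_all
    show "a i A x \<in> N" for i
    proof -
      have xA: "x \<in> carrier A" using x by (simp add: N_def)
      have "r (a i A x) = \<zero>\<^bsub>B\<^esub>" if B: "B \<in> ?R" and r: "r \<in> intertwiners X ?R a irr_proj (A, B)" for B r
      proof -
        have "r (a i A x) = irr_proj i B (r x)" using r A B xA by (simp add: intertwiners_apply)
        also have "r x = \<zero>\<^bsub>B\<^esub>" by (rule NZ[OF x B r])
        also have "irr_proj i B \<zero>\<^bsub>B\<^esub> = \<zero>\<^bsub>B\<^esub>"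
          by (rule ops_zero[OF Proj_ops[OF qs irr_proj_Proj B] ro(2)[OF B r] ro(2)[OF B r]])
        finally show ?thesis .
      qed
      then show ?thesis using ops_closed[OF is_projD(1)[OF aA] xA] by (simp add: N_def)
    qed
  qed
  have "N = {\<zero>\<^bsub>A\<^esub>}"
  proof (rule ccontr)
    assume "N \<noteq> {\<zero>\<^bsub>A\<^esub>}"
    then obtain M where MN: "M \<subseteq> N" and M: "invariant A (\<lambda>i. a i A) M" "M \<noteq> {\<zero>\<^bsub>A\<^esub>}"
      and min: "\<And>W. W \<subseteq> M \<Longrightarrow> invariant A (\<lambda>i. a i A) W \<Longrightarrow> W = {\<zero>\<^bsub>A\<^esub>} \<or> W = M"
      using minimal_invariant[OF fd N] by blast
    let ?H = "A\<lparr>carrier := M, mult := encode A (\<lambda>i. a i A)\<rparr>"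
    note H = minimal_invariant_irr_pairs[of A "\<lambda>i. a i A" M, OF fd aA M min]
    have Ms: "csubspace A M" and aM: "\<And>i x. x \<in> M \<Longrightarrow> a i A x \<in> M" using M by (auto simp: invariant_def)
    note MD = csubspaceD[OF Ms fd_hilbert_cvs[OF fd]]
    let ?B = "irr_rep ?H"
    have B: "?B \<in> ?R" using H(1) by (auto simp: irr_reps_def)
    note fdH = irr_pairsD(1)[OF H(1)] and fdB = qsetD(1)[OF qs B]
    obtain s where s: "s \<in> ops ?H ?B" "s \<noteq> \<zero>\<^bsub>lin_ops ?H ?B\<^esub>"
      and se: "\<And>i x. x \<in> carrier ?H \<Longrightarrow> s (decode i ?H x) = decode i ?B (s x)"
      using irr_rep(2)[OF H(1)] unfolding linked_def by blast
    have pM: "proj A M x \<in> M" if "x \<in> carrier A" for x using proj_spec(1)[OF fd Ms that] .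
    have "proj A M \<in> ops A ?H"
      using proj_ops[OF fd Ms] pM unfolding ops_iff by simp
    then have r: "op_comp A s (proj A M) \<in> ops A ?B" using s(1) fd by (rule op_comp_closed)
    \<comment> \<open>A self-adjoint operator that leaves M invariant commutes with the projection
      onto M.\<close>
    have comm: "proj A M (a i A x) = a i A (proj A M x)" if x: "x \<in> carrier A" for i x
    proof (rule proj_eqI[OF fd Ms])
      note ac = ops_closed[OF is_projD(1)[OF aA]]
      show "a i A x \<in> carrier A" using ac x .
      show "a i A (proj A M x) \<in> M" using aM pM x by blast
      fix u assume u: "u \<in> M"
      have pA: "proj A M x \<in> carrier A" using pM[OF x] MD(1) by blast
      have "inner A u (a i A (proj A M x)) = inner A (a i A u) (proj A M x)"
        using is_projD(3)[OF aA MD(1)[OF u] pA] by simp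
      also have "\<dots> = inner A (a i A u) x" by (rule proj_spec(2)[OF fd Ms x aM[OF u]])
      also have "\<dots> = inner A u (a i A x)" by (rule is_projD(3)[OF aA MD(1)[OF u] x])
      finally show "inner A u (a i A (proj A M x)) = inner A u (a i A x)" .
    qed
    have "op_comp A s (proj A M) (a i A x) = irr_proj i ?B (op_comp A s (proj A M) x)" if x: "x \<in> carrier A" for i x
    proof -
      have "op_comp A s (proj A M) (a i A x) = s (a i A (proj A M x))"
        using comm[OF x] ops_closed[OF is_projD(1)[OF aA] x] by simp
      also have "a i A (proj A M x) = decode i ?H (proj A M x)" using pM[OF x] by (simp add: H(2))
      also have "s \<dots> = decode i ?B (s (proj A M x))" using se pM[OF x] by simp
      finally show ?thesis using x B by (simp add: irr_proj_apply)
    qed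
    then have rI: "op_comp A s (proj A M) \<in> intertwiners X ?R a irr_proj (A, ?B)"
      using r A B by (simp add: intertwiners_apply)
    obtain y where y: "y \<in> carrier ?H" "s y \<noteq> \<zero>\<^bsub>?B\<^esub>" using nonzero_op_witness[OF fdH fdB s] by blast
    then have yM: "y \<in> M" by simp
    have "op_comp A s (proj A M) y = s y" using proj_ident[OF fd Ms yM] MD(1)[OF yM] by simp
    moreover have "op_comp A s (proj A M) y = \<zero>\<^bsub>?B\<^esub>" using yM MN rI B unfolding N_def by blast
    ultimately show False using y(2) by simp
  qed
  moreover have "x \<in> N" using x 0 by (simp add: N_def)
  ultimately show "x = \<zero>\<^bsub>A\<^esub>" by blast
qed

lemma intertwiners_irr_reps_qFun:
  fixes X :: "'v hilb set"
  assumes X: "qset X" and a: "\<And>i. a i \<in> carrier (Proj X)"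
  shows "intertwiners X irr_reps a irr_proj \<in> qFun X (irr_reps :: 'v hilb set)"
  by (rule intertwiners_qFun[OF X qset_irr_reps a irr_proj_Proj irr_reps_schur irr_reps_total[OF X a]])

lemma q_true_ops: "C \<in> q_bool \<Longrightarrow> q_true C \<in> ops C C"
  by (rule Proj_ops[OF qset_q_bool q_true_Proj])

text \<open>Under \<open>fun_star\<close>, functions to \<open>q_bool\<close> are single
  projections, and functions to \<open>irr_reps\<close> are pairs of them, the images of the two
  members of \<open>irr_proj\<close>. The universal property becomes the fact that two projections
  form a unique pair.\<close>

lemma is_qprod_irr_reps:
  "is_qprod q_bool q_bool (irr_reps :: 'v hilb set, Proj_to_Fun irr_reps (irr_proj True), Proj_to_Fun irr_reps (irr_proj False))"
proof -
  let ?P = "irr_reps :: 'v hilb set"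
  let ?Q = "\<lambda>i. Proj_to_Fun ?P (irr_proj i)"
  note P = qset_irr_reps[where 'v = 'v]
  have Q: "?Q i \<in> qFun ?P q_bool" for i by (rule Proj_to_Fun_qFun[OF P irr_proj_Proj])
  have "\<exists>!G. G \<in> qFun Z ?P \<and> rel_comp Z ?P q_bool (?Q True) G = F1 \<and> rel_comp Z ?P q_bool (?Q False) G = F2"
    if Z: "qset Z" and F1: "F1 \<in> qFun Z q_bool" and F2: "F2 \<in> qFun Z q_bool" for Z :: "'v hilb set" and F1 F2
  proof -
    define F where "F i = (if i then F1 else F2)" for i
    have F: "F i \<in> qFun Z q_bool" for i using F1 F2 by (simp add: F_def)
    define a where "a i = fun_star Z q_bool (F i) q_true" for i
    have a: "a i \<in> carrier (Proj Z)" for i unfolding a_def by (rule fun_star_Proj[OF Z qset_q_bool F q_true_Proj])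
    let ?G = "intertwiners Z ?P a irr_proj"
    have G: "?G \<in> qFun Z ?P" by (rule intertwiners_irr_reps_qFun[OF Z a])
    \<comment> \<open>Composition with the structure map for i carries t to the image of
      \<open>irr_proj i\<close> under K, so existence and uniqueness both reduce to
      intertwiners.\<close>
    have star: "fun_star Z q_bool (rel_comp Z ?P q_bool (?Q i) K) q_true = fun_star Z ?P K (irr_proj i)"
      if K: "K \<in> qFun Z ?P" for K i
      using fun_star_rel_comp[OF Z P qset_q_bool K Q q_true_ops] fun_star_Proj_to_Fun[OF P irr_proj_Proj] by simp
    have "rel_comp Z ?P q_bool (?Q i) ?G = F i" for i
    proof (rule fun_star_q_true_inj[OF Z qFun_rel_comp[OF Z P qset_q_bool G Q] F])
      show "fun_star Z q_bool (rel_comp Z ?P q_bool (?Q i) ?G) q_true = fun_star Z q_bool (F i) q_true"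
        using star[OF G] fun_star_intertwiners[of Z ?P a irr_proj, OF Z P a irr_proj_Proj G] a_def by simp
    qed
    from this[of True] this[of False]
    have ex: "rel_comp Z ?P q_bool (?Q True) ?G = F1" "rel_comp Z ?P q_bool (?Q False) ?G = F2" by (simp_all add: F_def)
    have un: "K = ?G" if K: "K \<in> qFun Z ?P" and K1: "rel_comp Z ?P q_bool (?Q True) K = F1"
      and K2: "rel_comp Z ?P q_bool (?Q False) K = F2" for K
    proof (rule eq_intertwiners[OF Z P a irr_proj_Proj G K])
      show "fun_star Z ?P K (irr_proj i) = a i" for i
        using star[OF K, of i] K1 K2 by (cases i) (simp_all add: a_def F_def)
    qed
    show ?thesis using G ex un by (intro ex1I[of _ ?G]) blast+
  qed
  then show ?thesis using P Q unfolding is_qprod_def by simp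
qed

text \<open>The witness \<open>irr_reps\<close> makes the choice in \<open>bb_prod\<close>
  meaningful. The chosen \<open>BB\<close> may be a different product, so what follows relies on the
  universal property.\<close>

lemma is_qprod_BB: "is_qprod q_bool q_bool (BB :: 'v hilb set, BQ1, BQ2)"
  using someI[of "is_qprod q_bool q_bool", OF is_qprod_irr_reps[where 'v = 'v]]
  by (simp add: BB_def BQ1_def BQ2_def bb_prod_def)

lemma qset_BB: "qset (BB :: 'v hilb set)"
  and BQ1_qFun: "BQ1 \<in> qFun (BB :: 'v hilb set) q_bool"
  and BQ2_qFun: "BQ2 \<in> qFun (BB :: 'v hilb set) q_bool"
  using is_qprod_BB[where 'v = 'v] by (simp_all add: is_qprod_def)

lemma bb_pair:
  assumes X: "qset (X :: 'v hilb set)" and F: "F1 \<in> qFun X q_bool" "F2 \<in> qFun X q_bool"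
  shows "bb_pair X F1 F2 \<in> qFun X BB" "rel_comp X BB q_bool BQ1 (bb_pair X F1 F2) = F1"
    "rel_comp X BB q_bool BQ2 (bb_pair X F1 F2) = F2"
proof -
  have "\<exists>!G. G \<in> qFun X (BB :: 'v hilb set) \<and> rel_comp X BB q_bool BQ1 G = F1 \<and> rel_comp X BB q_bool BQ2 G = F2"
    using conjunct2[OF conjunct2[OF conjunct2[OF is_qprod_BB[where 'v = 'v, unfolded is_qprod_def prod.case]]],
        rule_format, OF X F] .
  from theI'[OF this] show "bb_pair X F1 F2 \<in> qFun X BB" "rel_comp X BB q_bool BQ1 (bb_pair X F1 F2) = F1"
    "rel_comp X BB q_bool BQ2 (bb_pair X F1 F2) = F2" by (simp_all add: bb_pair_def)
qed

section \<open>The functor of functions to the two-element quantum set\<close>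

context
  fixes X :: "'v hilb set"
  assumes X: "qset X"
begin

lemma fun_star_comp_bb_pair:
  assumes F: "F1 \<in> qFun X q_bool" "F2 \<in> qFun X q_bool"
  shows "fun_star X BB (bb_pair X F1 F2) (fun_star BB q_bool BQ1 q_true) = fun_star X q_bool F1 q_true"
    and "fun_star X BB (bb_pair X F1 F2) (fun_star BB q_bool BQ2 q_true) = fun_star X q_bool F2 q_true"
  using fun_star_rel_comp[OF X qset_BB qset_q_bool bb_pair(1)[OF X F] BQ1_qFun q_true_ops]
    fun_star_rel_comp[OF X qset_BB qset_q_bool bb_pair(1)[OF X F] BQ2_qFun q_true_ops]
    bb_pair(2,3)[OF X F] by simp_all

text \<open>Serves both binary connectives: p is the projection on the product by which the
  connective V is defined.\<close>

lemma fun_star_comp_bb: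
  assumes F: "F1 \<in> qFun X q_bool" "F2 \<in> qFun X q_bool" and p: "p \<in> carrier (Proj BB)"
    and V: "V = (THE V. V \<in> qFun (BB :: 'v hilb set) q_bool \<and> fun_star BB q_bool V q_true = p)"
  shows "rel_comp X BB q_bool V (bb_pair X F1 F2) \<in> qFun X q_bool"
    and "fun_star X q_bool (rel_comp X BB q_bool V (bb_pair X F1 F2)) q_true = fun_star X BB (bb_pair X F1 F2) p"
proof -
  have V': "V = Proj_to_Fun BB p" using V the_fun_star_q_true[OF qset_BB p] by simp
  have Vf: "V \<in> qFun BB q_bool" unfolding V' by (rule Proj_to_Fun_qFun[OF qset_BB p])
  show "rel_comp X BB q_bool V (bb_pair X F1 F2) \<in> qFun X q_bool"
    by (rule qFun_rel_comp[OF X qset_BB qset_q_bool bb_pair(1)[OF X F] Vf])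
  show "fun_star X q_bool (rel_comp X BB q_bool V (bb_pair X F1 F2)) q_true = fun_star X BB (bb_pair X F1 F2) p"
    using fun_star_rel_comp[OF X qset_BB qset_q_bool bb_pair(1)[OF X F] Vf q_true_ops]
      fun_star_Proj_to_Fun[OF qset_BB p] V' by simp
qed

text \<open>Applied to the pairing; the functor of projections is available because X and the
  product lie over the same type.\<close>

lemma fun_star_hom:
  assumes "qset (Y :: 'v hilb set)" "G \<in> qFun X Y" shows "fun_star X Y G \<in> ortho_hom (Proj Y) (Proj X)"
  using ProjF_natural_iso(1)[where 'v = 'v] X assms unfolding contravariant_functor_def ProjF_def qfunctor.simps by blast

text \<open>The pairing acts on projections as an ortholattice morphism. It therefore takes the join
  of Q1^star(t) and Q2^star(t) on the product to the join of their images, which are F1^star(t) and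
  F2^star(t).\<close>

lemma fun_or:
  assumes F: "F1 \<in> qFun X q_bool" "F2 \<in> qFun X q_bool"
  shows "fun_or X F1 F2 \<in> qFun X q_bool"
    and "fun_star X q_bool (fun_or X F1 F2) q_true
      = ojoin (Proj X) (fun_star X q_bool F1 q_true) (fun_star X q_bool F2 q_true)"
proof -
  interpret B: ortholattice "Proj (BB :: 'v hilb set)" by (rule ortholattice_Proj(1)[OF qset_BB])
  note q = fun_star_Proj[OF qset_BB[where 'v = 'v] qset_q_bool BQ1_qFun q_true_Proj]
    fun_star_Proj[OF qset_BB[where 'v = 'v] qset_q_bool BQ2_qFun q_true_Proj]
  note S = fun_star_comp_bb[OF F B.ojoin_closed[OF q] q_or_def]
  show "fun_or X F1 F2 \<in> qFun X q_bool" unfolding fun_or_def by (rule S(1))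
  show "fun_star X q_bool (fun_or X F1 F2) q_true
      = ojoin (Proj X) (fun_star X q_bool F1 q_true) (fun_star X q_bool F2 q_true)"
    using S(2) fun_star_hom[OF qset_BB bb_pair(1)[OF X F]] q fun_star_comp_bb_pair[OF F]
    unfolding fun_or_def ortho_hom_def by simp
qed

lemma fun_and:
  assumes F: "F1 \<in> qFun X q_bool" "F2 \<in> qFun X q_bool"
  shows "fun_and X F1 F2 \<in> qFun X q_bool"
    and "fun_star X q_bool (fun_and X F1 F2) q_true
      = omeet (Proj X) (fun_star X q_bool F1 q_true) (fun_star X q_bool F2 q_true)"
proof -
  interpret B: ortholattice "Proj (BB :: 'v hilb set)" by (rule ortholattice_Proj(1)[OF qset_BB])
  note q = fun_star_Proj[OF qset_BB[where 'v = 'v] qset_q_bool BQ1_qFun q_true_Proj]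
    fun_star_Proj[OF qset_BB[where 'v = 'v] qset_q_bool BQ2_qFun q_true_Proj]
  note S = fun_star_comp_bb[OF F B.omeet_closed[OF q] q_and_def]
  show "fun_and X F1 F2 \<in> qFun X q_bool" unfolding fun_and_def by (rule S(1))
  show "fun_star X q_bool (fun_and X F1 F2) q_true
      = omeet (Proj X) (fun_star X q_bool F1 q_true) (fun_star X q_bool F2 q_true)"
    using S(2) fun_star_hom[OF qset_BB bb_pair(1)[OF X F]] q fun_star_comp_bb_pair[OF F]
    unfolding fun_and_def ortho_hom_def by simp
qed

lemma ocompl_Proj: "ocompl (Proj X) = ell_compl X"
  by (simp add: Proj_def)

lemma ell_compl_Proj: "p \<in> carrier (Proj X) \<Longrightarrow> ell_compl X p \<in> carrier (Proj X)"
  using ortholattice.ocompl_closed[OF ortholattice_Proj(1)[OF X]] ocompl_Proj by metis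

end

text \<open>The functor of projections compares quantum sets over one type, whereas
  \<open>q_bool\<close> lies over its own; compatibility with complements across types is obtained
  from the intertwining law.\<close>

lemma fun_star_ell_compl:
  assumes X: "qset X" and Y: "qset Y" and F: "F \<in> qFun X Y" and p: "p \<in> carrier (Proj Y)"
  shows "fun_star X Y F (ell_compl Y p) = ell_compl X (fun_star X Y F p)"
proof (rule fun_star_eqI[OF X Y F])
  have Fr: "F \<in> qRel X Y" and fn: "qfunctional X Y F" using F qFun_iff[OF X Y] by auto
  note c = ell_compl_Proj[OF X fun_star_Proj[OF X Y F p]]
  show "ell_compl Y p B \<in> ops B B" if "B \<in> Y" for B by (rule Proj_ops[OF Y ell_compl_Proj[OF Y p] that])
  show "ell_compl X (fun_star X Y F p) A \<in> ops A A" if "A \<in> X" for A by (rule Proj_ops[OF X c that])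
  show "ell_compl X (fun_star X Y F p) \<in> extensional X" by (simp add: ell_compl_def)
  fix A B r x assume A: "A \<in> X" and B: "B \<in> Y" and r: "r \<in> F (A, B)" and x: "x \<in> carrier A"
  note [simp] = qsetD(1)[OF X A] qsetD(1)[OF Y B]
  have ro: "r \<in> ops A B" by (rule qRel_ops[OF Fr A B r])
  have q: "fun_star X Y F p A \<in> ops A A" by (rule Proj_ops[OF X fun_star_Proj[OF X Y F p] A])
  have pB: "p B \<in> ops B B" by (rule Proj_ops[OF Y p B])
  have rx: "r x \<in> carrier B" "fun_star X Y F p A x \<in> carrier A" using ops_closed[OF ro x] ops_closed[OF q x] by auto
  have "r (fun_star X Y F p A x) = p B (r x)"
    by (rule fun_star_intertwines[OF X Y Fr fn Proj_ops[OF Y p] A B r x])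
  then show "r (ell_compl X (fun_star X Y F p) A x) = ell_compl Y p B (r x)"
    using A B x rx q pB ops_minus[OF ro, of x "fun_star X Y F p A x"] by (simp add: ell_compl_def)
qed

lemma q_not: "q_not \<in> qFun q_bool q_bool" "fun_star q_bool q_bool q_not q_true = ell_compl q_bool q_true"
proof -
  note p = ell_compl_Proj[OF qset_q_bool q_true_Proj]
  have "q_not = Proj_to_Fun q_bool (ell_compl q_bool q_true)"
    unfolding q_not_def by (rule the_fun_star_q_true[OF qset_q_bool p])
  then show "q_not \<in> qFun q_bool q_bool" "fun_star q_bool q_bool q_not q_true = ell_compl q_bool q_true"
    using Proj_to_Fun_qFun[OF qset_q_bool p] fun_star_Proj_to_Fun[OF qset_q_bool p] by simp_all
qed

lemma fun_not:
  assumes X: "qset X" and F: "F \<in> qFun X q_bool"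
  shows "fun_not X F \<in> qFun X q_bool"
    and "fun_star X q_bool (fun_not X F) q_true = ell_compl X (fun_star X q_bool F q_true)"
  unfolding fun_not_def
  using qFun_rel_comp[OF X qset_q_bool qset_q_bool F q_not(1)] q_not(2)
    fun_star_rel_comp[OF X qset_q_bool qset_q_bool F q_not(1) q_true_ops]
    fun_star_ell_compl[OF X qset_q_bool F q_true_Proj] by simp_all

text \<open>The connectives have been computed on \<open>q_true\<close>, where functions are
  determined. The order of \<open>Fun_bool\<close> is defined through its join, so it matches that
  of the projections by \<open>le_iff_ojoin\<close>.\<close>

lemma ortholattice_Fun_bool:
  assumes X: "qset X"
  shows "ortholattice (Fun_bool X)" "Proj_to_Fun X \<in> ortho_iso (Proj X) (Fun_bool X)"
proof -
  interpret P: ortholattice "Proj X" by (rule ortholattice_Proj(1)[OF X])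
  note F = Proj_to_Fun_qFun[OF X]
  note inv = fun_star_Proj_to_Fun[OF X]
  have eqI: "G = Proj_to_Fun X p" if "G \<in> qFun X q_bool" "p \<in> carrier (Proj X)" "fun_star X q_bool G q_true = p" for G p
    using fun_star_q_true_inj[OF X that(1) F[OF that(2)]] inv[OF that(2)] that(3) by simp
  have j: "fun_or X (Proj_to_Fun X p) (Proj_to_Fun X q) = Proj_to_Fun X (ojoin (Proj X) p q)"
    and m: "fun_and X (Proj_to_Fun X p) (Proj_to_Fun X q) = Proj_to_Fun X (omeet (Proj X) p q)"
    if "p \<in> carrier (Proj X)" "q \<in> carrier (Proj X)" for p q
  proof -
    note Fpq = F[OF that(1)] F[OF that(2)]
    show "fun_or X (Proj_to_Fun X p) (Proj_to_Fun X q) = Proj_to_Fun X (ojoin (Proj X) p q)"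
      by (rule eqI[OF fun_or(1)[OF X Fpq] P.ojoin_closed[OF that]]) (simp add: fun_or(2)[OF X Fpq] inv that)
    show "fun_and X (Proj_to_Fun X p) (Proj_to_Fun X q) = Proj_to_Fun X (omeet (Proj X) p q)"
      by (rule eqI[OF fun_and(1)[OF X Fpq] P.omeet_closed[OF that]]) (simp add: fun_and(2)[OF X Fpq] inv that)
  qed
  have c: "fun_not X (Proj_to_Fun X p) = Proj_to_Fun X (ocompl (Proj X) p)" if "p \<in> carrier (Proj X)" for p
    by (rule eqI[OF fun_not(1)[OF X F[OF that]] P.ocompl_closed[OF that]])
      (simp add: fun_not(2)[OF X F[OF that]] inv[OF that] ocompl_Proj[OF X])
  have "Proj_to_Fun X (ojoin (Proj X) p q) = Proj_to_Fun X q \<longleftrightarrow> p \<sqsubseteq>\<^bsub>Proj X\<^esub> q"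
    if "p \<in> carrier (Proj X)" "q \<in> carrier (Proj X)" for p q
    using that inv P.ojoin_closed P.le_iff_ojoin by metis
  then show "ortholattice (Fun_bool X)" "Proj_to_Fun X \<in> ortho_iso (Proj X) (Fun_bool X)"
    using ortholattice_transport[of "Proj X" "Proj_to_Fun X" "Fun_bool X"] bij_Proj_to_Fun[OF X] P.ortholattice_axioms
      j m c by (simp_all add: Fun_bool_def)
qed

text \<open>Functions to \<open>q_bool\<close> are determined by their action on
  \<open>q_true\<close>, and there both sides give F^star(p).\<close>

lemma Proj_to_Fun_fun_star_comp:
  assumes X: "qset X" and Y: "qset Y" and F: "F \<in> qFun X Y" and p: "p \<in> carrier (Proj Y)"
  shows "Proj_to_Fun X (fun_star X Y F p) = rel_comp X Y q_bool (Proj_to_Fun Y p) F"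
proof (rule fun_star_q_true_inj[OF X])
  note G = Proj_to_Fun_qFun[OF Y p] and q = fun_star_Proj[OF X Y F p]
  show "Proj_to_Fun X (fun_star X Y F p) \<in> qFun X q_bool" by (rule Proj_to_Fun_qFun[OF X q])
  show "rel_comp X Y q_bool (Proj_to_Fun Y p) F \<in> qFun X q_bool" by (rule qFun_rel_comp[OF X Y qset_q_bool F G])
  show "fun_star X q_bool (Proj_to_Fun X (fun_star X Y F p)) q_true
      = fun_star X q_bool (rel_comp X Y q_bool (Proj_to_Fun Y p) F) q_true"
    using fun_star_rel_comp[OF X Y qset_q_bool F G q_true_ops] fun_star_Proj_to_Fun[OF X q] fun_star_Proj_to_Fun[OF Y p]
    by simp
qed

lemma FunF_natural_iso:
  "contravariant_functor (FunF :: ('v, ('v, nat \<Rightarrow> complex) qrel) qfunctor)"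
  "naturally_isomorphic (ProjF :: ('v, 'v hilb \<Rightarrow> 'v \<Rightarrow> 'v) qfunctor) FunF"
proof -
  note T = contravariant_functor_transport[of "ProjF :: ('v, 'v hilb \<Rightarrow> 'v \<Rightarrow> 'v) qfunctor" FunF Proj_to_Fun,
      OF ProjF_natural_iso(1)]
  show "contravariant_functor (FunF :: ('v, ('v, nat \<Rightarrow> complex) qrel) qfunctor)"
    "naturally_isomorphic (ProjF :: ('v, 'v hilb \<Rightarrow> 'v \<Rightarrow> 'v) qfunctor) FunF"
    by (rule T; simp add: ProjF_def FunF_def ortholattice_Fun_bool Proj_to_Fun_fun_star_comp)+
qed

theorem theoremB8:
  shows "contravariant_functor (PredF :: ('v, 'v hilb \<Rightarrow> 'v set) qfunctor)
    \<and> contravariant_functor (RelF :: ('v, ('v, complex) qrel) qfunctor)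
    \<and> contravariant_functor (ProjF :: ('v, 'v hilb \<Rightarrow> 'v \<Rightarrow> 'v) qfunctor)
    \<and> contravariant_functor (FunF :: ('v, ('v, nat \<Rightarrow> complex) qrel) qfunctor)
    \<and> naturally_isomorphic (PredF :: ('v, 'v hilb \<Rightarrow> 'v set) qfunctor) RelF
    \<and> naturally_isomorphic (RelF :: ('v, ('v, complex) qrel) qfunctor) ProjF
    \<and> naturally_isomorphic (ProjF :: ('v, 'v hilb \<Rightarrow> 'v \<Rightarrow> 'v) qfunctor) FunF"
  \<comment> \<open>The isomorphism from relations to projections is composed through the
    predicates, with the first leg inverted.\<close>
  by (intro conjI contravariant_functor_PredF RelF_natural_iso ProjF_natural_iso(1) FunF_natural_iso
      naturally_isomorphic_trans[OF RelF_natural_iso(1) naturally_isomorphic_sym[OF contravariant_functor_PredF RelF_natural_iso]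
        ProjF_natural_iso(2)])

end
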